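(* Let $N\ge 1$ and $1\le p<\infty$. Then for every $u\in W^{2,p}(\mathbb{R}^N)$ we have $$H_nu\to\nabla^2u\quad\text{in }L^p(\mathbb{R}^N,\mathbb{R}^{N\times N})\quad\text{as }n\to\infty.$$
   Context: Standing assumptions: $(\rho_n)_{n\in\mathbb{N}}$ is a sequence of radial functions on $\mathbb{R}^N$ such that for all $n$: $\rho_n\ge 0$, $\int_{\mathbb{R}^N}\rho_n(x)\,dx=1$, and $\lim_{n\to\infty}\int_{|x|>\gamma}\rho_n(x)\,dx=0$ for every $\gamma>0$. Non-local Hessian (a Lebesgue integral, defined for almost every $x$ when $u\in W^{2,p}(\mathbb{R}^N)$): $$H_nu(x):=\frac{N(N+2)}{2}\int_{\mathbb{R}^N}\frac{u(x+h)-2u(x)+u(x-h)}{|h|^2}\,\frac{h\otimes h-\frac{|h|^2}{N+2}I_N}{|h|^2}\,\rho_n(h)\,dh\in\mathbb{R}^{N\times N},$$ where $I_N$ is the $N\times N$ identity matrix and $h\otimes h=hh^{\top}$. $\nabla^2u$ is the weak Hessian of $u$. $|\cdot|$ denotes the Euclidean norm for vectors and the Frobenius norm for matrices. *)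

theory Defs
  imports "HOL-Analysis.Analysis"
begin

text \<open>
  The ambient space is \<^typ>\<open>real ^ 'n\<close>, so that N is \<^term>\<open>CARD('n)\<close>. Matrices have type
  \<^typ>\<open>real ^ 'n ^ 'n\<close>, whose library norm (the Euclidean norm of the vector of Euclidean norms
  of the rows) is the Frobenius norm. Functions are Lebesgue (not only Borel) measurable.
\<close>

subsection \<open>Lebesgue spaces\<close>

definition Lp_fun :: "real \<Rightarrow> ('a::euclidean_space \<Rightarrow> 'b::euclidean_space) \<Rightarrow> bool" where
  "Lp_fun p f \<longleftrightarrow>
     f \<in> borel_measurable lebesgue \<and> integrable lebesgue (\<lambda>x. norm (f x) powr p)"

definition Lp_norm :: "real \<Rightarrow> ('a::euclidean_space \<Rightarrow> 'b::euclidean_space) \<Rightarrow> real" where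
  "Lp_norm p f = (LINT x|lebesgue. norm (f x) powr p) powr (1 / p)"

text \<open>
  \<^const>\<open>Lp_norm\<close> takes a junk value outside the space, so membership of all the functions is
  part of convergence.
\<close>

definition Lp_tendsto ::
  "real \<Rightarrow> (nat \<Rightarrow> 'a::euclidean_space \<Rightarrow> 'b::euclidean_space) \<Rightarrow> ('a \<Rightarrow> 'b) \<Rightarrow> bool" where
  "Lp_tendsto p F f \<longleftrightarrow>
     (\<forall>n. Lp_fun p (F n)) \<and> Lp_fun p f \<and> (\<lambda>n. Lp_norm p (\<lambda>x. F n x - f x)) \<longlonglongrightarrow> 0"

definition locally_integrable :: "('a::euclidean_space \<Rightarrow> real) \<Rightarrow> bool" where
  "locally_integrable f \<longleftrightarrow> (\<forall>K. compact K \<longrightarrow> set_integrable lebesgue K f)"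

subsection \<open>Weak derivatives and Sobolev spaces\<close>

definition partial_deriv :: "'n \<Rightarrow> (real ^ 'n \<Rightarrow> real) \<Rightarrow> real ^ 'n \<Rightarrow> real" where
  "partial_deriv i f x = frechet_derivative f (at x) (axis i 1)"

text \<open>
  Multi-indices are represented by lists of coordinate directions; the order of a derivative is
  the length of its list.
\<close>

primrec partial_derivs :: "'n list \<Rightarrow> (real ^ 'n \<Rightarrow> real) \<Rightarrow> real ^ 'n \<Rightarrow> real" where
  "partial_derivs [] f = f"
| "partial_derivs (i # is) f = partial_deriv i (partial_derivs is f)"

text \<open>
  A function is infinitely often continuously differentiable iff each of its iterated partial
  derivatives is everywhere (hence also continuous and) differentiable.
\<close>

definition smooth_fun :: "(real ^ 'n \<Rightarrow> real) \<Rightarrow> bool" where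
  "smooth_fun f \<longleftrightarrow> (\<forall>is x. partial_derivs is f differentiable (at x))"

definition test_fun :: "(real ^ 'n \<Rightarrow> real) \<Rightarrow> bool" where
  "test_fun \<phi> \<longleftrightarrow> smooth_fun \<phi> \<and> compact (closure {x. \<phi> x \<noteq> 0})"

definition weak_deriv :: "'n list \<Rightarrow> (real ^ 'n \<Rightarrow> real) \<Rightarrow> (real ^ 'n \<Rightarrow> real) \<Rightarrow> bool" where
  "weak_deriv is u v \<longleftrightarrow>
     locally_integrable u \<and> locally_integrable v \<and>
     (\<forall>\<phi>. test_fun \<phi> \<longrightarrow>
        (LINT x|lebesgue. u x * partial_derivs is \<phi> x)
          = (-1) ^ length is * (LINT x|lebesgue. v x * \<phi> x))"

definition sobolev :: "nat \<Rightarrow> real \<Rightarrow> (real ^ 'n \<Rightarrow> real) \<Rightarrow> bool" where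
  "sobolev k p u \<longleftrightarrow>
     Lp_fun p u \<and> (\<forall>is. length is \<le> k \<longrightarrow> (\<exists>v. Lp_fun p v \<and> weak_deriv is u v))"

text \<open>
  Weak derivatives are unique only up to null sets, so the weak Hessian is a relation.
\<close>

definition has_weak_hessian :: "(real ^ 'n \<Rightarrow> real) \<Rightarrow> (real ^ 'n \<Rightarrow> real ^ 'n ^ 'n) \<Rightarrow> bool" where
  "has_weak_hessian u G \<longleftrightarrow> (\<forall>i j. weak_deriv [i, j] u (\<lambda>x. G x $ i $ j))"

subsection \<open>The non-local Hessian\<close>

definition radial :: "('a::real_normed_vector \<Rightarrow> 'b) \<Rightarrow> bool" where
  "radial f \<longleftrightarrow> (\<forall>x y. norm x = norm y \<longrightarrow> f x = f y)"

definition outer_product :: "real ^ 'n \<Rightarrow> real ^ 'n \<Rightarrow> real ^ 'n ^ 'n" where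
  "outer_product a b = (\<chi> i j. a $ i * b $ j)"

definition nonlocal_hessian_integrand ::
  "(real ^ 'n \<Rightarrow> real) \<Rightarrow> (real ^ 'n \<Rightarrow> real) \<Rightarrow> real ^ 'n \<Rightarrow> real ^ 'n \<Rightarrow> real ^ 'n ^ 'n" where
  "nonlocal_hessian_integrand \<rho> u x h =
     ((u (x + h) - 2 * u x + u (x - h)) / (norm h)\<^sup>2 * \<rho> h) *\<^sub>R
       ((outer_product h h - ((norm h)\<^sup>2 / (real CARD('n) + 2)) *\<^sub>R mat 1) /\<^sub>R (norm h)\<^sup>2)"

text \<open>
  The library integral is 0 where the integrand is not integrable; existence of the integral has
  to be stated separately.
\<close>

definition nonlocal_hessian ::
  "(real ^ 'n \<Rightarrow> real) \<Rightarrow> (real ^ 'n \<Rightarrow> real) \<Rightarrow> real ^ 'n \<Rightarrow> real ^ 'n ^ 'n" where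
  "nonlocal_hessian \<rho> u x =
     (real CARD('n) * (real CARD('n) + 2) / 2) *\<^sub>R
       (LINT h|lebesgue. nonlocal_hessian_integrand \<rho> u x h)"

end

theory Submission
  imports Defs
begin

text \<open>
  Let \<open>N\<close> be the dimension, \<open>C = N(N+2)/2\<close>, \<open>\<omega> = h/|h|\<close> and \<open>k(t) = max 0 (1 - |t|)\<close>. The idea is to eliminate
  \<open>u\<close>. Taylor's formula on the segment from \<open>x - h\<close> to \<open>x + h\<close> has the integral form
  \<open>u(x+h) - 2 u(x) + u(x-h) = \<Sum>ij h_i h_j \<integral> k(t) G_ij(x - t h) dt\<close>,
  valid for every \<open>h\<close> and almost every \<open>x\<close> (lemma \<open>weak_second_difference\<close>). After division by \<open>|h|^2\<close> the
  entry \<open>kl\<close> of the non-local Hessian is therefore \<open>C \<Sum>ij \<integral> \<rho>(h) m_ijkl(h) \<integral> k(t) G_ij(x - t h) dt dh\<close>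
  with the bounded kernels \<open>m_ijkl = \<omega>_i \<omega>_j (\<omega>_k \<omega>_l - \<delta>_kl/(N+2))\<close>: a finite sum of weighted averages of
  translates of functions in \<open>L^p\<close>. Its limit is found by one analytic and one algebraic fact.

  The analytic fact: as \<open>\<rho>\<close> concentrates at the origin, such an average converges in \<open>L^p\<close> to
  \<open>(\<integral> \<rho> m_ijkl) G_ij\<close>. By Jensen's inequality the \<open>p\<close>-th power of the error is at most the average of
  \<open>||G_ij(\<cdot> - t h) - G_ij||^p\<close> against \<open>\<rho>(h) k(t)\<close> (lemma \<open>hat_average_kernel_error\<close>), and translation is continuous in
  \<open>L^p\<close> (\<open>shift_continuous_Lp\<close>, \<open>concentrating_kernel_error_tendsto_0\<close>).

  The algebraic fact: \<open>\<omega>\<close> is a rotation invariant random direction, so its fourth moments are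
  \<open>E[\<omega>_i \<omega>_j \<omega>_k \<omega>_l] = (\<delta>_ij \<delta>_kl + \<delta>_ik \<delta>_jl + \<delta>_il \<delta>_jk) / (N(N+2))\<close> (lemma \<open>expect_coordinates\<close>). The
  term \<open>\<delta>_kl/(N+2)\<close> in the kernel cancels the contribution of the trace, the factor \<open>C\<close> normalises
  the rest, and what remains is \<open>(G_kl + G_lk)/2 = G_kl\<close> (lemma \<open>hessian_kernel_contraction\<close>).

  Taylor's formula itself is proved weakly: tested against a bump function \<open>\<phi>\<close>, the difference
  operator moves over to \<open>\<phi>\<close>, where the formula is classical; Fubini's theorem and the definition of
  the weak derivative move it back, and the fundamental lemma of the calculus of variations
  (\<open>zero_against_box_bumps_imp_zero\<close>) removes \<open>\<phi>\<close>. The same lemma shows that \<open>G\<close> is symmetric and agrees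
  almost everywhere with the \<open>L^p\<close> derivatives that the Sobolev space provides.

  Fubini's theorem needs product measures, so all functions are first replaced by Borel
  functions that agree with them almost everywhere. This destroys radiality of \<open>\<rho>\<close> on a null set
  and leaves invariance under each rotation almost everywhere, which is what the computation of the moments uses.
\<close>

section \<open>Smooth bump functions\<close>

text \<open>
  The polynomial factor in \<open>1/t\<close> makes the family closed under differentiation.
\<close>

definition flat_exp :: "real poly \<Rightarrow> real \<Rightarrow> real" where
  "flat_exp q t = (if 0 < t then poly q (1 / t) * exp (- (1 / t)) else 0)"

lemma tendsto_poly_exp_at_top: "((\<lambda>s. poly q s * exp (- s)) \<longlongrightarrow> (0::real)) at_top"
proof -
  have "((\<lambda>s. \<Sum>i\<le>degree q. coeff q i * (s ^ i / exp s)) \<longlongrightarrow> (\<Sum>i\<le>degree q. coeff q i * 0)) at_top"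
    by (intro tendsto_intros tendsto_power_div_exp_0)
  then show ?thesis
    by (simp add: poly_altdef sum_distrib_right exp_minus divide_inverse mult.assoc)
qed

text \<open>
  With \<open>s = 1/t\<close> one has \<open>ds/dt = - s^2\<close>, so differentiation turns the polynomial \<open>q\<close> into
  \<open>s^2 (q - q')\<close>. At \<open>0\<close> the difference quotient from the right is \<open>s q(s) exp(-s)\<close>, which tends to \<open>0\<close>.
\<close>

lemma flat_exp_has_derivative:
  "(flat_exp q has_real_derivative flat_exp ([:0, 0, 1:] * (q - pderiv q)) t) (at t)"
proof (cases t "0::real" rule: linorder_cases)
  case less
  have ev: "\<forall>\<^sub>F x in nhds t. flat_exp q x = 0"
    using eventually_nhds_in_open[of "{..<0}" t] less
    by (auto simp: flat_exp_def elim!: eventually_mono)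
  then show ?thesis
    using less by (subst DERIV_cong_ev[OF refl ev refl]) (simp add: flat_exp_def)
next
  case greater
  have ev: "\<forall>\<^sub>F x in nhds t. flat_exp q x = poly q (1 / x) * exp (- (1 / x))"
    using eventually_nhds_in_open[of "{0<..}" t] greater
    by (auto simp: flat_exp_def elim!: eventually_mono)
  have "((\<lambda>x. poly q (1 / x) * exp (- (1 / x))) has_real_derivative
      poly q (1 / t) * (exp (- (1 / t)) * (1 / t\<^sup>2)) + poly (pderiv q) (1 / t) * (- (1 / t\<^sup>2)) * exp (- (1 / t))) (at t)"
    using greater
    by (auto intro!: derivative_eq_intros DERIV_chain'[OF _ poly_DERIV] simp: power2_eq_square)
  then show ?thesis
    using greater
    by (subst DERIV_cong_ev[OF refl ev refl])
      (simp add: flat_exp_def algebra_simps power2_eq_square)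
next
  case equal
  have "((\<lambda>h. poly ([:0, 1:] * q) (inverse h) * exp (- inverse h)) \<longlongrightarrow> 0) (at_right 0)"
    by (rule filterlim_compose[OF tendsto_poly_exp_at_top filterlim_inverse_at_top_right])
  moreover have "\<forall>\<^sub>F h in at_right 0. poly ([:0, 1:] * q) (inverse h) * exp (- inverse h) = flat_exp q h / h"
    using eventually_at_right_less[of "0::real"]
    by eventually_elim (simp add: flat_exp_def field_simps)
  ultimately have "((\<lambda>h. flat_exp q h / h) \<longlongrightarrow> 0) (at_right 0)"
    by (rule Lim_transform_eventually)
  moreover have "((\<lambda>h. flat_exp q h / h) \<longlongrightarrow> 0) (at_left 0)"
    by (rule tendsto_eventually)
      (auto simp: eventually_at_filter flat_exp_def)
  ultimately have "((\<lambda>h. flat_exp q h / h) \<longlongrightarrow> 0) (at 0)"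
    by (simp add: filterlim_at_split)
  then show ?thesis
    using equal by (simp add: DERIV_def flat_exp_def)
qed

text \<open>
  The algebra generated by flat functions of one coordinate. It is small enough for its
  properties (smoothness, stability under translation and partial differentiation, symmetry of second
  derivatives) to follow by rule induction, and rich enough to approximate indicators of boxes.
\<close>

inductive_set bump_algebra :: "(real ^ 'n \<Rightarrow> real) set" where
  flat: "(\<lambda>x. flat_exp q (a * x $ i + b)) \<in> bump_algebra"
| const: "(\<lambda>x. c) \<in> bump_algebra"
| add: "f \<in> bump_algebra \<Longrightarrow> g \<in> bump_algebra \<Longrightarrow> (\<lambda>x. f x + g x) \<in> bump_algebra"
| mult: "f \<in> bump_algebra \<Longrightarrow> g \<in> bump_algebra \<Longrightarrow> (\<lambda>x. f x * g x) \<in> bump_algebra"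

lemma has_derivative_flat_coord:
  "((\<lambda>x. flat_exp q (a * x $ i + b)) has_derivative
     (\<lambda>h. flat_exp ([:0, 0, 1:] * (q - pderiv q)) (a * x $ i + b) * (a * h $ i))) (at (x :: real ^ 'n))"
proof -
  have "((\<lambda>x :: real ^ 'n. a * x $ i + b) has_derivative (\<lambda>h. a * h $ i)) (at x)"
    by (auto intro!: derivative_eq_intros bounded_linear_imp_has_derivative)
  from has_derivative_compose[OF this flat_exp_has_derivative[unfolded has_field_derivative_def]]
  show ?thesis .
qed

lemma bump_algebra_differentiable:
  "f \<in> bump_algebra \<Longrightarrow> f differentiable (at x)"
proof (induction rule: bump_algebra.induct)
  case (flat q a i b)
  show ?case using has_derivative_flat_coord by (rule differentiableI)
qed auto

lemma partial_deriv_eqI: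
  "(f has_derivative f') (at x) \<Longrightarrow> partial_deriv i f x = f' (axis i 1)"
  by (simp add: partial_deriv_def flip: frechet_derivative_at)

lemma partial_deriv_flat:
  "partial_deriv j (\<lambda>x. flat_exp q (a * x $ i + b)) =
    (\<lambda>x. (if i = j then a else 0) * flat_exp ([:0, 0, 1:] * (q - pderiv q)) (a * x $ i + b))"
  by (rule ext) (subst partial_deriv_eqI[OF has_derivative_flat_coord], auto simp: axis_def)

lemma partial_deriv_const [simp]: "partial_deriv j (\<lambda>x. c) = (\<lambda>x. 0)"
  by (rule ext) (subst partial_deriv_eqI, auto)

lemma partial_deriv_add:
  assumes "\<And>x. f differentiable (at x)" "\<And>x. g differentiable (at x)"
  shows "partial_deriv j (\<lambda>x. f x + g x) = (\<lambda>x. partial_deriv j f x + partial_deriv j g x)"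
  using assms
  by (intro ext partial_deriv_eqI[THEN trans])
    (auto simp: partial_deriv_def intro!: has_derivative_add frechet_derivative_works[THEN iffD1])

lemma partial_deriv_mult:
  assumes "\<And>x. f differentiable (at x)" "\<And>x. g differentiable (at x)"
  shows "partial_deriv j (\<lambda>x. f x * g x) = (\<lambda>x. f x * partial_deriv j g x + partial_deriv j f x * g x)"
  using assms
  by (intro ext partial_deriv_eqI[THEN trans])
    (auto simp: partial_deriv_def intro!: has_derivative_mult frechet_derivative_works[THEN iffD1])

lemma bump_algebra_partial_deriv:
  "f \<in> bump_algebra \<Longrightarrow> partial_deriv j f \<in> bump_algebra"
proof (induction rule: bump_algebra.induct)
  case (flat q a i b)
  then show ?case
    unfolding partial_deriv_flat by (intro bump_algebra.intros)
next
  case (const c)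
  show ?case by (simp add: bump_algebra.intros)
next
  case (add f g)
  then show ?case
    by (subst partial_deriv_add) (auto simp: bump_algebra_differentiable intro!: bump_algebra.add)
next
  case (mult f g)
  then show ?case
    by (subst partial_deriv_mult)
      (auto simp: bump_algebra_differentiable intro!: bump_algebra.add bump_algebra.mult)
qed

lemma bump_algebra_partial_derivs:
  "f \<in> bump_algebra \<Longrightarrow> partial_derivs is f \<in> bump_algebra"
  by (induction "is") (auto simp: bump_algebra_partial_deriv)

lemma bump_algebra_smooth: "f \<in> bump_algebra \<Longrightarrow> smooth_fun f"
  by (simp add: smooth_fun_def bump_algebra_differentiable bump_algebra_partial_derivs)

lemma bump_algebra_translate:
  "f \<in> bump_algebra \<Longrightarrow> (\<lambda>x. f (x + c)) \<in> bump_algebra"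
proof (induction rule: bump_algebra.induct)
  case (flat q a i b)
  then show ?case
    using bump_algebra.flat[of q a i "a * c $ i + b"] by (simp add: algebra_simps)
qed (auto intro: bump_algebra.intros)

lemma partial_deriv_translate:
  assumes "\<And>x. f differentiable (at x)"
  shows "partial_deriv j (\<lambda>x. f (x + c)) x = partial_deriv j f (x + c)"
proof -
  have "((\<lambda>x. f (x + c)) has_derivative (\<lambda>h. frechet_derivative f (at (x + c)) h)) (at x)"
    by (rule has_derivative_compose[where f = "\<lambda>x. x + c"])
      (use assms in \<open>auto intro!: derivative_eq_intros frechet_derivative_works[THEN iffD1]\<close>)
  from partial_deriv_eqI[OF this] show ?thesis by (simp add: partial_deriv_def)
qed

text \<open>
  Both mixed derivatives of a generator vanish unless the two directions coincide; the product
  rule carries the symmetry over to products.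
\<close>

lemma bump_algebra_symmetric:
  "f \<in> bump_algebra \<Longrightarrow> partial_deriv i (partial_deriv j f) = partial_deriv j (partial_deriv i f)"
proof (induction rule: bump_algebra.induct)
  case (flat q a k b)
  have [simp]: "partial_deriv j (\<lambda>x. c * f x) = (\<lambda>x. c * partial_deriv j f x)"
    if "f \<in> bump_algebra" for f c j
    using that by (subst partial_deriv_mult) (auto simp: bump_algebra_differentiable)
  show ?case
    by (simp add: partial_deriv_flat bump_algebra.flat) 
next
  case (add f g)
  then show ?case
    by (simp add: partial_deriv_add bump_algebra_differentiable bump_algebra_partial_deriv)
next
  case (mult f g)
  then show ?case
    by (simp add: partial_deriv_add partial_deriv_mult bump_algebra_differentiable
        bump_algebra_partial_deriv bump_algebra.mult algebra_simps)
qed simp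

lemma bump_algebra_prod:
  "finite I \<Longrightarrow> (\<And>i. i \<in> I \<Longrightarrow> f i \<in> bump_algebra) \<Longrightarrow> (\<lambda>x. \<Prod>i\<in>I. f i x) \<in> bump_algebra"
  by (induction I rule: finite_induct) (auto intro: bump_algebra.intros)

lemma bump_algebra_continuous: "f \<in> bump_algebra \<Longrightarrow> continuous_on S f"
  using bump_algebra_differentiable
  by (metis continuous_at_imp_continuous_on differentiable_imp_continuous_within)

text \<open>
  Positive exactly on the box; the factor \<open>m\<close> steepens the flanks, since \<open>exp(-1/(m s))\<close> tends to \<open>1\<close>
  for every \<open>s > 0\<close>.
\<close>

definition box_bump :: "nat \<Rightarrow> real ^ 'n \<Rightarrow> real ^ 'n \<Rightarrow> real ^ 'n \<Rightarrow> real" where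
  "box_bump m a b x = (\<Prod>i\<in>UNIV. flat_exp 1 (real m * (x $ i - a $ i)) * flat_exp 1 (real m * (b $ i - x $ i)))"

lemma box_bump_in_bump_algebra: "box_bump m a b \<in> bump_algebra"
proof -
  have "(\<lambda>x. flat_exp 1 (real m * (x $ i - a $ i))) \<in> bump_algebra" for i
    using bump_algebra.flat[of 1 "real m" i "- real m * a $ i"] by (simp add: algebra_simps)
  moreover have "(\<lambda>x. flat_exp 1 (real m * (b $ i - x $ i))) \<in> bump_algebra" for i
    using bump_algebra.flat[of 1 "- real m" i "real m * b $ i"] by (simp add: algebra_simps)
  ultimately show ?thesis
    unfolding box_bump_def[abs_def] by (intro bump_algebra_prod bump_algebra.mult) auto
qed

lemma flat_exp_1_bounds: "0 \<le> flat_exp 1 t" "flat_exp 1 t \<le> 1"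
  by (auto simp: flat_exp_def)

lemma box_bump_bounds: "0 \<le> box_bump m a b x" "box_bump m a b x \<le> 1"
  unfolding box_bump_def
  by (auto intro!: prod_nonneg prod_le_1 mult_nonneg_nonneg mult_le_one simp: flat_exp_1_bounds)

lemma box_bump_eq_0: "x \<notin> box a b \<Longrightarrow> box_bump m a b x = 0"
proof -
  assume "x \<notin> box a b"
  then obtain i where "x $ i \<le> a $ i \<or> b $ i \<le> x $ i"
    using mem_box_cart(1)[of x a b] not_le by blast
  then have "flat_exp 1 (real m * (x $ i - a $ i)) * flat_exp 1 (real m * (b $ i - x $ i)) = 0"
    by (auto simp: flat_exp_def zero_less_mult_iff)
  then show ?thesis
    unfolding box_bump_def by (intro prod_zero) auto
qed

lemma tendsto_flat_exp_1: "0 < t \<Longrightarrow> (\<lambda>m. flat_exp 1 (real m * t)) \<longlonglongrightarrow> 1"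
proof -
  assume t: "0 < t"
  have "(\<lambda>m. exp (- (inverse (real m) * (1 / t)))) \<longlonglongrightarrow> exp (- (0 * (1 / t)))"
    by (intro tendsto_intros lim_inverse_n)
  moreover have "\<forall>\<^sub>F m in sequentially. exp (- (inverse (real m) * (1 / t))) = flat_exp 1 (real m * t)"
    using eventually_gt_at_top[of 0]
    by eventually_elim (use t in \<open>simp add: flat_exp_def field_simps\<close>)
  ultimately show ?thesis
    by (auto intro: Lim_transform_eventually)
qed

lemma tendsto_box_bump: "(\<lambda>m. box_bump m a b x) \<longlonglongrightarrow> indicator (box a b) x"
proof (cases "x \<in> box a b")
  case True
  have "(\<lambda>m. box_bump m a b x) \<longlonglongrightarrow> (\<Prod>i\<in>(UNIV :: 'a set). 1 * 1)"
    unfolding box_bump_def using True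
    by (intro tendsto_prod tendsto_mult tendsto_flat_exp_1) (auto simp: mem_box_cart)
  with True show ?thesis by simp
qed (simp add: box_bump_eq_0)

lemma compact_support_bounded:
  fixes f :: "'a::euclidean_space \<Rightarrow> real"
  assumes "\<And>x. f x \<noteq> 0 \<Longrightarrow> norm x \<le> R"
  shows "compact (closure {x. f x \<noteq> 0})"
proof -
  have "{x. f x \<noteq> 0} \<subseteq> cball 0 R" using assms by auto
  then show ?thesis by (meson bounded_cball bounded_subset compact_closure)
qed

section \<open>Functions annihilated by all bumps\<close>

text \<open>
  Boxes are stable under intersection and generate the Borel sets, so the integral vanishes
  over every Borel set, in particular where the function is positive and where it is negative.
  Cutting off outside a fixed box makes the function integrable, as complements require.
\<close>

lemma zero_integral_over_boxes_imp_zero_on_box: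
  fixes f :: "'a::euclidean_space \<Rightarrow> real"
  assumes int: "set_integrable lborel (box c d) f"
    and zero: "\<And>a b. (LINT x:box a b|lborel. f x) = 0"
  shows "AE x in lborel. x \<in> box c d \<longrightarrow> f x = 0"
proof -
  define g where "g x = indicator (box c d) x * f x" for x
  have g: "integrable lborel g"
    using int by (simp add: set_integrable_def g_def[abs_def])
  then have g_meas [measurable]: "g \<in> borel_measurable lborel" by blast
  have g_set: "set_integrable lborel A g" if "A \<in> sets borel" for A
    using that g unfolding set_integrable_def by (intro integrable_mult_indicator) auto
  have sets_zero: "(LINT x:A|lborel. g x) = 0" if "A \<in> sets borel" for A
  proof -
    have stable: "Int_stable (range (\<lambda>(a, b). box a b :: 'a set))"
      by (auto simp: Int_stable_def box_Int_box)
    have closed: "range (\<lambda>(a, b). box a b :: 'a set) \<subseteq> Pow UNIV" by simp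
    have "A \<in> sigma_sets UNIV (range (\<lambda>(a, b). box a b))"
      using that by (simp add: borel_eq_box)
    from stable closed this show ?thesis
    proof (induction rule: sigma_sets_induct_disjoint)
      case (basic A)
      then obtain a b where A: "A = box a b" by auto
      obtain a' b' where "box a b \<inter> box c d = box a' b'"
        using box_Int_box by blast
      then have "(LINT x:A|lborel. g x) = (LINT x:box a' b'|lborel. f x)"
        unfolding A set_lebesgue_integral_def g_def
        by (intro Bochner_Integration.integral_cong) (auto simp: indicator_def split: if_splits)
      then show ?case by (simp add: zero)
    next
      case (compl A)
      then have A: "A \<in> sets borel" by (simp add: borel_eq_box)
      have "(LINT x:UNIV|lborel. g x) = (LINT x:box c d|lborel. f x)"
        by (simp add: set_lebesgue_integral_def g_def)
      moreover have "(LINT x:UNIV|lborel. g x) = (LINT x:A|lborel. g x) + (LINT x:UNIV - A|lborel. g x)"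
        using A by (subst set_integral_Un[symmetric]) (auto intro!: g_set)
      ultimately show ?case using compl zero by simp
    next
      case (union A)
      then have A: "range A \<subseteq> sets borel" by (auto simp: borel_eq_box)
      have "(LINT x:(\<Union>i. A i)|lborel. g x) = (\<Sum>i. LINT x:A i|lborel. g x)"
        using A union by (intro lebesgue_integral_countable_add g_set) (auto simp: disjoint_family_on_def)
      then show ?case using union by simp
    qed (simp add: set_lebesgue_integral_def)
  qed
  have "AE x in lborel. indicator {x. 0 < g x} x *\<^sub>R g x = 0"
    using sets_zero[of "{x. 0 < g x}"] g_set[of "{x. 0 < g x}"]
    by (subst integral_nonneg_eq_0_iff_AE[symmetric])
      (auto simp: set_lebesgue_integral_def set_integrable_def indicator_def)
  moreover have "AE x in lborel. indicator {x. g x < 0} x *\<^sub>R (- g x) = 0"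
    using sets_zero[of "{x. g x < 0}"] g_set[of "{x. g x < 0}"]
    by (subst integral_nonneg_eq_0_iff_AE[symmetric])
      (auto simp: set_lebesgue_integral_def set_integrable_def indicator_def)
  ultimately show ?thesis
    by eventually_elim (auto simp: g_def indicator_def split: if_splits)
qed

lemma zero_integral_over_boxes_imp_zero:
  fixes f :: "'a::euclidean_space \<Rightarrow> real"
  assumes int: "\<And>a b. set_integrable lborel (box a b) f"
    and zero: "\<And>a b. (LINT x:box a b|lborel. f x) = 0"
  shows "AE x in lborel. f x = 0"
proof -
  have "AE x in lborel. \<forall>n::nat. x \<in> box (- (real n *\<^sub>R One)) (real n *\<^sub>R One) \<longrightarrow> f x = 0"
    unfolding AE_all_countable by (intro allI zero_integral_over_boxes_imp_zero_on_box int zero)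
  then show ?thesis
  proof eventually_elim
    case (elim x)
    have "x \<in> (\<Union>n::nat. box (- (real n *\<^sub>R One)) (real n *\<^sub>R One))"
      unfolding UN_box_eq_UNIV by simp
    with elim show ?case by blast
  qed
qed

text \<open>
  The fundamental lemma of the calculus of variations: the bumps of a box converge boundedly to
  its indicator, so all integrals over boxes vanish.
\<close>

lemma zero_against_box_bumps_imp_zero:
  fixes f :: "real ^ 'n \<Rightarrow> real"
  assumes int: "\<And>a b. set_integrable lborel (box a b) f"
    and zero: "\<And>m a b. (LINT x|lborel. f x * box_bump m a b x) = 0"
  shows "AE x in lborel. f x = 0"
proof (rule zero_integral_over_boxes_imp_zero[OF int])
  fix a b :: "real ^ 'n"
  have [measurable]: "f \<in> borel_measurable borel"
  proof (rule borel_measurable_LIMSEQ_real)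
    fix x
    show "(\<lambda>n. indicator (box (- (real n *\<^sub>R One)) (real n *\<^sub>R One)) x * f x) \<longlonglongrightarrow> f x"
    proof (rule tendsto_eventually)
      have "x \<in> (\<Union>n::nat. box (- (real n *\<^sub>R One)) (real n *\<^sub>R One))"
        unfolding UN_box_eq_UNIV by simp
      then obtain n where n: "x \<in> box (- (real n *\<^sub>R One)) (real n *\<^sub>R One)" by auto
      have "x \<in> box (- (real k *\<^sub>R One)) (real k *\<^sub>R One)" if "n \<le> k" for k
        using n that by (force simp: mem_box)
      then show "\<forall>\<^sub>F n in sequentially. indicator (box (- (real n *\<^sub>R One)) (real n *\<^sub>R One)) x * f x = f x"
        by (auto simp: eventually_at_top_linorder intro!: exI[of _ n])
    qed
  next
    show "(\<lambda>x. indicator (box (- (real n *\<^sub>R One)) (real n *\<^sub>R One)) x * f x) \<in> borel_measurable borel" for n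
      using int[of "- (real n *\<^sub>R One)" "real n *\<^sub>R One"] borel_measurable_integrable
      unfolding set_integrable_def by fastforce
  qed
  have [measurable]: "box_bump m a b \<in> borel_measurable borel" for m
    by (intro borel_measurable_continuous_onI bump_algebra_continuous box_bump_in_bump_algebra)
  have "(\<lambda>m. LINT x|lborel. f x * box_bump m a b x) \<longlonglongrightarrow> (LINT x|lborel. f x * indicator (box a b) x)"
  proof (rule integral_dominated_convergence)
    show "integrable lborel (\<lambda>x. norm (indicator (box a b) x *\<^sub>R f x))"
      using int[of a b] unfolding set_integrable_def by (rule integrable_norm)
    show "AE x in lborel. (\<lambda>m. f x * box_bump m a b x) \<longlonglongrightarrow> f x * indicator (box a b) x"
      by (auto intro!: tendsto_mult tendsto_box_bump)
    show "AE x in lborel. norm (f x * box_bump m a b x) \<le> norm (indicator (box a b) x *\<^sub>R f x)" for m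
    proof (rule AE_I2)
      fix x
      have "\<bar>f x\<bar> * \<bar>box_bump m a b x\<bar> \<le> \<bar>f x\<bar> * 1" 
        using box_bump_bounds[of m a b x] by (intro mult_left_mono) auto
      then show "norm (f x * box_bump m a b x) \<le> norm (indicator (box a b) x *\<^sub>R f x)"
        using box_bump_eq_0[of x a b m] by (cases "x \<in> box a b") (auto simp: abs_mult)
    qed
  qed auto
  then show "(LINT x:box a b|lborel. f x) = 0"
    by (simp add: zero set_lebesgue_integral_def mult.commute LIMSEQ_const_iff)
qed

section \<open>Averages against the hat function\<close>

text \<open>
  The Peano kernel of the second difference: \<open>g 1 - 2 g 0 + g (-1)\<close> is the integral of \<open>hat\<close> times the
  second derivative of \<open>g\<close>.
\<close>

definition hat :: "real \<Rightarrow> real" where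
  "hat t = max 0 (1 - \<bar>t\<bar>)"

lemma hat_nonneg [simp]: "0 \<le> hat t"
  by (simp add: hat_def)

lemma hat_eq_0: "1 \<le> \<bar>t\<bar> \<Longrightarrow> hat t = 0"
  by (simp add: hat_def)

lemma continuous_on_hat [continuous_intros]: "continuous_on S f \<Longrightarrow> continuous_on S (\<lambda>x. hat (f x))"
  unfolding hat_def by (intro continuous_intros)

lemma measurable_hat [measurable]: "hat \<in> borel_measurable borel"
  by (intro borel_measurable_continuous_onI continuous_intros)

text \<open>
  On \<open>[-1,0]\<close> and \<open>[0,1]\<close> the integrand has the antiderivatives \<open>(1 + t) g' - g\<close> and \<open>(1 - t) g' + g\<close>; the
  terms with \<open>g' 0\<close> cancel.
\<close>

lemma hat_integral_by_parts:
  fixes g g' g'' :: "real \<Rightarrow> real"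
  assumes g: "\<And>t. (g has_real_derivative g' t) (at t)"
    and g': "\<And>t. (g' has_real_derivative g'' t) (at t)"
    and cont: "continuous_on UNIV g''"
  shows "integrable lborel (\<lambda>t. hat t * g'' t)"
    and "(LINT t|lborel. hat t * g'' t) = g 1 - 2 * g 0 + g (- 1)"
proof -
  have cont': "continuous_on S g''" for S
    using cont continuous_on_subset by blast
  have left: "(LINT t|lborel. indicator {-1..0} t *\<^sub>R ((1 + t) * g'' t)) =
      ((1 + 0) * g' 0 - g 0) - ((1 + (-1)) * g' (-1) - g (-1))"
    by (rule integral_FTC_atLeastAtMost)
      (auto intro!: derivative_eq_intros continuous_intros cont' DERIV_subset[OF g] DERIV_subset[OF g']
        simp: has_real_derivative_iff_has_vector_derivative[symmetric] algebra_simps)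
  have right: "(LINT t|lborel. indicator {0..1} t *\<^sub>R ((1 - t) * g'' t)) =
      ((1 - 1) * g' 1 + g 1) - ((1 - 0) * g' 0 + g 0)"
    by (rule integral_FTC_atLeastAtMost)
      (auto intro!: derivative_eq_intros continuous_intros cont' DERIV_subset[OF g] DERIV_subset[OF g']
        simp: has_real_derivative_iff_has_vector_derivative[symmetric] algebra_simps)
  have int_left: "integrable lborel (\<lambda>t. indicator {-1..0} t *\<^sub>R ((1 + t) * g'' t))"
    by (rule borel_integrable_compact[unfolded set_integrable_def]) (auto intro!: continuous_intros cont')
  have int_right: "integrable lborel (\<lambda>t. indicator {0..1} t *\<^sub>R ((1 - t) * g'' t))"
    by (rule borel_integrable_compact[unfolded set_integrable_def]) (auto intro!: continuous_intros cont')
  have [measurable]: "g'' \<in> borel_measurable borel"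
    by (rule borel_measurable_continuous_onI[OF cont])
  have split: "AE t in lborel. hat t * g'' t =
      indicator {-1..0} t *\<^sub>R ((1 + t) * g'' t) + indicator {0..1} t *\<^sub>R ((1 - t) * g'' t)"
    using AE_lborel_singleton[of 0]
    by eventually_elim (auto simp: hat_def indicator_def)
  show "integrable lborel (\<lambda>t. hat t * g'' t)"
    using int_left int_right by (subst integrable_cong_AE[OF _ _ split]) auto
  show "(LINT t|lborel. hat t * g'' t) = g 1 - 2 * g 0 + g (- 1)"
    using int_left int_right left right
    by (subst integral_cong_AE[OF _ _ split]) auto
qed

lemma hat_integral: "integrable lborel hat" "(LINT t|lborel. hat t) = 1"
proof -
  have "((\<lambda>t. t\<^sup>2 / 2) has_real_derivative t) (at t)" for t :: real
    by (auto intro!: derivative_eq_intros)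
  \<comment> \<open>The second difference of \<open>t^2 / 2\<close> is \<open>1\<close>, and so is its second derivative.\<close>
  note hat_integral_by_parts[where g'' = "\<lambda>_. 1", OF this DERIV_ident]
  then show "integrable lborel hat" "(LINT t|lborel. hat t) = 1"
    by simp_all
qed

lemma bump_algebra_line_derivative:
  fixes f :: "real ^ 'n \<Rightarrow> real"
  assumes "f \<in> bump_algebra"
  shows "((\<lambda>t. f (x + t *\<^sub>R h)) has_real_derivative (\<Sum>i\<in>UNIV. h $ i * partial_deriv i f (x + t *\<^sub>R h))) (at t)"
proof -
  let ?D = "frechet_derivative f (at (x + t *\<^sub>R h))"
  have D: "(f has_derivative ?D) (at (x + t *\<^sub>R h))"
    using bump_algebra_differentiable[OF assms] by (simp add: frechet_derivative_works[THEN iffD1])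
  interpret linear ?D
    using D by (rule has_derivative_linear)
  have "((\<lambda>t. x + t *\<^sub>R h) has_derivative (\<lambda>s. s *\<^sub>R h)) (at t)"
    by (auto intro!: derivative_eq_intros)
  from has_derivative_compose[OF this D]
  have "((\<lambda>t. f (x + t *\<^sub>R h)) has_derivative (\<lambda>s. ?D (s *\<^sub>R h))) (at t)" .
  moreover have "?D (s *\<^sub>R h) = (\<Sum>i\<in>UNIV. h $ i * partial_deriv i f (x + t *\<^sub>R h)) * s" for s
  proof -
    have "h = (\<Sum>i\<in>UNIV. h $ i *\<^sub>R axis i 1)"
      using basis_expansion[of h] by (simp add: scalar_mult_eq_scaleR)
    then have "?D h = ?D (\<Sum>i\<in>UNIV. h $ i *\<^sub>R axis i 1)" by simp
    also have "\<dots> = (\<Sum>i\<in>UNIV. h $ i * ?D (axis i 1))" by (simp only: sum scale real_scaleR_def)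
    finally have "?D h = (\<Sum>i\<in>UNIV. h $ i * ?D (axis i 1))" .
    then show ?thesis by (simp add: scale partial_deriv_def)
  qed
  ultimately show ?thesis
    by (simp add: has_field_derivative_def)
qed

text \<open>
  The previous formula for the restriction of \<open>f\<close> to the line \<open>x + t h\<close>.
\<close>

lemma second_difference_eq_hat_average:
  fixes f :: "real ^ 'n \<Rightarrow> real"
  assumes f: "f \<in> bump_algebra"
  shows "f (x + h) - 2 * f x + f (x - h) =
    (\<Sum>i\<in>UNIV. \<Sum>j\<in>UNIV. h $ i * h $ j * (LINT t|lborel. hat t * partial_deriv i (partial_deriv j f) (x + t *\<^sub>R h)))"
proof -
  let ?d = "\<lambda>i j t. partial_deriv i (partial_deriv j f) (x + t *\<^sub>R h)"
  have cont: "continuous_on UNIV (?d i j)" for i j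
    by (intro continuous_on_compose2[OF bump_algebra_continuous[of _ UNIV]] continuous_intros
        bump_algebra_partial_deriv f) auto
  have int: "integrable lborel (\<lambda>t. hat t * ?d i j t)" for i j
  proof -
    have "integrable lborel (\<lambda>t. indicator {-1..1} t *\<^sub>R (hat t * ?d i j t))"
      by (rule borel_integrable_compact[unfolded set_integrable_def]) (auto intro!: continuous_intros cont[THEN continuous_on_subset])
    moreover have "(\<lambda>t. indicator {-1..1} t *\<^sub>R (hat t * ?d i j t)) = (\<lambda>t. hat t * ?d i j t)"
      by (auto simp: indicator_def hat_def fun_eq_iff)
    ultimately show ?thesis by simp
  qed
  have "f (x + 1 *\<^sub>R h) - 2 * f (x + 0 *\<^sub>R h) + f (x + (- 1) *\<^sub>R h) =
      (LINT t|lborel. hat t * (\<Sum>j\<in>UNIV. h $ j * (\<Sum>i\<in>UNIV. h $ i * ?d i j t)))"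
    by (rule hat_integral_by_parts(2)[symmetric, where g' = "\<lambda>t. \<Sum>j\<in>UNIV. h $ j * partial_deriv j f (x + t *\<^sub>R h)"])
      (auto intro!: bump_algebra_line_derivative f DERIV_sum DERIV_cmult bump_algebra_partial_deriv
        continuous_intros cont)
  also have "\<dots> = (LINT t|lborel. (\<Sum>i\<in>UNIV. \<Sum>j\<in>UNIV. h $ i * h $ j * (hat t * ?d i j t)))"
    by (subst sum.swap) (simp add: sum_distrib_left mult_ac)
  also have "\<dots> = (\<Sum>i\<in>UNIV. \<Sum>j\<in>UNIV. h $ i * h $ j * (LINT t|lborel. hat t * ?d i j t))"
    using int by (simp add: Bochner_Integration.integral_sum)
  finally show ?thesis by simp
qed

lemma lborel_integral_translate:
  fixes f :: "'a::euclidean_space \<Rightarrow> 'b::{banach, second_countable_topology}"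
  assumes "f \<in> borel_measurable borel"
  shows "(LINT x|lborel. f (x + c)) = (LINT x|lborel. f x)"
    and "integrable lborel (\<lambda>x. f (x + c)) \<longleftrightarrow> integrable lborel f"
proof -
  show "(LINT x|lborel. f (x + c)) = (LINT x|lborel. f x)"
    using assms by (subst (2) lborel_distr_plus[symmetric, of c], subst integral_distr) (auto simp: add.commute)
  show "integrable lborel (\<lambda>x. f (x + c)) \<longleftrightarrow> integrable lborel f"
    using assms by (subst (2) lborel_distr_plus[symmetric, of c], subst integrable_distr_eq) (auto simp: add.commute)
qed

text \<open>
  The shear \<open>(t, x) \<mapsto> (t, x + t h)\<close> preserves the measure, so averaging one factor along the segment is
  dual to averaging the other one along the reversed segment. All four claims are Fubini's theorem
  for one integrand in two coordinate systems; it is integrable because \<open>t\<close> and \<open>x\<close> are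
  confined to bounded sets.
\<close>

lemma hat_average_duality:
  fixes g \<psi> :: "'a::euclidean_space \<Rightarrow> real"
  assumes [measurable]: "g \<in> borel_measurable borel" "\<psi> \<in> borel_measurable borel"
    and g: "\<And>R. set_integrable lborel (cball 0 R) g"
    and B: "\<And>x. \<bar>\<psi> x\<bar> \<le> B" and R: "\<And>x. R < norm x \<Longrightarrow> \<psi> x = 0"
  shows "integrable lborel (\<lambda>x. g x * (LINT t|lborel. hat t * \<psi> (x + t *\<^sub>R h)))" (is ?int1)
    and "integrable lborel (\<lambda>y. \<psi> y * (LINT t|lborel. hat t * g (y - t *\<^sub>R h)))" (is ?int2)
    and "(LINT x|lborel. g x * (LINT t|lborel. hat t * \<psi> (x + t *\<^sub>R h))) =
      (LINT t|lborel. hat t * (LINT x|lborel. g x * \<psi> (x + t *\<^sub>R h)))" (is ?eq1)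
    and "(LINT y|lborel. \<psi> y * (LINT t|lborel. hat t * g (y - t *\<^sub>R h))) =
      (LINT t|lborel. hat t * (LINT x|lborel. g x * \<psi> (x + t *\<^sub>R h)))" (is ?eq2)
proof -
  define F where "F = (\<lambda>(t, x). hat t * (g x * \<psi> (x + t *\<^sub>R h)))"
  define F' where "F' = (\<lambda>(t, y). hat t * (\<psi> y * g (y - t *\<^sub>R h)))"
  have [measurable]: "F \<in> borel_measurable (lborel \<Otimes>\<^sub>M lborel)" "F' \<in> borel_measurable (lborel \<Otimes>\<^sub>M lborel)"
    unfolding F_def F'_def by measurable
  \<comment> \<open>Where \<open>hat t * \<psi> (x + t h)\<close> is not zero, \<open>x\<close> lies within distance \<open>|h|\<close> of the support of \<open>\<psi>\<close>.\<close>
  define S where "S = cball (0 :: 'a) (R + norm h)"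
  have [measurable]: "S \<in> sets borel" by (simp add: S_def)
  have gS: "integrable lborel (\<lambda>x. B * norm (indicator S x *\<^sub>R g x))"
    using g[of "R + norm h"] unfolding set_integrable_def S_def by simp
  have bound: "norm (F (t, x)) \<le> hat t * (B * norm (indicator S x *\<^sub>R g x))" for t x
  proof (cases "\<bar>t\<bar> \<le> 1 \<and> norm (x + t *\<^sub>R h) \<le> R")
    case True
    have "norm x \<le> norm (x + t *\<^sub>R h) + norm (t *\<^sub>R h)"
      using norm_triangle_ineq4[of "x + t *\<^sub>R h" "t *\<^sub>R h"] by simp
    also have "\<dots> \<le> R + norm h"
      using True mult_right_mono[of "\<bar>t\<bar>" 1 "norm h"] by simp
    finally have "x \<in> S" by (simp add: S_def)
    moreover have "\<bar>g x\<bar> * \<bar>\<psi> (x + t *\<^sub>R h)\<bar> \<le> \<bar>g x\<bar> * B"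
      by (intro mult_left_mono B) auto
    ultimately show ?thesis
      by (auto simp: F_def abs_mult mult.commute[of B] intro!: mult_left_mono)
  next
    case False
    have "0 \<le> B" using B[of 0] by linarith
    with False show ?thesis using R[of "x + t *\<^sub>R h"] by (auto simp: F_def hat_eq_0)
  qed
  have int_inner: "integrable lborel (\<lambda>x. F (t, x))" for t
  proof (rule Bochner_Integration.integrable_bound[OF integrable_mult_right[OF gS, of "hat t"]])
    show "AE x in lborel. norm (F (t, x)) \<le> norm (hat t * (B * norm (indicator S x *\<^sub>R g x)))"
      by (intro AE_I2 order.trans[OF bound]) simp
  qed measurable
  have intF: "integrable (lborel \<Otimes>\<^sub>M lborel) F"
  proof (rule lborel_pair.Fubini_integrable)
    show "integrable lborel (\<lambda>t. LINT x|lborel. norm (F (t, x)))"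
    proof (rule Bochner_Integration.integrable_bound)
      show "integrable lborel (\<lambda>t. hat t * (LINT x|lborel. B * norm (indicator S x *\<^sub>R g x)))"
        by (intro integrable_mult_left hat_integral)
      show "AE t in lborel. norm (LINT x|lborel. norm (F (t, x)))
          \<le> norm (hat t * (LINT x|lborel. B * norm (indicator S x *\<^sub>R g x)))"
      proof (rule AE_I2)
        fix t
        have "(LINT x|lborel. norm (F (t, x))) \<le> (LINT x|lborel. hat t * (B * norm (indicator S x *\<^sub>R g x)))"
          by (intro integral_mono integrable_norm integrable_mult_right[OF gS] int_inner bound)
        then show "norm (LINT x|lborel. norm (F (t, x)))
          \<le> norm (hat t * (LINT x|lborel. B * norm (indicator S x *\<^sub>R g x)))"
          by (simp add: integral_nonneg_AE)
      qed
    qed measurable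
  qed (auto intro: int_inner)
  have shift: "F' (t, y) = F (t, y - t *\<^sub>R h)" for t y
    by (simp add: F_def F'_def mult_ac)
  have meas_F: "(\<lambda>x. F (t, x)) \<in> borel_measurable borel" for t
    by measurable
  have inner_shift: "(LINT y|lborel. F' (t, y)) = (LINT x|lborel. F (t, x))"
    "(LINT y|lborel. norm (F' (t, y))) = (LINT x|lborel. norm (F (t, x)))"
    "integrable lborel (\<lambda>y. F' (t, y))" for t
    using lborel_integral_translate[of "\<lambda>x. F (t, x)" "- (t *\<^sub>R h)"]
      lborel_integral_translate(1)[of "\<lambda>x. norm (F (t, x))" "- (t *\<^sub>R h)"] meas_F[of t] int_inner[of t]
    by (auto simp: shift)
  have intF': "integrable (lborel \<Otimes>\<^sub>M lborel) F'"
  proof (rule lborel_pair.Fubini_integrable)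
    show "integrable lborel (\<lambda>t. LINT y|lborel. norm (F' (t, y)))"
      unfolding inner_shift(2) by (rule lborel_pair.integrable_fst'[OF integrable_norm[OF intF]])
  qed (auto intro: inner_shift)
  have pull: "(LINT t|lborel. F (t, x)) = g x * (LINT t|lborel. hat t * \<psi> (x + t *\<^sub>R h))"
    "(LINT t|lborel. F' (t, x)) = \<psi> x * (LINT t|lborel. hat t * g (x - t *\<^sub>R h))"
    "(LINT z|lborel. F (t, z)) = hat t * (LINT x|lborel. g x * \<psi> (x + t *\<^sub>R h))" for x t
    by (simp_all add: F_def F'_def mult_ac flip: integral_mult_right_zero)
  have split: "(\<lambda>(t, x). F (t, x)) = F" "(\<lambda>(t, x). F' (t, x)) = F'" by auto
  show ?int1 using lborel_pair.integrable_snd[of "\<lambda>t x. F (t, x)"] intF by (simp add: pull split)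
  show ?int2 using lborel_pair.integrable_snd[of "\<lambda>t x. F' (t, x)"] intF' by (simp add: pull split)
  show ?eq1 using lborel_pair.Fubini_integral[of "\<lambda>t x. F (t, x)"] intF by (simp add: pull split)
  show ?eq2 using lborel_pair.Fubini_integral[of "\<lambda>t x. F' (t, x)"] intF' inner_shift(1) by (simp add: pull split)
qed

section \<open>Second differences of weakly differentiable functions\<close>

lemma bump_algebra_partial_deriv_support:
  assumes f: "f \<in> bump_algebra" and R: "\<And>x. R < norm x \<Longrightarrow> f x = 0" and x: "R < norm x"
  shows "partial_deriv i f x = 0"
proof -
  have "open {x :: real ^ 'a. R < norm x}"
    by (intro open_Collect_less continuous_intros)
  then have "(f has_derivative (\<lambda>_. 0)) (at x)"
    by (rule has_derivative_transform_within_open[OF has_derivative_const[of 0]]) (simp_all add: x R)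
  then show ?thesis by (simp add: partial_deriv_eqI)
qed

lemma bump_algebra_bounded:
  assumes f: "f \<in> bump_algebra" and R: "\<And>x. R < norm x \<Longrightarrow> f x = 0"
  obtains B where "\<And>x. \<bar>f x\<bar> \<le> B"
proof -
  have "compact (f ` cball 0 R)"
    by (intro compact_continuous_image bump_algebra_continuous f compact_cball)
  from compact_imp_bounded[OF this] obtain B where "\<forall>y\<in>f ` cball 0 R. norm y \<le> B"
    unfolding bounded_iff by blast
  then have B: "\<And>x. x \<in> cball 0 R \<Longrightarrow> \<bar>f x\<bar> \<le> B"
    by simp
  have "\<bar>f x\<bar> \<le> max B 0" for x
    using R[of x] B[of x] by (cases "R < norm x") (simp_all add: not_less le_max_iff_disj)
  then show ?thesis using that by blast
qed

lemma locally_integrable_mult: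
  fixes g \<psi> :: "'a::euclidean_space \<Rightarrow> real"
  assumes [measurable]: "g \<in> borel_measurable borel" "\<psi> \<in> borel_measurable borel"
    and g: "set_integrable lborel (cball 0 R) g"
    and B: "\<And>x. \<bar>\<psi> x\<bar> \<le> B" and R: "\<And>x. R < norm x \<Longrightarrow> \<psi> x = 0"
  shows "integrable lborel (\<lambda>x. g x * \<psi> x)"
proof (rule Bochner_Integration.integrable_bound)
  show "integrable lborel (\<lambda>x. B * (indicator (cball 0 R) x *\<^sub>R g x))"
    using g unfolding set_integrable_def by simp
  show "AE x in lborel. norm (g x * \<psi> x) \<le> norm (B * (indicator (cball 0 R) x *\<^sub>R g x))"
  proof (rule AE_I2)
    fix x
    have "\<bar>g x\<bar> * \<bar>\<psi> x\<bar> \<le> \<bar>g x\<bar> * \<bar>B\<bar>"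
      using B[of x] by (intro mult_left_mono) auto
    then show "norm (g x * \<psi> x) \<le> norm (B * (indicator (cball 0 R) x *\<^sub>R g x))"
      using R[of x] by (cases "norm x \<le> R") (auto simp: abs_mult mult.commute)
  qed
qed measurable

text \<open>
  Tested against a bump, the second difference of \<open>u\<close> becomes the second difference of the bump,
  which is a hat average of second derivatives. Bumps may be translated, so the weak derivative
  applies for each \<open>t\<close> separately, and duality of hat averages returns the average to \<open>G\<close>.
\<close>

lemma weak_second_difference:
  fixes u :: "real ^ 'n \<Rightarrow> real" and G :: "'n \<Rightarrow> 'n \<Rightarrow> real ^ 'n \<Rightarrow> real"
  assumes u [measurable]: "u \<in> borel_measurable borel" and G [measurable]: "\<And>i j. G i j \<in> borel_measurable borel"
    and u_loc: "\<And>R. set_integrable lborel (cball 0 R) u"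
    and G_loc: "\<And>i j R. set_integrable lborel (cball 0 R) (G i j)"
    and weak: "\<And>i j \<phi> R. \<phi> \<in> bump_algebra \<Longrightarrow> (\<And>x. R < norm x \<Longrightarrow> \<phi> x = 0) \<Longrightarrow>
      (LINT x|lborel. u x * partial_deriv i (partial_deriv j \<phi>) x) = (LINT x|lborel. G i j x * \<phi> x)"
  shows "AE x in lborel. u (x + h) - 2 * u x + u (x - h) =
    (\<Sum>i\<in>UNIV. \<Sum>j\<in>UNIV. h $ i * h $ j * (LINT t|lborel. hat t * G i j (x - t *\<^sub>R h)))"
proof -
  define D where "D x = u (x + h) - 2 * u x + u (x - h)" for x
  define K where "K i j x = (LINT t|lborel. hat t * G i j (x - t *\<^sub>R h))" for i j x
  define S where "S x = (\<Sum>i\<in>UNIV. \<Sum>j\<in>UNIV. h $ i * h $ j * K i j x)" for x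
  have [measurable]: "K i j \<in> borel_measurable borel" for i j
    unfolding K_def[abs_def] by measurable
  have [measurable]: "D \<in> borel_measurable borel" "S \<in> borel_measurable borel"
    unfolding D_def[abs_def] S_def[abs_def] by measurable
  have D_mult: "integrable lborel (\<lambda>x. D x * \<psi> x)"
      "(LINT x|lborel. D x * \<psi> x) = (LINT x|lborel. u x * (\<psi> (x + h) - 2 * \<psi> x + \<psi> (x - h)))"
    and K_mult: "integrable lborel (\<lambda>x. K i j x * \<psi> x)"
    if [measurable]: "\<psi> \<in> borel_measurable borel" and B: "\<And>x. \<bar>\<psi> x\<bar> \<le> B" and R: "\<And>x. R < norm x \<Longrightarrow> \<psi> x = 0"
    for \<psi> B R i j
  proof -
    have shifted: "integrable lborel (\<lambda>x. u x * \<psi> (x + c))" for c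
    proof (rule locally_integrable_mult[OF _ _ u_loc])
      show "\<psi> (x + c) = 0" if "R + norm c < norm x" for x
        using that norm_triangle_ineq4[of "x + c" c] by (intro R) simp
    qed (auto intro: B)
    have moved: "integrable lborel (\<lambda>x. u (x - c) * \<psi> x)"
      "(LINT x|lborel. u (x - c) * \<psi> x) = (LINT x|lborel. u x * \<psi> (x + c))" for c
      using lborel_integral_translate[of "\<lambda>x. u x * \<psi> (x + c)" "- c"] shifted[of c] by auto
    have D_split: "(\<lambda>x. D x * \<psi> x) = (\<lambda>x. u (x - (- h)) * \<psi> x - 2 * (u (x - 0) * \<psi> x) + u (x - h) * \<psi> x)"
      by (simp add: D_def fun_eq_iff left_diff_distrib distrib_right)
    show "integrable lborel (\<lambda>x. D x * \<psi> x)"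
      unfolding D_split by (intro Bochner_Integration.integrable_add Bochner_Integration.integrable_diff
          integrable_mult_right moved)
    have "(LINT x|lborel. D x * \<psi> x) = (LINT x|lborel. u x * \<psi> (x - h)) - 2 * (LINT x|lborel. u x * \<psi> x)
        + (LINT x|lborel. u x * \<psi> (x + h))"
      unfolding D_split using moved[of "- h"] moved[of 0] moved[of h] by simp
    also have "\<dots> = (LINT x|lborel. u x * (\<psi> (x + h) - 2 * \<psi> x + \<psi> (x - h)))"
    proof -
      have "(\<lambda>x. u x * (\<psi> (x + h) - 2 * \<psi> x + \<psi> (x - h))) =
          (\<lambda>x. u x * \<psi> (x + h) - 2 * (u x * \<psi> x) + u x * \<psi> (x - h))"
        by (simp add: fun_eq_iff right_diff_distrib distrib_left)
      then show ?thesis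
        using shifted[of h] shifted[of "- h"] shifted[of 0] by simp
    qed
    finally show "(LINT x|lborel. D x * \<psi> x) = (LINT x|lborel. u x * (\<psi> (x + h) - 2 * \<psi> x + \<psi> (x - h)))" .
    show "integrable lborel (\<lambda>x. K i j x * \<psi> x)"
      using hat_average_duality(2)[OF G that(1) G_loc B R] by (simp add: K_def mult.commute)
  qed
  have S_mult: "integrable lborel (\<lambda>x. S x * \<psi> x)"
      "(LINT x|lborel. S x * \<psi> x) = (\<Sum>i\<in>UNIV. \<Sum>j\<in>UNIV. h $ i * h $ j * (LINT x|lborel. K i j x * \<psi> x))"
    if "\<psi> \<in> borel_measurable borel" and B: "\<And>x. \<bar>\<psi> x\<bar> \<le> B" and R: "\<And>x. R < norm x \<Longrightarrow> \<psi> x = 0"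
    for \<psi> B R
  proof -
    have eq: "(\<lambda>x. S x * \<psi> x) = (\<lambda>x. \<Sum>i\<in>UNIV. \<Sum>j\<in>UNIV. h $ i * h $ j * (K i j x * \<psi> x))"
      by (simp add: S_def sum_distrib_right mult.assoc)
    show "integrable lborel (\<lambda>x. S x * \<psi> x)"
      unfolding eq using K_mult[OF that] by simp
    show "(LINT x|lborel. S x * \<psi> x) = (\<Sum>i\<in>UNIV. \<Sum>j\<in>UNIV. h $ i * h $ j * (LINT x|lborel. K i j x * \<psi> x))"
      unfolding eq using K_mult[OF that] by (simp add: Bochner_Integration.integral_sum)
  qed
  have "AE x in lborel. D x - S x = 0"
  proof (rule zero_against_box_bumps_imp_zero)
    fix a b :: "real ^ 'n"
    obtain R where R: "\<And>x. x \<in> box a b \<Longrightarrow> norm x \<le> R"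
      using bounded_box[of a b] by (auto simp: bounded_iff)
    have ind: "indicator (box a b) \<in> borel_measurable borel" "\<bar>indicator (box a b) x :: real\<bar> \<le> 1"
      "R < norm x \<Longrightarrow> indicator (box a b) x = (0 :: real)" for x
      using R[of x] by (auto simp: indicator_def not_less[symmetric])
    have "integrable lborel (\<lambda>x. D x * indicator (box a b) x - S x * indicator (box a b) x)"
      by (intro Bochner_Integration.integrable_diff D_mult(1)[OF ind] S_mult(1)[OF ind])
    then show "set_integrable lborel (box a b) (\<lambda>x. D x - S x)"
      by (simp add: set_integrable_def right_diff_distrib left_diff_distrib mult.commute)
    fix m
    define \<phi> where "\<phi> = box_bump m a b"
    have \<phi>: "\<phi> \<in> bump_algebra" by (simp add: \<phi>_def box_bump_in_bump_algebra)
    have \<phi>R: "\<phi> x = 0" if "R < norm x" for x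
      using that R[of x] box_bump_eq_0[of x a b m] by (auto simp: \<phi>_def not_le)
    have bump_meas: "\<psi> \<in> borel_measurable borel" if "\<psi> \<in> bump_algebra" for \<psi> :: "real ^ 'n \<Rightarrow> real"
      by (intro borel_measurable_continuous_onI bump_algebra_continuous that)
    obtain B where B: "\<And>x. \<bar>\<phi> x\<bar> \<le> B"
      using bump_algebra_bounded[OF \<phi> \<phi>R] by blast
    note \<phi>' = bump_meas[OF \<phi>] B \<phi>R
    have pair: "(LINT x|lborel. u x * (LINT t|lborel. hat t * partial_deriv i (partial_deriv j \<phi>) (x + t *\<^sub>R h)))
          = (LINT x|lborel. K i j x * \<phi> x)"
      and pair_int: "integrable lborel (\<lambda>x. u x * (LINT t|lborel. hat t * partial_deriv i (partial_deriv j \<phi>) (x + t *\<^sub>R h)))"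
      for i j
    proof -
      let ?d = "partial_deriv i (partial_deriv j \<phi>)"
      have d: "?d \<in> bump_algebra" by (intro bump_algebra_partial_deriv \<phi>)
      have "partial_deriv j \<phi> x = 0" if "R < norm x" for x
        by (rule bump_algebra_partial_deriv_support[OF \<phi> \<phi>R that])
      then have dR: "?d x = 0" if "R < norm x" for x
        by (rule bump_algebra_partial_deriv_support[OF bump_algebra_partial_deriv[OF \<phi>] _ that])
      obtain B' where B': "\<And>x. \<bar>?d x\<bar> \<le> B'"
        using bump_algebra_bounded[OF d dR] by blast
      have translated: "(LINT x|lborel. u x * ?d (x + c)) = (LINT x|lborel. G i j x * \<phi> (x + c))" for c
      proof -
        have "partial_deriv j (\<lambda>x. \<phi> (x + c)) = (\<lambda>x. partial_deriv j \<phi> (x + c))"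
          by (intro ext partial_deriv_translate bump_algebra_differentiable \<phi>)
        then have "partial_deriv i (partial_deriv j (\<lambda>x. \<phi> (x + c))) = (\<lambda>x. ?d (x + c))"
          by (simp only:) (intro ext partial_deriv_translate bump_algebra_differentiable bump_algebra_partial_deriv \<phi>)
        moreover have "\<phi> (x + c) = 0" if "R + norm c < norm x" for x
          using that norm_triangle_ineq4[of "x + c" c] by (intro \<phi>R) simp
        ultimately show ?thesis
          using weak[OF bump_algebra_translate[OF \<phi>, of c], of "R + norm c" i j] by simp
      qed
      show "integrable lborel (\<lambda>x. u x * (LINT t|lborel. hat t * ?d (x + t *\<^sub>R h)))"
        by (rule hat_average_duality(1)[OF u bump_meas[OF d] u_loc B' dR])
      have "(LINT x|lborel. u x * (LINT t|lborel. hat t * ?d (x + t *\<^sub>R h))) =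
          (LINT t|lborel. hat t * (LINT x|lborel. G i j x * \<phi> (x + t *\<^sub>R h)))"
        using hat_average_duality(3)[OF u bump_meas[OF d] u_loc B' dR, where h = h] by (simp add: translated)
      also have "\<dots> = (LINT x|lborel. K i j x * \<phi> x)"
        using hat_average_duality(4)[OF G[of i j] bump_meas[OF \<phi>] G_loc B \<phi>R, where h = h]
        by (simp add: K_def mult.commute)
      finally show "(LINT x|lborel. u x * (LINT t|lborel. hat t * ?d (x + t *\<^sub>R h))) = (LINT x|lborel. K i j x * \<phi> x)" .
    qed
    have "(LINT x|lborel. D x * \<phi> x) = (LINT x|lborel. u x * (\<phi> (x + h) - 2 * \<phi> x + \<phi> (x - h)))"
      by (rule D_mult(2)[OF \<phi>'])
    also have "\<dots> = (LINT x|lborel. (\<Sum>i\<in>UNIV. \<Sum>j\<in>UNIV. h $ i * h $ j *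
        (u x * (LINT t|lborel. hat t * partial_deriv i (partial_deriv j \<phi>) (x + t *\<^sub>R h)))))"
      unfolding second_difference_eq_hat_average[OF \<phi>] sum_distrib_left
      by (intro Bochner_Integration.integral_cong refl sum.cong) (simp only: mult_ac)
    also have "\<dots> = (LINT x|lborel. S x * \<phi> x)"
      using pair_int by (simp add: Bochner_Integration.integral_sum pair S_mult(2)[OF \<phi>'])
    finally show "(LINT x|lborel. (D x - S x) * box_bump m a b x) = 0"
      using D_mult(1)[OF \<phi>'] S_mult(1)[OF \<phi>'] by (simp add: left_diff_distrib flip: \<phi>_def)
  qed
  then show ?thesis
    by eventually_elim (simp add: D_def S_def K_def)
qed

section \<open>Continuity of translation in the Lebesgue spaces\<close>

text \<open>
  The sum is at most twice the larger summand, and the power of the larger one is at most the sum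
  of both powers.
\<close>

lemma powr_sum_bound:
  fixes a b p :: real
  assumes "0 \<le> p"
  shows "\<bar>a + b\<bar> powr p \<le> 2 powr p * (\<bar>a\<bar> powr p + \<bar>b\<bar> powr p)"
proof -
  have "\<bar>a + b\<bar> powr p \<le> (2 * max \<bar>a\<bar> \<bar>b\<bar>) powr p"
    using assms by (intro powr_mono2) auto
  also have "\<dots> = 2 powr p * max \<bar>a\<bar> \<bar>b\<bar> powr p"
    by (simp add: powr_mult)
  also have "max \<bar>a\<bar> \<bar>b\<bar> powr p \<le> \<bar>a\<bar> powr p + \<bar>b\<bar> powr p"
    by (auto simp: max_def)
  finally show ?thesis by simp
qed

lemma nn_integral_powr_sum_bound:
  fixes f g :: "'a \<Rightarrow> real"
  assumes [measurable]: "f \<in> borel_measurable M" "g \<in> borel_measurable M" and p: "0 \<le> p"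
  shows "(\<integral>\<^sup>+x. ennreal (\<bar>f x + g x\<bar> powr p) \<partial>M) \<le>
    ennreal (2 powr p) * ((\<integral>\<^sup>+x. ennreal (\<bar>f x\<bar> powr p) \<partial>M) + (\<integral>\<^sup>+x. ennreal (\<bar>g x\<bar> powr p) \<partial>M))"
proof -
  have "(\<integral>\<^sup>+x. ennreal (\<bar>f x + g x\<bar> powr p) \<partial>M) \<le>
      (\<integral>\<^sup>+x. ennreal (2 powr p) * (ennreal (\<bar>f x\<bar> powr p) + ennreal (\<bar>g x\<bar> powr p)) \<partial>M)"
    by (intro nn_integral_mono)
      (simp add: ennreal_mult'[symmetric] ennreal_plus[symmetric] powr_sum_bound p ennreal_leI del: ennreal_plus)
  then show ?thesis
    by (simp add: nn_integral_cmult nn_integral_add)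
qed

lemma nn_integral_lborel_translate:
  fixes f :: "'a::euclidean_space \<Rightarrow> ennreal"
  assumes "f \<in> borel_measurable borel"
  shows "(\<integral>\<^sup>+x. f (x + c) \<partial>lborel) = (\<integral>\<^sup>+x. f x \<partial>lborel)"
  using assms by (subst (2) lborel_distr_plus[symmetric, of c], subst nn_integral_distr) (auto simp: add.commute)

text \<open>
  The \<open>p\<close>-th power of the \<open>L^p\<close> distance between \<open>g\<close> and its translate.
\<close>

definition shift_dist :: "real \<Rightarrow> ('a::euclidean_space \<Rightarrow> real) \<Rightarrow> 'a \<Rightarrow> ennreal" where
  "shift_dist p g y = (\<integral>\<^sup>+x. ennreal (\<bar>g (x + y) - g x\<bar> powr p) \<partial>lborel)"

definition shift_continuous :: "real \<Rightarrow> ('a::euclidean_space \<Rightarrow> real) \<Rightarrow> bool" where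
  "shift_continuous p g \<longleftrightarrow> (shift_dist p g \<longlongrightarrow> 0) (at 0)"

lemma measurable_shift_dist:
  assumes [measurable]: "g \<in> borel_measurable borel"
  shows "shift_dist p g \<in> borel_measurable borel"
proof -
  have [measurable]: "(\<lambda>y. g (fst y + snd y)) \<in> borel_measurable (borel \<Otimes>\<^sub>M borel)"
    by measurable
  show ?thesis unfolding shift_dist_def[abs_def] by measurable
qed

lemma shift_dist_bound:
  assumes [measurable]: "g \<in> borel_measurable borel" and p: "0 \<le> p"
  shows "shift_dist p g y \<le> ennreal (2 * 2 powr p) * (\<integral>\<^sup>+x. ennreal (\<bar>g x\<bar> powr p) \<partial>lborel)"
proof -
  have "shift_dist p g y \<le> ennreal (2 powr p) * ((\<integral>\<^sup>+x. ennreal (\<bar>g (x + y)\<bar> powr p) \<partial>lborel) +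
      (\<integral>\<^sup>+x. ennreal (\<bar>g x\<bar> powr p) \<partial>lborel))"
    using nn_integral_powr_sum_bound[of "\<lambda>x. g (x + y)" lborel "\<lambda>x. - g x" p] p
    by (simp add: shift_dist_def)
  also have "\<dots> = ennreal (2 * 2 powr p) * (\<integral>\<^sup>+x. ennreal (\<bar>g x\<bar> powr p) \<partial>lborel)"
    by (simp add: nn_integral_lborel_translate[of "\<lambda>x. ennreal (\<bar>g x\<bar> powr p)"] mult_2[symmetric] ennreal_mult mult_ac)
  finally show ?thesis .
qed

text \<open>
  Translations are isometries of \<open>L^p\<close>, so \<open>g\<close> moves at most as much as \<open>f n\<close> does, up to a multiple of
  the distance between \<open>g\<close> and \<open>f n\<close> that does not depend on the translation.
\<close>

lemma shift_continuous_limit: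
  assumes [measurable]: "g \<in> borel_measurable borel" "\<And>n. f n \<in> borel_measurable borel" and p: "0 \<le> p"
    and f: "\<And>n. shift_continuous p (f n)"
    and lim: "(\<lambda>n. \<integral>\<^sup>+x. ennreal (\<bar>g x - f n x\<bar> powr p) \<partial>lborel) \<longlonglongrightarrow> 0"
  shows "shift_continuous p g"
  unfolding shift_continuous_def
proof (rule tendsto_0_if_Limsup_eq_0_ennreal)
  let ?c = "ennreal (2 powr p * (2 * 2 powr p))"
  let ?e = "\<lambda>n. \<integral>\<^sup>+x. ennreal (\<bar>g x - f n x\<bar> powr p) \<partial>lborel"
  have "Limsup (at 0) (shift_dist p g) \<le> ?c * ?e n" for n
  proof -
    have "shift_dist p g y \<le> ?c * ?e n + ennreal (2 powr p) * shift_dist p (f n) y" for y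
    proof -
      have "shift_dist p g y \<le> ennreal (2 powr p) * (shift_dist p (\<lambda>x. g x - f n x) y + shift_dist p (f n) y)"
        using nn_integral_powr_sum_bound[of "\<lambda>x. (g (x + y) - f n (x + y)) - (g x - f n x)" lborel
            "\<lambda>x. f n (x + y) - f n x" p] p
        by (simp add: shift_dist_def)
      also have "\<dots> \<le> ennreal (2 powr p) * (ennreal (2 * 2 powr p) * ?e n + shift_dist p (f n) y)"
        by (intro mult_left_mono add_right_mono shift_dist_bound p) auto
      finally show ?thesis by (simp add: distrib_left ennreal_mult mult.assoc)
    qed
    then have "Limsup (at 0) (shift_dist p g) \<le> Limsup (at 0) (\<lambda>y. ?c * ?e n + ennreal (2 powr p) * shift_dist p (f n) y)"
      by (intro Limsup_mono always_eventually) auto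
    also have "((\<lambda>y. ?c * ?e n + ennreal (2 powr p) * shift_dist p (f n) y) \<longlongrightarrow> ?c * ?e n + ennreal (2 powr p) * 0) (at 0)"
      using f[of n] unfolding shift_continuous_def
      by (intro tendsto_add tendsto_const ennreal_tendsto_cmult) auto
    then have "Limsup (at 0) (\<lambda>y. ?c * ?e n + ennreal (2 powr p) * shift_dist p (f n) y) = ?c * ?e n"
      by (intro lim_imp_Limsup) auto
    finally show ?thesis .
  qed
  moreover have "(\<lambda>n. ?c * ?e n) \<longlonglongrightarrow> ?c * 0"
    by (intro ennreal_tendsto_cmult lim) auto
  ultimately have "Limsup (at 0) (shift_dist p g) \<le> ?c * 0"
    by (intro LIMSEQ_le_const) auto
  then show "Limsup (at 0) (shift_dist p g) = 0" by simp
qed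

lemma shift_continuous_compact_support:
  fixes f :: "'a::euclidean_space \<Rightarrow> real"
  assumes cont: "continuous_on UNIV f" and R: "\<And>x. R < norm x \<Longrightarrow> f x = 0" and p: "0 < p"
    and B: "\<And>x. \<bar>f x\<bar> \<le> B"
  shows "shift_continuous p f"
  unfolding shift_continuous_def tendsto_at_iff_sequentially
proof (intro allI impI, unfold comp_def)
  fix y :: "nat \<Rightarrow> 'a"
  assume "y \<longlonglongrightarrow> 0"
  then have "Bseq y" by (intro convergent_imp_Bseq) (auto simp: convergent_def)
  then obtain K where K: "\<And>n. norm (y n) \<le> K" by (auto simp: Bseq_def)
  have [measurable]: "f \<in> borel_measurable borel"
    by (rule borel_measurable_continuous_onI[OF cont])
  let ?S = "cball (0::'a) (R + K)"
  have "(\<lambda>n. \<integral>\<^sup>+x. ennreal (\<bar>f (x + y n) - f x\<bar> powr p) \<partial>lborel) \<longlonglongrightarrow>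
      (\<integral>\<^sup>+x. 0 \<partial>(lborel :: 'a measure))"
  proof (rule nn_integral_dominated_convergence[where w = "\<lambda>x. ennreal ((2 * B) powr p) * indicator ?S x"])
    show "AE x in lborel. ennreal (\<bar>f (x + y n) - f x\<bar> powr p) \<le> ennreal ((2 * B) powr p) * indicator ?S x" for n
    proof (rule AE_I2)
      fix x
      show "ennreal (\<bar>f (x + y n) - f x\<bar> powr p) \<le> ennreal ((2 * B) powr p) * indicator ?S x"
      proof (cases "x \<in> ?S")
        case True
        have "\<bar>f (x + y n) - f x\<bar> \<le> 2 * B" using B[of x] B[of "x + y n"] by linarith
        then show ?thesis using True p by (auto intro!: ennreal_leI powr_mono2)
      next
        case False
        moreover have "0 \<le> K" by (rule order.trans[OF norm_ge_zero K])
        ultimately have "R < norm x" "R < norm (x + y n)"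
          using K[of n] norm_triangle_ineq4[of "x + y n" "y n"] by auto
        then show ?thesis using R by simp
      qed
    qed
    show "(\<integral>\<^sup>+x. ennreal ((2 * B) powr p) * indicator ?S x \<partial>lborel) < \<infinity>"
      using emeasure_lborel_cball_finite[of 0 "R + K"]
      by (subst nn_integral_cmult_indicator) (auto simp: ennreal_mult_less_top)
    show "AE x in lborel. (\<lambda>n. ennreal (\<bar>f (x + y n) - f x\<bar> powr p)) \<longlonglongrightarrow> 0"
    proof (rule AE_I2)
      fix x
      have y': "(\<lambda>n. x + y n) \<longlonglongrightarrow> x + 0"
        by (intro tendsto_add tendsto_const \<open>y \<longlonglongrightarrow> 0\<close>)
      have "isCont f (x + 0)"
        using cont by (simp add: continuous_on_eq_continuous_at)
      from isCont_tendsto_compose[OF this y'] have "(\<lambda>n. f (x + y n)) \<longlonglongrightarrow> f (x + 0)" .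
      then have "(\<lambda>n. f (x + y n) - f x) \<longlonglongrightarrow> 0"
        by (simp add: LIM_zero)
      then have "(\<lambda>n. \<bar>f (x + y n) - f x\<bar> powr p) \<longlonglongrightarrow> 0 powr p"
        using p by (intro tendsto_powr' tendsto_rabs_zero tendsto_const) auto
      from tendsto_ennrealI[OF this]
      show "(\<lambda>n. ennreal (\<bar>f (x + y n) - f x\<bar> powr p)) \<longlonglongrightarrow> 0" by simp
    qed
    show "(\<lambda>x. ennreal (\<bar>f (x + y n) - f x\<bar> powr p)) \<in> borel_measurable lborel" for n
      by measurable
    show "(\<lambda>x. ennreal ((2 * B) powr p) * indicator ?S x) \<in> borel_measurable lborel"
      by (intro borel_measurable_times_ennreal borel_measurable_const borel_measurable_indicator) simp
  qed (rule borel_measurable_const)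
  then show "(\<lambda>n. shift_dist p f (y n)) \<longlonglongrightarrow> 0"
    by (simp add: shift_dist_def)
qed

text \<open>
  A measurable function is an almost everywhere limit of continuous functions. Clamping their
  values and cutting off outside a ball keeps the limit and makes the convergence dominated.
\<close>

lemma shift_continuous_bounded_support:
  fixes g :: "'a::euclidean_space \<Rightarrow> real"
  assumes [measurable]: "g \<in> borel_measurable borel"
    and R: "\<And>x. R < norm x \<Longrightarrow> g x = 0" and p: "0 < p" and B: "\<And>x. \<bar>g x\<bar> \<le> B"
  shows "shift_continuous p g"
proof -
  have "g measurable_on UNIV"
    by (rule lebesgue_measurable_imp_measurable_on_real) (auto intro: measurable_completion)
  then obtain N c where N: "negligible N" and c: "\<And>n. continuous_on UNIV (c n)"
    and lim: "\<And>x. x \<notin> N \<Longrightarrow> (\<lambda>n. c n x) \<longlonglongrightarrow> g x"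
    by (auto simp: measurable_on_def)
  have "AE x in lebesgue. x \<notin> N"
    using N by (simp add: negligible_iff_null_sets AE_not_in)
  then have N_ae: "AE x in lborel. x \<notin> N"
    by (simp add: AE_completion_iff)
  have B0: "0 \<le> B" using B[of 0] by linarith
  \<comment> \<open>The first factor converges to \<open>g\<close> since \<open>|g| \<le> B\<close>; the second is \<open>1\<close> on the ball of radius \<open>R\<close>.\<close>
  define f where "f n x = max (- B) (min B (c n x)) * max 0 (min 1 (R + 1 - norm x))" for n x
  have f_cont: "continuous_on UNIV (f n)" for n
    unfolding f_def by (intro continuous_intros c)
  have f_meas [measurable]: "f n \<in> borel_measurable borel" for n
    by (rule borel_measurable_continuous_onI[OF f_cont])
  have f_supp: "f n x = 0" if "R + 1 < norm x" for n x
    using that by (simp add: f_def)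
  have f_bound: "\<bar>f n x\<bar> \<le> B" for n x
  proof -
    have "\<bar>f n x\<bar> \<le> B * 1"
      unfolding f_def abs_mult using B0 by (intro mult_mono) auto
    then show ?thesis by simp
  qed
  let ?S = "cball (0::'a) (R + 1)"
  show ?thesis
  proof (rule shift_continuous_limit[where f = f])
    show "shift_continuous p (f n)" for n
      by (rule shift_continuous_compact_support[OF f_cont f_supp p f_bound])
    have "(\<lambda>n. \<integral>\<^sup>+x. ennreal (\<bar>g x - f n x\<bar> powr p) \<partial>lborel) \<longlonglongrightarrow> (\<integral>\<^sup>+x. 0 \<partial>(lborel :: 'a measure))"
    proof (rule nn_integral_dominated_convergence[where w = "\<lambda>x. ennreal ((2 * B) powr p) * indicator ?S x"])
      show "AE x in lborel. ennreal (\<bar>g x - f n x\<bar> powr p) \<le> ennreal ((2 * B) powr p) * indicator ?S x" for n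
      proof (rule AE_I2)
        fix x
        have "\<bar>g x - f n x\<bar> \<le> 2 * B" using B[of x] f_bound[of n x] by linarith
        then show "ennreal (\<bar>g x - f n x\<bar> powr p) \<le> ennreal ((2 * B) powr p) * indicator ?S x"
          using p f_supp[of x n] R[of x] by (cases "x \<in> ?S") (auto intro!: ennreal_leI powr_mono2)
      qed
      show "(\<integral>\<^sup>+x. ennreal ((2 * B) powr p) * indicator ?S x \<partial>lborel) < \<infinity>"
        using emeasure_lborel_cball_finite[of 0 "R + 1"]
        by (subst nn_integral_cmult_indicator) (auto simp: ennreal_mult_less_top)
      show "AE x in lborel. (\<lambda>n. ennreal (\<bar>g x - f n x\<bar> powr p)) \<longlonglongrightarrow> 0"
        using N_ae
      proof eventually_elim
        case (elim x)
        have "(\<lambda>n. f n x) \<longlonglongrightarrow> max (- B) (min B (g x)) * max 0 (min 1 (R + 1 - norm x))"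
          unfolding f_def by (intro tendsto_intros lim elim)
        also have "max (- B) (min B (g x)) * max 0 (min 1 (R + 1 - norm x)) = g x"
          using B[of x] R[of x] by (cases "R < norm x") (auto simp: max_def min_def)
        finally have "(\<lambda>n. g x - f n x) \<longlonglongrightarrow> g x - g x"
          by (intro tendsto_intros)
        then have "(\<lambda>n. \<bar>g x - f n x\<bar> powr p) \<longlonglongrightarrow> 0 powr p"
          using p by (intro tendsto_powr' tendsto_rabs_zero tendsto_const) auto
        from tendsto_ennrealI[OF this] show ?case by simp
      qed
      show "(\<lambda>x. ennreal (\<bar>g x - f n x\<bar> powr p)) \<in> borel_measurable lborel" for n
        by measurable
      show "(\<lambda>x. ennreal ((2 * B) powr p) * indicator ?S x) \<in> borel_measurable lborel"
        by (intro borel_measurable_times_ennreal borel_measurable_const borel_measurable_indicator) simp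
    qed (rule borel_measurable_const)
    then show "(\<lambda>n. \<integral>\<^sup>+x. ennreal (\<bar>g x - f n x\<bar> powr p) \<partial>lborel) \<longlonglongrightarrow> 0" by simp
  qed (use p in auto)
qed

text \<open>
  By truncation in the domain and in the range.
\<close>

theorem shift_continuous_Lp:
  fixes g :: "'a::euclidean_space \<Rightarrow> real"
  assumes [measurable]: "g \<in> borel_measurable borel"
    and fin: "(\<integral>\<^sup>+x. ennreal (\<bar>g x\<bar> powr p) \<partial>lborel) < \<infinity>" and p: "0 < p"
  shows "shift_continuous p g"
proof -
  define f where "f n x = (if norm x \<le> real n \<and> \<bar>g x\<bar> \<le> real n then g x else 0)" for n x
  have [measurable]: "f n \<in> borel_measurable borel" for n
    unfolding f_def[abs_def] by measurable
  show ?thesis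
  proof (rule shift_continuous_limit[where f = f])
    show "shift_continuous p (f n)" for n
      by (rule shift_continuous_bounded_support[where R = "real n" and B = "real n"]) (auto simp: f_def p)
    have "(\<lambda>n. \<integral>\<^sup>+x. ennreal (\<bar>g x - f n x\<bar> powr p) \<partial>lborel) \<longlonglongrightarrow> (\<integral>\<^sup>+x. 0 \<partial>(lborel :: 'a measure))"
    proof (rule nn_integral_dominated_convergence[OF _ _ _ _ fin])
      show "AE x in lborel. (\<lambda>n. ennreal (\<bar>g x - f n x\<bar> powr p)) \<longlonglongrightarrow> 0"
      proof (rule AE_I2, rule tendsto_eventually)
        fix x
        obtain m where "max (norm x) \<bar>g x\<bar> \<le> real m" using real_arch_simple by blast
        then have "\<bar>g x - f n x\<bar> powr p = 0" if "m \<le> n" for n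
          using that by (auto simp: f_def)
        then show "\<forall>\<^sub>F n in sequentially. ennreal (\<bar>g x - f n x\<bar> powr p) = 0"
          unfolding eventually_sequentially by (intro exI[of _ m]) simp
      qed
    qed (auto simp: f_def)
    then show "(\<lambda>n. \<integral>\<^sup>+x. ennreal (\<bar>g x - f n x\<bar> powr p) \<partial>lborel) \<longlonglongrightarrow> 0" by simp
  qed (use p in auto)
qed

section \<open>Averaging against a concentrating kernel\<close>

lemma powr_above_tangent:
  fixes a A p :: real
  assumes p: "1 \<le> p" and A: "0 < A" and a: "0 \<le> a"
  shows "A powr p + p * A powr (p - 1) * (a - A) \<le> a powr p"
proof (cases "a = 0")
  case True
  have "A powr (p - 1) * A = A powr p"
    using A powr_add[of A "p - 1" 1] by simp
  then have "A powr p + p * A powr (p - 1) * (a - A) = (1 - p) * A powr p"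
    using True by (simp add: algebra_simps)
  then show ?thesis using p True by (simp add: mult_nonpos_nonneg)
next
  case False
  have "a powr p - A powr p \<ge> p * A powr (p - 1) * (a - A)"
  proof (rule convex_on_imp_above_tangent)
    show "convex_on {0<..} (\<lambda>x. x powr p)" by (rule powr_convex[OF p])
    show "((\<lambda>x. x powr p) has_real_derivative p * A powr (p - 1)) (at A within {0<..})"
      using A by (auto intro!: derivative_eq_intros)
  qed (use A a False in \<open>auto simp: interior_open\<close>)
  then show ?thesis by simp
qed

text \<open>
  Integrate the tangent inequality at the mean \<open>A\<close> of \<open>|f|\<close> against the weight: the linear term
  drops out.
\<close>

lemma weighted_jensen_powr:
  fixes f w :: "'a \<Rightarrow> real"
  assumes p: "1 \<le> p" and w: "\<And>x. 0 \<le> w x" "integrable M w" "(LINT x|M. w x) = 1"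
    and [measurable]: "f \<in> borel_measurable M"
    and fp: "integrable M (\<lambda>x. w x * \<bar>f x\<bar> powr p)"
  shows "integrable M (\<lambda>x. w x * f x)"
    and "\<bar>LINT x|M. w x * f x\<bar> powr p \<le> (LINT x|M. w x * \<bar>f x\<bar> powr p)"
proof -
  have [measurable]: "w \<in> borel_measurable M" using w(2) by simp
  have le: "\<bar>a\<bar> \<le> 1 + \<bar>a\<bar> powr p" for a :: real
  proof (cases "\<bar>a\<bar> \<le> 1")
    case False
    then have "\<bar>a\<bar> powr 1 \<le> \<bar>a\<bar> powr p" using p by (intro powr_mono) auto
    then show ?thesis by simp
  qed (simp add: add_increasing2)
  show int: "integrable M (\<lambda>x. w x * f x)"
  proof (rule Bochner_Integration.integrable_bound)
    show "integrable M (\<lambda>x. w x + w x * \<bar>f x\<bar> powr p)"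
      by (intro Bochner_Integration.integrable_add w fp)
    show "AE x in M. norm (w x * f x) \<le> norm (w x + w x * \<bar>f x\<bar> powr p)"
    proof (rule AE_I2)
      fix x
      have "w x * \<bar>f x\<bar> \<le> w x * (1 + \<bar>f x\<bar> powr p)"
        by (intro mult_left_mono le w)
      then show "norm (w x * f x) \<le> norm (w x + w x * \<bar>f x\<bar> powr p)"
        using w(1)[of x] by (simp add: abs_mult distrib_left)
    qed
  qed measurable
  have int_abs: "integrable M (\<lambda>x. w x * \<bar>f x\<bar>)"
    using integrable_norm[OF int] w(1) by (simp add: abs_mult)
  define A where "A = (LINT x|M. w x * \<bar>f x\<bar>)"
  have A: "\<bar>LINT x|M. w x * f x\<bar> \<le> A"
    using integral_norm_bound[of M "\<lambda>x. w x * f x"] w(1) by (simp add: A_def abs_mult)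
  have rhs: "0 \<le> (LINT x|M. w x * \<bar>f x\<bar> powr p)"
    using w(1) by (intro integral_nonneg_AE) auto
  show "\<bar>LINT x|M. w x * f x\<bar> powr p \<le> (LINT x|M. w x * \<bar>f x\<bar> powr p)"
  proof (cases "A \<le> 0")
    case True
    with A have "(LINT x|M. w x * f x) = 0" by linarith
    then show ?thesis using rhs by simp
  next
    case False
    have tangent: "(\<lambda>x. w x * (A powr p + p * A powr (p - 1) * (\<bar>f x\<bar> - A))) =
          (\<lambda>x. (A powr p - p * A powr (p - 1) * A) * w x + p * A powr (p - 1) * (w x * \<bar>f x\<bar>))"
        by (simp add: fun_eq_iff algebra_simps)    have "(LINT x|M. w x * (A powr p + p * A powr (p - 1) * (\<bar>f x\<bar> - A))) \<le> (LINT x|M. w x * \<bar>f x\<bar> powr p)"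
    proof (rule integral_mono)
      show "integrable M (\<lambda>x. w x * (A powr p + p * A powr (p - 1) * (\<bar>f x\<bar> - A)))"
        unfolding tangent by (intro Bochner_Integration.integrable_add integrable_mult_right w int_abs)
      show "w x * (A powr p + p * A powr (p - 1) * (\<bar>f x\<bar> - A)) \<le> w x * \<bar>f x\<bar> powr p" for x
        using p False by (intro mult_left_mono powr_above_tangent w) auto
    qed (rule fp)
    also have "(LINT x|M. w x * (A powr p + p * A powr (p - 1) * (\<bar>f x\<bar> - A))) = A powr p"
      unfolding tangent using w int_abs by (simp add: A_def)
    finally have "A powr p \<le> (LINT x|M. w x * \<bar>f x\<bar> powr p)" .
    moreover have "\<bar>LINT x|M. w x * f x\<bar> powr p \<le> A powr p"
      using A p by (intro powr_mono2) auto
    ultimately show ?thesis by linarith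
  qed
qed

definition hat_average :: "('a::euclidean_space \<Rightarrow> real) \<Rightarrow> 'a \<Rightarrow> 'a \<Rightarrow> real" where
  "hat_average g h x = (LINT t|lborel. hat t * g (x - t *\<^sub>R h))"

lemma nn_integral_eq_1_if_integral_eq_1:
  fixes w :: "'a \<Rightarrow> real"
  assumes "\<And>x. 0 \<le> w x" "integrable M w" "(LINT x|M. w x) = 1"
  shows "(\<integral>\<^sup>+x. ennreal (w x) \<partial>M) = 1"
  using assms by (subst nn_integral_eq_integral) auto

text \<open>
  The pairs \<open>(h, t)\<close> carry the probability density \<open>W(h, t) = \<rho>(h) hat(t)\<close>. The difference in question is the
  mean of \<open>m(h) (g(x - t h) - g(x))\<close>; Jensen's inequality and \<open>|m| \<le> 1\<close> bound its \<open>p\<close>-th power by the mean of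
  \<open>|g(x - t h) - g(x)|^p\<close>, and integrating over \<open>x\<close> first gives the distances between translates.
  Tonelli's theorem for \<open>|g(x - t h)|^p\<close> shows that all these means exist for almost every \<open>x\<close>.
\<close>

lemma hat_average_kernel_error:
  fixes g \<rho> m :: "'a::euclidean_space \<Rightarrow> real"
  assumes p: "1 \<le> p" and \<rho>: "\<And>x. 0 \<le> \<rho> x" "integrable lborel \<rho>" "(LINT x|lborel. \<rho> x) = 1"
    and m [measurable]: "m \<in> borel_measurable borel" and m1: "\<And>h. \<bar>m h\<bar> \<le> 1"
    and g [measurable]: "g \<in> borel_measurable borel"
    and fin: "(\<integral>\<^sup>+x. ennreal (\<bar>g x\<bar> powr p) \<partial>lborel) < \<infinity>"
  shows "AE x in lborel. integrable lborel (\<lambda>h. \<rho> h * (m h * hat_average g h x))"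
    and "(\<integral>\<^sup>+x. ennreal (\<bar>(LINT h|lborel. \<rho> h * (m h * hat_average g h x)) - (LINT h|lborel. \<rho> h * m h) * g x\<bar> powr p) \<partial>lborel)
      \<le> (\<integral>\<^sup>+h. ennreal (\<rho> h) * (\<integral>\<^sup>+t. ennreal (hat t) * shift_dist p g (- (t *\<^sub>R h)) \<partial>lborel) \<partial>lborel)"
proof -
  let ?M = "lborel \<Otimes>\<^sub>M lborel :: ('a \<times> real) measure"
  interpret P: pair_sigma_finite "lborel :: 'a measure" ?M
    unfolding lborel_prod by unfold_locales
  have [measurable]: "\<rho> \<in> borel_measurable borel" using \<rho>(2) by auto
  define W where "W z = \<rho> (fst z) * hat (snd z)" for z
  have W_meas [measurable]: "W \<in> borel_measurable ?M"
    unfolding W_def[abs_def] by measurable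
  have W0: "0 \<le> W z" for z by (simp add: W_def \<rho>)
  have hat_nn: "(\<integral>\<^sup>+t. ennreal (hat t) \<partial>lborel) = 1"
    by (rule nn_integral_eq_1_if_integral_eq_1[OF hat_nonneg hat_integral])
  have W_nn: "(\<integral>\<^sup>+z. ennreal (W z) \<partial>?M) = 1"
  proof -
    have "(\<integral>\<^sup>+z. ennreal (W z) \<partial>?M) = (\<integral>\<^sup>+h. \<integral>\<^sup>+t. ennreal (W (h, t)) \<partial>lborel \<partial>lborel)"
      by (rule lborel.nn_integral_fst[symmetric]) measurable
    also have "\<dots> = (\<integral>\<^sup>+h. ennreal (\<rho> h) \<partial>lborel)"
      by (simp add: W_def ennreal_mult \<rho> nn_integral_cmult hat_nn)
    finally show ?thesis by (simp add: nn_integral_eq_1_if_integral_eq_1 \<rho>)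
  qed
  have W_int: "integrable ?M W"
    using W_nn W0 by (intro integrableI_nonneg) auto
  have W_1: "(LINT z|?M. W z) = 1"
    using W_nn W0 by (subst integral_eq_nn_integral) auto
  have [measurable]: "(\<lambda>z. g (x - snd z *\<^sub>R fst z)) \<in> borel_measurable ?M" for x
    by measurable
  have [measurable]: "(\<lambda>(x, z). g (x - snd z *\<^sub>R fst z)) \<in> borel_measurable (lborel \<Otimes>\<^sub>M ?M)"
    by measurable
  have swap: "(\<integral>\<^sup>+x. \<integral>\<^sup>+z. ennreal (W z * F x z) \<partial>?M \<partial>lborel) =
      (\<integral>\<^sup>+z. ennreal (W z) * (\<integral>\<^sup>+x. ennreal (F x z) \<partial>lborel) \<partial>?M)"
    if [measurable]: "(\<lambda>(x, z). F x z) \<in> borel_measurable (lborel \<Otimes>\<^sub>M ?M)" and F0: "\<And>x z. 0 \<le> F x z"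
    for F :: "'a \<Rightarrow> 'a \<times> real \<Rightarrow> real"
  proof -
    have "(\<integral>\<^sup>+x. \<integral>\<^sup>+z. ennreal (W z * F x z) \<partial>?M \<partial>lborel) = (\<integral>\<^sup>+z. \<integral>\<^sup>+x. ennreal (W z * F x z) \<partial>lborel \<partial>?M)"
      by (rule P.Fubini'[symmetric]) measurable
    also have "\<dots> = (\<integral>\<^sup>+z. ennreal (W z) * (\<integral>\<^sup>+x. ennreal (F x z) \<partial>lborel) \<partial>?M)"
      by (intro nn_integral_cong) (simp add: ennreal_mult W0 F0 nn_integral_cmult)
    finally show ?thesis .
  qed
  have "(\<integral>\<^sup>+x. \<integral>\<^sup>+z. ennreal (W z * \<bar>g (x - snd z *\<^sub>R fst z)\<bar> powr p) \<partial>?M \<partial>lborel) =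
      (\<integral>\<^sup>+z. ennreal (W z) * (\<integral>\<^sup>+x. ennreal (\<bar>g (x - snd z *\<^sub>R fst z)\<bar> powr p) \<partial>lborel) \<partial>?M)"
    by (rule swap[OF _ powr_ge_zero]) measurable
  also have "\<dots> = (\<integral>\<^sup>+z. ennreal (W z) \<partial>?M) * (\<integral>\<^sup>+x. ennreal (\<bar>g x\<bar> powr p) \<partial>lborel)"
    using nn_integral_lborel_translate[of "\<lambda>x. ennreal (\<bar>g x\<bar> powr p)" "- (snd z *\<^sub>R fst z)" for z]
    by (subst nn_integral_multc[symmetric]) auto
  also have "\<dots> < \<infinity>" using W_nn fin by simp
  finally have "AE x in lborel. (\<integral>\<^sup>+z. ennreal (W z * \<bar>g (x - snd z *\<^sub>R fst z)\<bar> powr p) \<partial>?M) \<noteq> \<infinity>"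
    by (intro nn_integral_PInf_AE) auto
  then have AE_p: "AE x in lborel. integrable ?M (\<lambda>z. W z * \<bar>g (x - snd z *\<^sub>R fst z)\<bar> powr p)"
    by eventually_elim (intro integrableI_nonneg, auto simp: W0 less_top)
  have key: "integrable lborel (\<lambda>h. \<rho> h * (m h * hat_average g h x))"
    "\<bar>(LINT h|lborel. \<rho> h * (m h * hat_average g h x)) - (LINT h|lborel. \<rho> h * m h) * g x\<bar> powr p
      \<le> (LINT z|?M. W z * \<bar>g (x - snd z *\<^sub>R fst z) - g x\<bar> powr p)"
    "integrable ?M (\<lambda>z. W z * \<bar>g (x - snd z *\<^sub>R fst z) - g x\<bar> powr p)"
    if x: "integrable ?M (\<lambda>z. W z * \<bar>g (x - snd z *\<^sub>R fst z)\<bar> powr p)" for x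
  proof -
    show int_diff: "integrable ?M (\<lambda>z. W z * \<bar>g (x - snd z *\<^sub>R fst z) - g x\<bar> powr p)"
    proof (rule Bochner_Integration.integrable_bound)
      show "integrable ?M (\<lambda>z. 2 powr p * (W z * \<bar>g (x - snd z *\<^sub>R fst z)\<bar> powr p + \<bar>g x\<bar> powr p * W z))"
        by (intro integrable_mult_right Bochner_Integration.integrable_add x W_int)
      show "AE z in ?M. norm (W z * \<bar>g (x - snd z *\<^sub>R fst z) - g x\<bar> powr p) \<le>
          norm (2 powr p * (W z * \<bar>g (x - snd z *\<^sub>R fst z)\<bar> powr p + \<bar>g x\<bar> powr p * W z))"
      proof (rule AE_I2)
        fix z
        have "W z * \<bar>g (x - snd z *\<^sub>R fst z) - g x\<bar> powr p \<le>
            W z * (2 powr p * (\<bar>g (x - snd z *\<^sub>R fst z)\<bar> powr p + \<bar>g x\<bar> powr p))"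
          using powr_sum_bound[of p "g (x - snd z *\<^sub>R fst z)" "- g x"] p
          by (intro mult_left_mono W0) auto
        also have "\<dots> = 2 powr p * (W z * \<bar>g (x - snd z *\<^sub>R fst z)\<bar> powr p + \<bar>g x\<bar> powr p * W z)"
          by (simp add: algebra_simps)
        finally show "norm (W z * \<bar>g (x - snd z *\<^sub>R fst z) - g x\<bar> powr p) \<le>
          norm (2 powr p * (W z * \<bar>g (x - snd z *\<^sub>R fst z)\<bar> powr p + \<bar>g x\<bar> powr p * W z))"
          by (simp add: W0 abs_mult)
      qed
    qed measurable
    have mle: "\<bar>m h * a\<bar> powr p \<le> \<bar>a\<bar> powr p" for h a
      using m1[of h] p mult_right_mono[of "\<bar>m h\<bar>" 1 "\<bar>a\<bar>"] by (intro powr_mono2) (auto simp: abs_mult)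
    have m_int: "integrable ?M (\<lambda>z. W z * \<bar>m (fst z) * f z\<bar> powr p)"
      "(LINT z|?M. W z * \<bar>m (fst z) * f z\<bar> powr p) \<le> (LINT z|?M. W z * \<bar>f z\<bar> powr p)"
      if [measurable]: "f \<in> borel_measurable ?M" and f: "integrable ?M (\<lambda>z. W z * \<bar>f z\<bar> powr p)" for f
    proof -
      show "integrable ?M (\<lambda>z. W z * \<bar>m (fst z) * f z\<bar> powr p)"
      proof (rule Bochner_Integration.integrable_bound[OF f])
        show "AE z in ?M. norm (W z * \<bar>m (fst z) * f z\<bar> powr p) \<le> norm (W z * \<bar>f z\<bar> powr p)"
        proof (rule AE_I2)
          fix z
          have "W z * \<bar>m (fst z) * f z\<bar> powr p \<le> W z * \<bar>f z\<bar> powr p"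
            by (intro mult_left_mono mle W0)
          then show "norm (W z * \<bar>m (fst z) * f z\<bar> powr p) \<le> norm (W z * \<bar>f z\<bar> powr p)"
            by (simp add: abs_mult W0)
        qed
      qed measurable
      then show "(LINT z|?M. W z * \<bar>m (fst z) * f z\<bar> powr p) \<le> (LINT z|?M. W z * \<bar>f z\<bar> powr p)"
        by (intro integral_mono f mult_left_mono mle W0)
    qed
    have int_mg: "integrable ?M (\<lambda>z. W z * (m (fst z) * g (x - snd z *\<^sub>R fst z)))"
      by (rule weighted_jensen_powr(1)[OF p W0 W_int W_1 _ m_int(1)[OF _ x]]) measurable
    have split: "(\<lambda>(h, t). W (h, t) * (m (fst (h, t)) * g (x - snd (h, t) *\<^sub>R fst (h, t)))) =
        (\<lambda>z. W z * (m (fst z) * g (x - snd z *\<^sub>R fst z)))" by auto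
    have inner: "(LINT t|lborel. W (h, t) * (m (fst (h, t)) * g (x - snd (h, t) *\<^sub>R fst (h, t)))) =
        \<rho> h * (m h * hat_average g h x)" for h
      by (simp add: W_def hat_average_def mult_ac flip: integral_mult_right_zero)
    show "integrable lborel (\<lambda>h. \<rho> h * (m h * hat_average g h x))"
      using lborel_pair.integrable_fst[of "\<lambda>h t. W (h, t) * (m (fst (h, t)) * g (x - snd (h, t) *\<^sub>R fst (h, t)))"]
        int_mg unfolding split inner by blast
    have T: "(LINT h|lborel. \<rho> h * (m h * hat_average g h x)) = (LINT z|?M. W z * (m (fst z) * g (x - snd z *\<^sub>R fst z)))"
      using lborel_pair.integral_fst[of "\<lambda>h t. W (h, t) * (m (fst (h, t)) * g (x - snd (h, t) *\<^sub>R fst (h, t)))"]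
        int_mg unfolding split inner by blast
    have int_m: "integrable ?M (\<lambda>z. W z * m (fst z))"
    proof (rule Bochner_Integration.integrable_bound[OF W_int])
      show "AE z in ?M. norm (W z * m (fst z)) \<le> norm (W z)"
        using mult_left_mono[OF m1 W0] by (intro AE_I2) (simp add: abs_mult W0)
    qed measurable
    have inner_m: "(LINT t|lborel. W (h, t) * m (fst (h, t))) = \<rho> h * m h" for h
      by (simp add: W_def hat_integral mult.assoc mult.commute[of "hat _"])
    have C: "(LINT h|lborel. \<rho> h * m h) = (LINT z|?M. W z * m (fst z))"
      using lborel_pair.integral_fst'[OF int_m] unfolding inner_m .
    have err: "(LINT h|lborel. \<rho> h * (m h * hat_average g h x)) - (LINT h|lborel. \<rho> h * m h) * g x =
        (LINT z|?M. W z * (m (fst z) * (g (x - snd z *\<^sub>R fst z) - g x)))"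
      unfolding T C using int_mg int_m
      by (simp add: right_diff_distrib mult.assoc[symmetric])
    have jensen: "\<bar>LINT z|?M. W z * (m (fst z) * (g (x - snd z *\<^sub>R fst z) - g x))\<bar> powr p
        \<le> (LINT z|?M. W z * \<bar>m (fst z) * (g (x - snd z *\<^sub>R fst z) - g x)\<bar> powr p)"
      by (rule weighted_jensen_powr(2)[OF p W0 W_int W_1 _ m_int(1)[OF _ int_diff]]) measurable
    have drop: "(LINT z|?M. W z * \<bar>m (fst z) * (g (x - snd z *\<^sub>R fst z) - g x)\<bar> powr p) \<le> (LINT z|?M. W z * \<bar>g (x - snd z *\<^sub>R fst z) - g x\<bar> powr p)"
      by (rule m_int(2)[OF _ int_diff]) measurable
    show "\<bar>(LINT h|lborel. \<rho> h * (m h * hat_average g h x)) - (LINT h|lborel. \<rho> h * m h) * g x\<bar> powr p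
      \<le> (LINT z|?M. W z * \<bar>g (x - snd z *\<^sub>R fst z) - g x\<bar> powr p)"
      unfolding err using jensen drop by (rule order.trans)
  qed
  show "AE x in lborel. integrable lborel (\<lambda>h. \<rho> h * (m h * hat_average g h x))"
    using AE_p by eventually_elim (rule key(1))
  have "(\<integral>\<^sup>+x. ennreal (\<bar>(LINT h|lborel. \<rho> h * (m h * hat_average g h x)) - (LINT h|lborel. \<rho> h * m h) * g x\<bar> powr p) \<partial>lborel)
      \<le> (\<integral>\<^sup>+x. \<integral>\<^sup>+z. ennreal (W z * \<bar>g (x - snd z *\<^sub>R fst z) - g x\<bar> powr p) \<partial>?M \<partial>lborel)"
  proof (rule nn_integral_mono_AE)
    show "AE x in lborel. ennreal (\<bar>(LINT h|lborel. \<rho> h * (m h * hat_average g h x)) - (LINT h|lborel. \<rho> h * m h) * g x\<bar> powr p)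
        \<le> (\<integral>\<^sup>+z. ennreal (W z * \<bar>g (x - snd z *\<^sub>R fst z) - g x\<bar> powr p) \<partial>?M)"
      using AE_p
    proof eventually_elim
      case (elim x)
      show ?case
        using key(2)[OF elim] W0 by (subst nn_integral_eq_integral[OF key(3)[OF elim]]) (auto intro: ennreal_leI)
    qed
  qed
  also have "\<dots> = (\<integral>\<^sup>+z. ennreal (W z) * (\<integral>\<^sup>+x. ennreal (\<bar>g (x - snd z *\<^sub>R fst z) - g x\<bar> powr p) \<partial>lborel) \<partial>?M)"
    by (rule swap[OF _ powr_ge_zero]) measurable
  also have "\<dots> = (\<integral>\<^sup>+z. ennreal (W z) * shift_dist p g (- (snd z *\<^sub>R fst z)) \<partial>?M)"
    by (simp add: shift_dist_def)
  also have "\<dots> = (\<integral>\<^sup>+h. \<integral>\<^sup>+t. ennreal (W (h, t)) * shift_dist p g (- (snd (h, t) *\<^sub>R fst (h, t))) \<partial>lborel \<partial>lborel)"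
  proof (rule lborel.nn_integral_fst[symmetric])
    have [measurable]: "shift_dist p g \<in> borel_measurable borel"
      by (rule measurable_shift_dist) measurable
    show "(\<lambda>z. ennreal (W z) * shift_dist p g (- (snd z *\<^sub>R fst z))) \<in> borel_measurable ?M"
      by measurable
  qed
  also have "\<dots> = (\<integral>\<^sup>+h. ennreal (\<rho> h) * (\<integral>\<^sup>+t. ennreal (hat t) * shift_dist p g (- (t *\<^sub>R h)) \<partial>lborel) \<partial>lborel)"
  proof (rule nn_integral_cong)
    fix h
    have [measurable]: "shift_dist p g \<in> borel_measurable borel"
      by (rule measurable_shift_dist) measurable
    show "(\<integral>\<^sup>+t. ennreal (W (h, t)) * shift_dist p g (- (snd (h, t) *\<^sub>R fst (h, t))) \<partial>lborel) =
      ennreal (\<rho> h) * (\<integral>\<^sup>+t. ennreal (hat t) * shift_dist p g (- (t *\<^sub>R h)) \<partial>lborel)"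
      by (subst nn_integral_cmult[symmetric]) (simp_all add: W_def ennreal_mult \<rho> mult.assoc)
  qed
  finally show "(\<integral>\<^sup>+x. ennreal (\<bar>(LINT h|lborel. \<rho> h * (m h * hat_average g h x)) - (LINT h|lborel. \<rho> h * m h) * g x\<bar> powr p) \<partial>lborel)
      \<le> (\<integral>\<^sup>+h. ennreal (\<rho> h) * (\<integral>\<^sup>+t. ennreal (hat t) * shift_dist p g (- (t *\<^sub>R h)) \<partial>lborel) \<partial>lborel)" .
qed

text \<open>
  Translates of \<open>g\<close> stay within a bounded distance of \<open>g\<close>; this puts each single non-local Hessian
  into \<open>L^p\<close>, before any limit is taken.
\<close>

lemma hat_average_kernel_error_finite:
  fixes g \<rho> :: "'a::euclidean_space \<Rightarrow> real"
  assumes p: "0 \<le> p" and \<rho>: "\<And>x. 0 \<le> \<rho> x" "integrable lborel \<rho>" "(LINT x|lborel. \<rho> x) = 1"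
    and g [measurable]: "g \<in> borel_measurable borel"
    and fin: "(\<integral>\<^sup>+x. ennreal (\<bar>g x\<bar> powr p) \<partial>lborel) < \<infinity>"
  shows "(\<integral>\<^sup>+h. ennreal (\<rho> h) * (\<integral>\<^sup>+t. ennreal (hat t) * shift_dist p g (- (t *\<^sub>R h)) \<partial>lborel) \<partial>lborel) < \<infinity>"
proof -
  define B where "B = ennreal (2 * 2 powr p) * (\<integral>\<^sup>+x. ennreal (\<bar>g x\<bar> powr p) \<partial>lborel)"
  have [measurable]: "\<rho> \<in> borel_measurable borel" using \<rho>(2) by auto
  have "(\<integral>\<^sup>+h. ennreal (\<rho> h) * (\<integral>\<^sup>+t. ennreal (hat t) * shift_dist p g (- (t *\<^sub>R h)) \<partial>lborel) \<partial>lborel)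
      \<le> (\<integral>\<^sup>+h. ennreal (\<rho> h) * (\<integral>\<^sup>+t. ennreal (hat t) * B \<partial>lborel) \<partial>lborel)"
    unfolding B_def by (intro nn_integral_mono mult_left_mono shift_dist_bound g p) auto
  also have "\<dots> = B"
    by (simp add: nn_integral_multc nn_integral_eq_1_if_integral_eq_1[OF hat_nonneg hat_integral] nn_integral_eq_1_if_integral_eq_1 \<rho>)
  also have "B < \<infinity>" unfolding B_def using fin by (auto simp: ennreal_mult_less_top)
  finally show ?thesis .
qed

text \<open>
  Near the origin \<open>shift_dist\<close> is small by continuity of translation; away from it, it is bounded and
  the density has little mass there. Since \<open>|t| \<le> 1\<close>, the point \<open>t h\<close> is no farther out than \<open>h\<close>.
\<close>

lemma concentrating_kernel_error_tendsto_0: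
  fixes g :: "'a::euclidean_space \<Rightarrow> real" and \<rho> :: "nat \<Rightarrow> 'a \<Rightarrow> real"
  assumes p: "1 \<le> p" and \<rho>: "\<And>n x. 0 \<le> \<rho> n x" "\<And>n. integrable lborel (\<rho> n)" "\<And>n. (LINT x|lborel. \<rho> n x) = 1"
    and conc: "\<And>\<gamma>. 0 < \<gamma> \<Longrightarrow> (\<lambda>n. LINT x:{x. \<gamma> < norm x}|lborel. \<rho> n x) \<longlonglongrightarrow> 0"
    and g [measurable]: "g \<in> borel_measurable borel"
    and fin: "(\<integral>\<^sup>+x. ennreal (\<bar>g x\<bar> powr p) \<partial>lborel) < \<infinity>"
  shows "(\<lambda>n. \<integral>\<^sup>+h. ennreal (\<rho> n h) * (\<integral>\<^sup>+t. ennreal (hat t) * shift_dist p g (- (t *\<^sub>R h)) \<partial>lborel) \<partial>lborel) \<longlonglongrightarrow> 0"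
    (is "?E \<longlonglongrightarrow> 0")
proof (rule tendsto_0_if_Limsup_eq_0_ennreal)
  have [measurable]: "\<rho> n \<in> borel_measurable borel" for n using \<rho>(2)[of n] by auto
  have [measurable]: "shift_dist p g \<in> borel_measurable borel"
    by (rule measurable_shift_dist) measurable
  define B where "B = ennreal (2 * 2 powr p) * (\<integral>\<^sup>+x. ennreal (\<bar>g x\<bar> powr p) \<partial>lborel)"
  have B: "B < \<infinity>" unfolding B_def using fin by (auto simp: ennreal_mult_less_top)
  have "Limsup sequentially ?E \<le> 0 + ennreal e" if "0 < e" for e
  proof -
    have "\<forall>\<^sub>F y in at 0. shift_dist p g y < ennreal e"
      using shift_continuous_Lp[OF g fin] p that unfolding shift_continuous_def
      by (intro order_tendstoD) auto
    then obtain d where d: "0 < d" "\<And>y. y \<noteq> 0 \<Longrightarrow> norm y < d \<Longrightarrow> shift_dist p g y < ennreal e"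
      unfolding eventually_at by auto
    have small: "shift_dist p g y \<le> ennreal e" if "norm y < d" for y
      using d(2)[of y] that by (cases "y = 0") (auto simp: shift_dist_def less_imp_le)
    let ?S = "{x :: 'a. d / 2 < norm x}"
    have S [measurable]: "?S \<in> sets borel" by measurable
    have pt: "ennreal (hat t) * shift_dist p g (- (t *\<^sub>R h)) \<le> ennreal (hat t) * (ennreal e + B * indicator ?S h)" for t h
    proof (cases "\<bar>t\<bar> \<le> 1")
      case True
      have "shift_dist p g (- (t *\<^sub>R h)) \<le> ennreal e + B * indicator ?S h"
      proof (cases "h \<in> ?S")
        case True
        then show ?thesis using shift_dist_bound[OF g, of p "- (t *\<^sub>R h)"] p by (simp add: B_def add_increasing)
      next
        case False
        have "norm (t *\<^sub>R h) \<le> norm h" using True by (simp add: mult_left_le_one_le)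
        then show ?thesis using small[of "- (t *\<^sub>R h)"] False d(1) by simp
      qed
      then show ?thesis by (intro mult_left_mono) auto
    qed (simp add: hat_eq_0)
    have bound: "?E n \<le> ennreal e + B * ennreal (LINT x:?S|lborel. \<rho> n x)" for n
    proof -
      have "?E n \<le> (\<integral>\<^sup>+h. ennreal (\<rho> n h) * (\<integral>\<^sup>+t. ennreal (hat t) * (ennreal e + B * indicator ?S h) \<partial>lborel) \<partial>lborel)"
        by (intro nn_integral_mono mult_left_mono pt) auto
      also have "\<dots> = (\<integral>\<^sup>+h. ennreal (\<rho> n h) * (ennreal e + B * indicator ?S h) \<partial>lborel)"
        by (simp add: nn_integral_multc nn_integral_eq_1_if_integral_eq_1[OF hat_nonneg hat_integral])
      also have "\<dots> = (\<integral>\<^sup>+h. ennreal e * ennreal (\<rho> n h) + B * ennreal (indicator ?S h * \<rho> n h) \<partial>lborel)"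
        by (intro nn_integral_cong) (auto simp: indicator_def distrib_left mult.commute)
      also have "\<dots> = ennreal e * (\<integral>\<^sup>+h. ennreal (\<rho> n h) \<partial>lborel) + B * (\<integral>\<^sup>+h. ennreal (indicator ?S h * \<rho> n h) \<partial>lborel)"
        by (subst nn_integral_add) (auto simp: nn_integral_cmult)
      also have "(\<integral>\<^sup>+h. ennreal (\<rho> n h) \<partial>lborel) = 1"
        by (intro nn_integral_eq_1_if_integral_eq_1 \<rho>)
      also have "(\<integral>\<^sup>+h. ennreal (indicator ?S h * \<rho> n h) \<partial>lborel) = ennreal (LINT x:?S|lborel. \<rho> n x)"
        unfolding set_lebesgue_integral_def real_scaleR_def
      proof (rule nn_integral_eq_integral)
        show "integrable lborel (\<lambda>x. indicator ?S x * \<rho> n x)"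
          using integrable_mult_indicator[of ?S lborel "\<rho> n"] \<rho>(2)[of n] by simp
      qed (auto simp: \<rho>)
      finally show ?thesis by simp
    qed
    have "(\<lambda>n. ennreal e + B * ennreal (LINT x:?S|lborel. \<rho> n x)) \<longlonglongrightarrow> ennreal e + B * ennreal 0"
      using conc[of "d / 2"] d(1) B by (intro tendsto_add tendsto_const ennreal_tendsto_cmult tendsto_ennrealI) auto
    then have "Limsup sequentially (\<lambda>n. ennreal e + B * ennreal (LINT x:?S|lborel. \<rho> n x)) = ennreal e"
      by (subst lim_imp_Limsup) auto
    moreover have "Limsup sequentially ?E \<le> Limsup sequentially (\<lambda>n. ennreal e + B * ennreal (LINT x:?S|lborel. \<rho> n x))"
      by (rule Limsup_mono, rule always_eventually, rule allI, rule bound)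
    ultimately show ?thesis by simp
  qed
  then have "Limsup sequentially ?E \<le> 0"
    by (rule ennreal_le_epsilon)
  then show "Limsup sequentially ?E = 0" by simp
qed

section \<open>Rotation invariance and fourth moments\<close>

text \<open>
  Uniqueness of Haar measure for the two translation invariant measures \<open>\<mu>\<close> (the image under \<open>T\<close>)
  and \<open>\<lambda>\<close> (Lebesgue measure): for a set \<open>A\<close> and the unit ball \<open>B\<close>, substituting \<open>x + y\<close> for \<open>x\<close> and then \<open>y - x\<close> for
  \<open>y\<close> turns \<open>\<mu>(A) \<lambda>(B)\<close> into \<open>\<lambda>(A) \<mu>(B)\<close>, and \<open>\<mu>(B) = \<lambda>(B)\<close> because \<open>T\<close> preserves balls.
\<close>

lemma lborel_distr_orthogonal:
  fixes T :: "'a::euclidean_space \<Rightarrow> 'a"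
  assumes T: "orthogonal_transformation T"
  shows "distr lborel borel T = lborel"
proof (rule measure_eqI)
  have lin: "linear T" by (rule orthogonal_transformation_linear[OF T])
  have T_meas [measurable]: "T \<in> borel_measurable borel"
    by (intro borel_measurable_continuous_onI linear_continuous_on linear_conv_bounded_linear[THEN iffD1] lin)
  fix A :: "'a set"
  assume "A \<in> sets (distr lborel borel T)"
  then have A [measurable]: "A \<in> sets borel" by simp
  let ?B = "ball (0 :: 'a) 1"
  have B [measurable]: "?B \<in> sets borel" by simp
  let ?f = "indicator A :: 'a \<Rightarrow> ennreal" and ?g = "indicator ?B :: 'a \<Rightarrow> ennreal"
  have f_meas [measurable]: "?f \<in> borel_measurable borel" and g_meas [measurable]: "?g \<in> borel_measurable borel"
    by (intro borel_measurable_indicator A B)+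
  have fg1: "(\<lambda>(x, y). ?f (T x) * ?g y) \<in> borel_measurable (lborel \<Otimes>\<^sub>M lborel)"
    and fg2: "(\<lambda>(x, y). ?f (T x + y) * ?g y) \<in> borel_measurable (lborel \<Otimes>\<^sub>M lborel)"
    and fg3: "(\<lambda>(x, y). ?f y * ?g (y - T x)) \<in> borel_measurable (lborel \<Otimes>\<^sub>M lborel)"
    by measurable
  have ball: "?g (y - T x) = indicator (ball (inv T y) 1) x" for x y
  proof -
    have "norm (y - T x) = norm (inv T y - x)"
      using orthogonal_transformation_norm[OF T, of "inv T y - x"] orthogonal_transformation_surj[OF T]
      by (simp add: linear_diff[OF lin] surj_f_inv_f)
    then show ?thesis by (simp add: indicator_def dist_norm norm_minus_commute)
  qed
  have "emeasure (distr lborel borel T) A = (\<integral>\<^sup>+x. ?f x \<partial>distr lborel borel T)"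
    by simp
  also have "\<dots> = (\<integral>\<^sup>+x. ?f (T x) \<partial>lborel)"
    by (rule nn_integral_distr) measurable
  finally have distr_A: "emeasure (distr lborel borel T) A = (\<integral>\<^sup>+x. ?f (T x) \<partial>lborel)" .
  have "emeasure lborel ?B * emeasure (distr lborel borel T) A = (\<integral>\<^sup>+y. ?g y * (\<integral>\<^sup>+x. ?f (T x) \<partial>lborel) \<partial>lborel)"
    by (subst nn_integral_multc) (simp_all add: distr_A)
  also have "\<dots> = (\<integral>\<^sup>+y. \<integral>\<^sup>+x. ?f (T x + y) * ?g y \<partial>lborel \<partial>lborel)"
  proof (rule nn_integral_cong)
    fix y
    have "(\<integral>\<^sup>+x. ?f (T x) \<partial>lborel) = (\<integral>\<^sup>+x. ?f (T (x + inv T y)) \<partial>lborel)"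
      by (rule nn_integral_lborel_translate[symmetric]) measurable
    also have "\<dots> = (\<integral>\<^sup>+x. ?f (T x + y) \<partial>lborel)"
      using orthogonal_transformation_surj[OF T] by (simp add: linear_add[OF lin] surj_f_inv_f)
    finally show "?g y * (\<integral>\<^sup>+x. ?f (T x) \<partial>lborel) = (\<integral>\<^sup>+x. ?f (T x + y) * ?g y \<partial>lborel)"
      by (subst nn_integral_multc) (simp_all add: mult.commute)
  qed
  also have "\<dots> = (\<integral>\<^sup>+x. \<integral>\<^sup>+y. ?f (T x + y) * ?g y \<partial>lborel \<partial>lborel)"
    by (rule lborel_pair.Fubini'[OF fg2])
  also have "\<dots> = (\<integral>\<^sup>+x. \<integral>\<^sup>+y. ?f y * ?g (y - T x) \<partial>lborel \<partial>lborel)"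
  proof (rule nn_integral_cong)
    fix x
    have "(\<lambda>y. ?f y * ?g (y - T x)) \<in> borel_measurable borel" by measurable
    from nn_integral_lborel_translate[OF this, of "T x"]
    show "(\<integral>\<^sup>+y. ?f (T x + y) * ?g y \<partial>lborel) = (\<integral>\<^sup>+y. ?f y * ?g (y - T x) \<partial>lborel)"
      by (simp add: add.commute)
  qed
  also have "\<dots> = (\<integral>\<^sup>+y. \<integral>\<^sup>+x. ?f y * ?g (y - T x) \<partial>lborel \<partial>lborel)"
    by (rule lborel_pair.Fubini'[OF fg3, symmetric])
  also have "\<dots> = (\<integral>\<^sup>+y. ?f y * emeasure lborel ?B \<partial>lborel)"
  proof (rule nn_integral_cong)
    fix y
    have "(\<integral>\<^sup>+x. ?g (y - T x) \<partial>lborel) = emeasure lborel (ball (inv T y) 1)"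
      unfolding ball by (rule nn_integral_indicator) simp
    also have "\<dots> = emeasure lborel ?B"
      by (simp add: emeasure_ball)
    finally show "(\<integral>\<^sup>+x. ?f y * ?g (y - T x) \<partial>lborel) = ?f y * emeasure lborel ?B"
      by (subst nn_integral_cmult) simp_all
  qed
  also have "\<dots> = emeasure lborel ?B * emeasure lborel A"
    by (subst nn_integral_multc) (simp_all add: mult.commute)
  finally have "emeasure lborel ?B * emeasure (distr lborel borel T) A = emeasure lborel ?B * emeasure lborel A" .
  moreover have "unit_ball_vol (real DIM('a)) > 0" by simp
  then have "emeasure lborel ?B \<noteq> 0"
    by (simp only: emeasure_ball) (simp add: less_imp_neq[symmetric])
  moreover have "emeasure lborel ?B \<noteq> top"
    using emeasure_lborel_ball_finite[of "0 :: 'a" 1] by (simp add: less_top)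
  ultimately show "emeasure (distr lborel borel T) A = emeasure lborel A"
    by (simp add: ennreal_mult_cancel_left)
qed simp

text \<open>
  Invariance holds only almost everywhere, with an exceptional set that depends on the
  rotation: this is what survives when a radial function is changed on a null set.
\<close>

locale radial_density =
  fixes \<rho> :: "real ^ 'n \<Rightarrow> real"
  assumes nonneg: "\<And>h. 0 \<le> \<rho> h"
    and integrable: "integrable lborel \<rho>"
    and integral_1: "(LINT h|lborel. \<rho> h) = 1"
    and rotation_invariant: "\<And>T. orthogonal_transformation T \<Longrightarrow> AE h in lborel. \<rho> (T h) = \<rho> h"
begin

lemma measurable_density [measurable]: "\<rho> \<in> borel_measurable borel"
  using integrable by auto

text \<open>
  The mean of \<open>f\<close> over the random direction \<open>h/|h|\<close>, where \<open>h\<close> has density \<open>\<rho>\<close>.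
\<close>

definition expect :: "(real ^ 'n \<Rightarrow> real) \<Rightarrow> real" where
  "expect f = (LINT h|lborel. \<rho> h * f (sgn h))"

lemma measurable_sgn_vec: "(sgn :: real ^ 'n \<Rightarrow> real ^ 'n) \<in> borel_measurable borel"
  unfolding sgn_div_norm[abs_def] by measurable

lemma measurable_comp_sgn: "continuous_on UNIV f \<Longrightarrow> (\<lambda>h :: real ^ 'n. f (sgn h)) \<in> borel_measurable borel"
  for f :: "real ^ 'n \<Rightarrow> real"
  by (rule measurable_compose[OF measurable_sgn_vec borel_measurable_continuous_onI])

lemma norm_sgn_le_1: "norm (sgn h) \<le> 1" for h :: "real ^ 'n"
  by (simp add: norm_sgn)

lemma expect_integrable:
  assumes f: "continuous_on UNIV f"
  shows "integrable lborel (\<lambda>h. \<rho> h * f (sgn h))"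
proof -
  have [measurable]: "(\<lambda>h. f (sgn h)) \<in> borel_measurable borel"
    by (rule measurable_comp_sgn[OF f])
  have "compact (f ` cball 0 1)"
    by (intro compact_continuous_image continuous_on_subset[OF f] compact_cball) simp
  from compact_imp_bounded[OF this] obtain B where "\<forall>y\<in>f ` cball 0 1. norm y \<le> B"
    unfolding bounded_iff by blast
  then have B: "\<bar>f (sgn h)\<bar> \<le> B" for h
    using norm_sgn_le_1[of h] by simp
  show ?thesis
  proof (rule Bochner_Integration.integrable_bound[OF integrable_mult_right[OF integrable, of B]])
    show "AE h in lborel. norm (\<rho> h * f (sgn h)) \<le> norm (B * \<rho> h)"
    proof (rule AE_I2)
      fix h
      have "\<rho> h * \<bar>f (sgn h)\<bar> \<le> \<rho> h * B" by (intro mult_left_mono B nonneg)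
      moreover have "0 \<le> B" using B[of 0] by linarith
      ultimately show "norm (\<rho> h * f (sgn h)) \<le> norm (B * \<rho> h)"
        by (simp add: abs_mult nonneg mult.commute)
    qed
  qed measurable
qed

lemma expect_add: "continuous_on UNIV f \<Longrightarrow> continuous_on UNIV g \<Longrightarrow> expect (\<lambda>s. f s + g s) = expect f + expect g"
  using expect_integrable[of f] expect_integrable[of g] by (simp add: expect_def distrib_left)

lemma expect_diff: "continuous_on UNIV f \<Longrightarrow> continuous_on UNIV g \<Longrightarrow> expect (\<lambda>s. f s - g s) = expect f - expect g"
  using expect_integrable[of f] expect_integrable[of g] by (simp add: expect_def right_diff_distrib)

lemma expect_cmult: "expect (\<lambda>s. c * f s) = c * expect f"
  by (simp add: expect_def mult.left_commute[of _ c])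

lemma expect_sum: "(\<And>i. i \<in> I \<Longrightarrow> continuous_on UNIV (f i)) \<Longrightarrow> expect (\<lambda>s. \<Sum>i\<in>I. f i s) = (\<Sum>i\<in>I. expect (f i))"
  unfolding expect_def sum_distrib_left by (intro Bochner_Integration.integral_sum expect_integrable)

lemma expect_rotate:
  assumes T: "orthogonal_transformation T" and f: "continuous_on UNIV f"
  shows "expect (\<lambda>s. f (T s)) = expect f"
proof -
  have [measurable]: "(\<lambda>h. f (sgn h)) \<in> borel_measurable borel"
    by (rule measurable_comp_sgn[OF f])
  have lin: "linear T" by (rule orthogonal_transformation_linear[OF T])
  have T_cont: "continuous_on UNIV T"
    by (intro linear_continuous_on linear_conv_bounded_linear[THEN iffD1] lin)
  then have T_meas [measurable]: "T \<in> borel_measurable borel"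
    by (rule borel_measurable_continuous_onI)
  have T_sgn: "T (sgn h) = sgn (T h)" for h
    by (simp add: sgn_div_norm linear_scale[OF lin] orthogonal_transformation_norm[OF T])
  have "expect (\<lambda>s. f (T s)) = (LINT h|lborel. \<rho> h * f (sgn (T h)))"
    by (simp add: expect_def T_sgn)
  also have "\<dots> = (LINT h|lborel. \<rho> (T h) * f (sgn (T h)))"
    using rotation_invariant[OF T] by (intro integral_cong_AE) (measurable, auto)
  also have "\<dots> = (LINT h|distr lborel borel T. \<rho> h * f (sgn h))"
    by (rule integral_distr[symmetric]) measurable
  finally show ?thesis
    unfolding lborel_distr_orthogonal[OF T] expect_def .
qed

text \<open>
  Every vector can be rotated to a multiple of one fixed unit vector.
\<close>

lemma expect_quartic:
  obtains c where "\<And>v. expect (\<lambda>s. (v \<bullet> s) ^ 4) = c * norm v ^ 4"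
proof (rule that)
  let ?e = "axis undefined 1 :: real ^ 'n"
  fix v :: "real ^ 'n"
  have norms: "norm v = norm (norm v *\<^sub>R ?e)" by simp
  obtain T where T: "orthogonal_transformation T" and Tv: "T v = norm v *\<^sub>R ?e"
    by (rule orthogonal_transformation_exists[OF norms]) (rule that)
  have "v \<bullet> s = norm v * (?e \<bullet> T s)" for s
  proof -
    have "v \<bullet> s = T v \<bullet> T s"
      using T by (simp add: orthogonal_transformation_def)
    then show ?thesis by (simp add: Tv)
  qed
  then have "expect (\<lambda>s. (v \<bullet> s) ^ 4) = expect (\<lambda>s. norm v ^ 4 * (?e \<bullet> T s) ^ 4)"
    by (simp add: power_mult_distrib)
  also have "\<dots> = norm v ^ 4 * expect (\<lambda>s. (?e \<bullet> s) ^ 4)"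
    using expect_rotate[OF T, of "\<lambda>s. (?e \<bullet> s) ^ 4"]
    by (simp add: expect_cmult continuous_intros)
  finally show "expect (\<lambda>s. (v \<bullet> s) ^ 4) = expect (\<lambda>s. (?e \<bullet> s) ^ 4) * norm v ^ 4"
    by (simp add: mult.commute)
qed

text \<open>
  A symmetric quadrilinear form is determined by its values on the diagonal; the polarisation is
  carried out in three steps, from \<open>v^4\<close> to \<open>v^2 w^2\<close>, to \<open>v v' w^2\<close> and to \<open>v v' w w'\<close>.
\<close>

lemma expect_quadrilinear:
  obtains c where "\<And>v v' w w'. expect (\<lambda>s. (v \<bullet> s) * (v' \<bullet> s) * ((w \<bullet> s) * (w' \<bullet> s))) =
    c * ((v \<bullet> v') * (w \<bullet> w') + (v \<bullet> w) * (v' \<bullet> w') + (v \<bullet> w') * (v' \<bullet> w))"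
proof -
  obtain c where c: "\<And>v. expect (\<lambda>s. (v \<bullet> s) ^ 4) = c * norm v ^ 4"
    by (rule expect_quartic) blast
  have c': "expect (\<lambda>s. (v \<bullet> s) ^ 4) = c * (v \<bullet> v)\<^sup>2" for v
    by (simp add: c power2_norm_eq_inner[symmetric] flip: power_mult)
  have S: "expect (\<lambda>s. (v \<bullet> s)\<^sup>2 * (w \<bullet> s)\<^sup>2) = c / 3 * ((v \<bullet> v) * (w \<bullet> w) + 2 * (v \<bullet> w)\<^sup>2)" for v w
  proof -
    have "(\<lambda>s. (v \<bullet> s)\<^sup>2 * (w \<bullet> s)\<^sup>2) =
        (\<lambda>s. (1 / 12) * ((((v + w) \<bullet> s) ^ 4 + ((v - w) \<bullet> s) ^ 4) - (2 * (v \<bullet> s) ^ 4 + 2 * (w \<bullet> s) ^ 4)))"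
      by (rule ext) (simp add: inner_add_left inner_diff_left power2_eq_square power4_eq_xxxx, algebra)
    then have "expect (\<lambda>s. (v \<bullet> s)\<^sup>2 * (w \<bullet> s)\<^sup>2) =
        (1 / 12) * ((c * ((v + w) \<bullet> (v + w))\<^sup>2 + c * ((v - w) \<bullet> (v - w))\<^sup>2) - (2 * (c * (v \<bullet> v)\<^sup>2) + 2 * (c * (w \<bullet> w)\<^sup>2)))"
      by (simp only: expect_cmult expect_add expect_diff c' continuous_intros)
    also have "\<dots> = c / 3 * ((v \<bullet> v) * (w \<bullet> w) + 2 * (v \<bullet> w)\<^sup>2)"
      by (simp add: inner_add_left inner_diff_left inner_add_right inner_diff_right inner_commute[of w v]
          power2_eq_square field_simps)
    finally show ?thesis .
  qed
  have B: "expect (\<lambda>s. (v \<bullet> s) * (v' \<bullet> s) * (w \<bullet> s)\<^sup>2) = c / 3 * ((v \<bullet> v') * (w \<bullet> w) + 2 * (v \<bullet> w) * (v' \<bullet> w))" for v v' w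
  proof -
    have "(\<lambda>s. (v \<bullet> s) * (v' \<bullet> s) * (w \<bullet> s)\<^sup>2) =
        (\<lambda>s. (1 / 4) * (((v + v') \<bullet> s)\<^sup>2 * (w \<bullet> s)\<^sup>2 - ((v - v') \<bullet> s)\<^sup>2 * (w \<bullet> s)\<^sup>2))"
      by (rule ext) (simp add: inner_add_left inner_diff_left power2_eq_square, algebra)
    then have "expect (\<lambda>s. (v \<bullet> s) * (v' \<bullet> s) * (w \<bullet> s)\<^sup>2) =
        (1 / 4) * (c / 3 * (((v + v') \<bullet> (v + v')) * (w \<bullet> w) + 2 * ((v + v') \<bullet> w)\<^sup>2) -
          c / 3 * (((v - v') \<bullet> (v - v')) * (w \<bullet> w) + 2 * ((v - v') \<bullet> w)\<^sup>2))"
      by (simp only: expect_cmult expect_diff S continuous_intros)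
    also have "\<dots> = c / 3 * ((v \<bullet> v') * (w \<bullet> w) + 2 * (v \<bullet> w) * (v' \<bullet> w))"
      by (simp add: inner_add_left inner_diff_left inner_add_right inner_diff_right inner_commute[of v' v]
          power2_eq_square field_simps)
    finally show ?thesis .
  qed
  have Q: "expect (\<lambda>s. (v \<bullet> s) * (v' \<bullet> s) * ((w \<bullet> s) * (w' \<bullet> s))) =
    c / 3 * ((v \<bullet> v') * (w \<bullet> w') + (v \<bullet> w) * (v' \<bullet> w') + (v \<bullet> w') * (v' \<bullet> w))" for v v' w w'
  proof -
    have "(\<lambda>s. (v \<bullet> s) * (v' \<bullet> s) * ((w \<bullet> s) * (w' \<bullet> s))) =
        (\<lambda>s. (1 / 4) * ((v \<bullet> s) * (v' \<bullet> s) * ((w + w') \<bullet> s)\<^sup>2 - (v \<bullet> s) * (v' \<bullet> s) * ((w - w') \<bullet> s)\<^sup>2))"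
      by (rule ext) (simp add: inner_add_left inner_diff_left power2_eq_square, algebra)
    then have "expect (\<lambda>s. (v \<bullet> s) * (v' \<bullet> s) * ((w \<bullet> s) * (w' \<bullet> s))) =
        (1 / 4) * (c / 3 * ((v \<bullet> v') * ((w + w') \<bullet> (w + w')) + 2 * (v \<bullet> (w + w')) * (v' \<bullet> (w + w'))) -
          c / 3 * ((v \<bullet> v') * ((w - w') \<bullet> (w - w')) + 2 * (v \<bullet> (w - w')) * (v' \<bullet> (w - w'))))"
      by (simp only: expect_cmult expect_diff B continuous_intros)
    also have "\<dots> = c / 3 * ((v \<bullet> v') * (w \<bullet> w') + (v \<bullet> w) * (v' \<bullet> w') + (v \<bullet> w') * (v' \<bullet> w))"
      by (simp add: inner_add_left inner_diff_left inner_add_right inner_diff_right inner_commute[of w' w]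
          field_simps)
    finally show ?thesis .
  qed
  show ?thesis by (rule that) (rule Q)
qed

abbreviation \<delta> :: "'n \<Rightarrow> 'n \<Rightarrow> real" where
  "\<delta> i j \<equiv> (if i = j then 1 else 0)"

text \<open>
  The fourth moments are a multiple \<open>c\<close> of the sum of the three products of Kronecker symbols.
  Putting \<open>k = l\<close> and summing over \<open>k\<close> gives the second moments, since the direction has norm \<open>1\<close>; doing
  the same with these gives \<open>1 = c N (N + 2)\<close>.
\<close>

lemma expect_coordinates:
  defines "N \<equiv> real CARD('n)"
  shows "expect (\<lambda>s. s $ i * s $ j * (s $ k * s $ l)) = (\<delta> i j * \<delta> k l + \<delta> i k * \<delta> j l + \<delta> i l * \<delta> j k) / (N * (N + 2))"
    and "expect (\<lambda>s. s $ i * s $ j) = \<delta> i j / N"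
proof -
  obtain c where c: "\<And>v v' w w'. expect (\<lambda>s. (v \<bullet> s) * (v' \<bullet> s) * ((w \<bullet> s) * (w' \<bullet> s))) =
    c * ((v \<bullet> v') * (w \<bullet> w') + (v \<bullet> w) * (v' \<bullet> w') + (v \<bullet> w') * (v' \<bullet> w))"
    by (rule expect_quadrilinear) blast
  have axis_axis: "axis i 1 \<bullet> axis j (1 :: real) = \<delta> i j" for i j
    by (simp add: inner_axis_axis)
  have coord: "expect (\<lambda>s. s $ i * s $ j * (s $ k * s $ l)) = c * (\<delta> i j * \<delta> k l + \<delta> i k * \<delta> j l + \<delta> i l * \<delta> j k)" for i j k l
    using c[of "axis i 1" "axis j 1" "axis k 1" "axis l 1"]
    unfolding axis_axis by (simp only: inner_axis' inner_real_def mult_1)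
  have N: "0 < N" by (simp add: N_def)
  have sgn_sq: "AE h :: real ^ 'n in lborel. (\<Sum>k\<in>UNIV. sgn h $ k * sgn h $ k) = 1"
  proof -
    have "AE h in lborel. h \<noteq> (0 :: real ^ 'n)"
      by (rule AE_lborel_singleton)
    then show ?thesis
    proof eventually_elim
      case (elim h)
      have "(\<Sum>k\<in>UNIV. sgn h $ k * sgn h $ k) = (norm (sgn h))\<^sup>2"
        by (simp add: power2_norm_eq_inner inner_vec_def)
      then show ?case using elim by (simp add: norm_sgn)
    qed
  qed
  have contract: "expect f = (\<Sum>k\<in>UNIV. expect (\<lambda>s. f s * (s $ k * s $ k)))" if f: "continuous_on UNIV f" for f
  proof -
    have cont: "continuous_on UNIV (\<lambda>s. f s * (s $ k * s $ k))" for k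
      by (intro continuous_intros f)
    have sum_eq: "(\<lambda>s. \<Sum>k\<in>UNIV. f s * (s $ k * s $ k)) = (\<lambda>s. f s * (\<Sum>k\<in>UNIV. s $ k * s $ k))"
      by (simp add: sum_distrib_left)
    have cont': "continuous_on UNIV (\<lambda>s. f s * (\<Sum>k\<in>UNIV. s $ k * s $ k))"
      by (intro continuous_intros f)
    have "expect f = expect (\<lambda>s. f s * (\<Sum>k\<in>UNIV. s $ k * s $ k))"
      unfolding expect_def
    proof (rule integral_cong_AE)
      show "AE h in lborel. \<rho> h * f (sgn h) = \<rho> h * (f (sgn h) * (\<Sum>k\<in>UNIV. sgn h $ k * sgn h $ k))"
        using sgn_sq by eventually_elim simp
    qed (use expect_integrable[OF f] expect_integrable[OF cont'] in auto)
    also have "\<dots> = (\<Sum>k\<in>UNIV. expect (\<lambda>s. f s * (s $ k * s $ k)))"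
      using cont by (subst expect_sum[symmetric]) (simp_all only: sum_eq)
    finally show ?thesis .
  qed
  have two: "expect (\<lambda>s. s $ i * s $ j) = c * (N + 2) * \<delta> i j" for i j
  proof -
    have "expect (\<lambda>s. s $ i * s $ j) = (\<Sum>k\<in>UNIV. c * (\<delta> i j + \<delta> i k * \<delta> j k + \<delta> i k * \<delta> j k))"
      by (subst contract) (auto intro!: continuous_intros simp: coord)
    also have "\<dots> = (\<Sum>k\<in>UNIV. c * \<delta> i j * (1 + 2 * \<delta> i k))"
      by (intro sum.cong) auto
    also have "\<dots> = c * \<delta> i j * (N + 2)"
      unfolding sum_distrib_left[symmetric] sum.distrib by (simp add: N_def)
    finally show ?thesis by (simp add: algebra_simps)
  qed
  have "1 = expect (\<lambda>s. 1)" by (simp add: expect_def integral_1)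
  also have "\<dots> = (\<Sum>k\<in>UNIV. expect (\<lambda>s. s $ k * s $ k))"
    by (subst contract) (auto intro!: continuous_intros)
  also have "\<dots> = c * N * (N + 2)"
    by (simp add: two N_def)
  finally have "c * (N * (N + 2)) = 1" by (simp add: mult.assoc)
  then have c: "c = 1 / (N * (N + 2))" using N by (simp add: eq_divide_eq)
  show "expect (\<lambda>s. s $ i * s $ j * (s $ k * s $ l)) = (\<delta> i j * \<delta> k l + \<delta> i k * \<delta> j l + \<delta> i l * \<delta> j k) / (N * (N + 2))"
    unfolding coord c by simp
  show "expect (\<lambda>s. s $ i * s $ j) = \<delta> i j / N"
  proof -
    have "N \<noteq> 0" "N + 2 \<noteq> 0" using N by auto
    then have "1 / (N * (N + 2)) * (N + 2) = 1 / N" by (subst eq_divide_eq) (simp add: mult.commute)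
    then show ?thesis unfolding two c by simp
  qed
qed

end

section \<open>Borel versions, norms and components\<close>

lemma abs_sum_powr_le:
  fixes a :: "'q \<Rightarrow> real"
  assumes I: "finite I" "I \<noteq> {}" and p: "0 \<le> p"
  shows "\<bar>\<Sum>i\<in>I. \<bar>a i\<bar>\<bar> powr p \<le> real (card I) powr p * (\<Sum>i\<in>I. \<bar>a i\<bar> powr p)"
proof -
  define M where "M = Max ((\<lambda>i. \<bar>a i\<bar>) ` I)"
  have M: "M \<in> (\<lambda>i. \<bar>a i\<bar>) ` I" unfolding M_def using I by (intro Max_in) auto
  then obtain k where k: "k \<in> I" "M = \<bar>a k\<bar>" by auto
  have le: "\<bar>a i\<bar> \<le> M" if "i \<in> I" for i unfolding M_def using I that by auto
  have "(\<Sum>i\<in>I. \<bar>a i\<bar>) \<le> real (card I) * M"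
    by (rule sum_bounded_above) (rule le)
  then have "\<bar>\<Sum>i\<in>I. \<bar>a i\<bar>\<bar> powr p \<le> (real (card I) * M) powr p"
    using p by (intro powr_mono2) (auto simp: sum_nonneg)
  also have "\<dots> = real (card I) powr p * \<bar>a k\<bar> powr p"
    using k by (simp add: powr_mult)
  also have "\<dots> \<le> real (card I) powr p * (\<Sum>i\<in>I. \<bar>a i\<bar> powr p)"
    using I k by (intro mult_left_mono member_le_sum) auto
  finally show ?thesis .
qed

lemma matrix_norm_le_sum: "norm A \<le> (\<Sum>k\<in>UNIV. \<Sum>l\<in>UNIV. \<bar>A $ k $ l\<bar>)" for A :: "real ^ 'n ^ 'm"
proof -
  have "norm A \<le> (\<Sum>k\<in>UNIV. norm (A $ k))"
    unfolding norm_vec_def[of A] by (rule L2_set_le_sum) simp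
  also have "\<dots> \<le> (\<Sum>k\<in>UNIV. \<Sum>l\<in>UNIV. \<bar>A $ k $ l\<bar>)"
    by (intro sum_mono norm_le_l1_cart)
  finally show ?thesis .
qed

lemma matrix_expansion: "A = (\<Sum>k\<in>UNIV. \<Sum>l\<in>UNIV. A $ k $ l *\<^sub>R axis k (axis l 1))" for A :: "real ^ 'n ^ 'm"
proof -
  have "(\<Sum>k\<in>UNIV. \<Sum>l\<in>UNIV. A $ k $ l *\<^sub>R axis k (axis l 1 :: real ^ 'n)) $ i $ j = A $ i $ j" for i j
    by (simp add: axis_def if_distrib[of "\<lambda>x. x $ _"] if_distrib[of "\<lambda>x. _ * x"] sum.If_cases cong: if_cong)
  then show ?thesis by (simp add: vec_eq_iff)
qed

lemma measurable_matrix: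
  fixes F :: "'a \<Rightarrow> real ^ 'n ^ 'm"
  assumes [measurable]: "\<And>k l. (\<lambda>x. F x $ k $ l) \<in> borel_measurable M"
  shows "F \<in> borel_measurable M"
proof -
  have "(\<lambda>x. \<Sum>k\<in>UNIV. \<Sum>l\<in>UNIV. F x $ k $ l *\<^sub>R (axis k (axis l 1) :: real ^ 'n ^ 'm)) \<in> borel_measurable M"
    by (intro borel_measurable_sum borel_measurable_scaleR borel_measurable_const assms)
  then show ?thesis by (simp flip: matrix_expansion)
qed

lemma integrable_matrix:
  fixes F :: "'a \<Rightarrow> real ^ 'n ^ 'm"
  assumes "\<And>k l. integrable M (\<lambda>x. F x $ k $ l)"
  shows "integrable M F" "(LINT x|M. F x) $ k $ l = (LINT x|M. F x $ k $ l)"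
proof -
  have "integrable M (\<lambda>x. \<Sum>k\<in>UNIV. \<Sum>l\<in>UNIV. F x $ k $ l *\<^sub>R (axis k (axis l 1) :: real ^ 'n ^ 'm))"
    by (intro Bochner_Integration.integrable_sum integrable_scaleR_left assms)
  then show F: "integrable M F" by (simp flip: matrix_expansion)
  have "bounded_linear (\<lambda>A :: real ^ 'n ^ 'm. A $ k $ l)"
    by (rule bounded_linear_compose[OF bounded_linear_vec_nth bounded_linear_vec_nth])
  from integral_bounded_linear[OF this F] show "(LINT x|M. F x) $ k $ l = (LINT x|M. F x $ k $ l)" by simp
qed

lemma lebesgue_eq_borel:
  fixes f g :: "'a::euclidean_space \<Rightarrow> 'b::euclidean_space"
  assumes g: "g \<in> borel_measurable borel" and eq: "AE x in lborel. f x = g x"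
  shows "f \<in> borel_measurable lebesgue"
    and "integrable lebesgue f \<longleftrightarrow> integrable lborel g"
    and "(LINT x|lebesgue. f x) = (LINT x|lborel. g x)"
proof -
  have g': "g \<in> borel_measurable lborel" "g \<in> borel_measurable lebesgue"
    using g by (auto intro: measurable_completion)
  have eq': "AE x in lebesgue. f x = g x"
    using eq by (rule AE_completion)
  then have "AE x in lebesgue. g x = f x" by eventually_elim simp
  from borel_measurable_AE[OF g'(2) this] show f: "f \<in> borel_measurable lebesgue" .
  show "integrable lebesgue f \<longleftrightarrow> integrable lborel g"
    using integrable_cong_AE[OF f g'(2) eq'] integrable_completion[OF g'(1)] by simp
  show "(LINT x|lebesgue. f x) = (LINT x|lborel. g x)"
    using integral_cong_AE[OF f g'(2) eq'] integral_completion[OF g'(1)] by simp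
qed

definition borel_version :: "('a::euclidean_space \<Rightarrow> real) \<Rightarrow> ('a \<Rightarrow> real) \<Rightarrow> bool" where
  "borel_version f g \<longleftrightarrow> g \<in> borel_measurable borel \<and> (AE x in lborel. f x = g x)"

lemma borel_version_exists:
  assumes "f \<in> borel_measurable lebesgue"
  obtains g where "borel_version f g"
  using completion_ex_borel_measurable_real[OF assms] by (auto simp: borel_version_def)

text \<open>
  Measurability is not part of local integrability, but follows since the function is the limit
  of its restrictions to balls.
\<close>

lemma locally_integrable_measurable:
  assumes "locally_integrable f"
  shows "f \<in> borel_measurable lebesgue"
proof (rule borel_measurable_LIMSEQ_real)
  have "set_integrable lebesgue (cball 0 (real n)) f" for n
    using assms by (simp add: locally_integrable_def)
  then show "(\<lambda>x. indicator (cball 0 (real n)) x *\<^sub>R f x) \<in> borel_measurable lebesgue" for n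
    unfolding set_integrable_def by (rule borel_measurable_integrable)
  show "(\<lambda>n. indicator (cball 0 (real n)) x *\<^sub>R f x) \<longlonglongrightarrow> f x" for x
  proof (rule tendsto_eventually)
    obtain m where "norm x \<le> real m" using real_arch_simple by blast
    then have "indicator (cball 0 (real n)) x *\<^sub>R f x = f x" if "m \<le> n" for n
      using that by (simp add: indicator_def)
    then show "\<forall>\<^sub>F n in sequentially. indicator (cball 0 (real n)) x *\<^sub>R f x = f x"
      unfolding eventually_sequentially by blast
  qed
qed

lemma locally_integrable_borel_version:
  assumes f: "locally_integrable f" and g: "borel_version f g"
  shows "set_integrable lborel (cball 0 R) g"
proof -
  have g_meas: "g \<in> borel_measurable borel" and eq: "AE x in lborel. f x = g x"
    using g by (auto simp: borel_version_def)
  have "set_integrable lebesgue (cball 0 R) f"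
    using f by (simp add: locally_integrable_def)
  moreover have eq': "AE x in lborel. indicator (cball 0 R) x *\<^sub>R f x = indicator (cball 0 R) x *\<^sub>R g x"
    using eq by eventually_elim simp
  have "(\<lambda>x. indicator (cball 0 R) x *\<^sub>R g x) \<in> borel_measurable borel"
    by (intro borel_measurable_scaleR borel_measurable_indicator g_meas) simp
  from lebesgue_eq_borel(2)[OF this eq'] calculation show ?thesis
    unfolding set_integrable_def by blast
qed

lemma Lp_fun_borel_version:
  fixes f g :: "'a::euclidean_space \<Rightarrow> real"
  assumes f: "Lp_fun p f" and g: "borel_version f g"
  shows "(\<integral>\<^sup>+x. ennreal (\<bar>g x\<bar> powr p) \<partial>lborel) < \<infinity>"
proof -
  have [measurable]: "g \<in> borel_measurable borel" and eq: "AE x in lborel. f x = g x"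
    using g by (auto simp: borel_version_def)
  have "AE x in lborel. norm (f x) powr p = \<bar>g x\<bar> powr p"
    using eq by eventually_elim simp
  then have "integrable lborel (\<lambda>x. \<bar>g x\<bar> powr p)"
    using f lebesgue_eq_borel(2)[of "\<lambda>x. \<bar>g x\<bar> powr p" "\<lambda>x. norm (f x) powr p"]
    by (simp add: Lp_fun_def)
  then show ?thesis
    by (subst nn_integral_eq_integral) auto
qed

lemma weak_deriv_bump:
  assumes weak: "weak_deriv is u v" and u: "borel_version u u'" and v: "borel_version v v'"
    and \<phi>: "\<phi> \<in> bump_algebra" and R: "\<And>x. R < norm x \<Longrightarrow> \<phi> x = 0"
  shows "(LINT x|lborel. u' x * partial_derivs is \<phi> x) = (- 1) ^ length is * (LINT x|lborel. v' x * \<phi> x)"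
proof -
  have bump_meas: "\<psi> \<in> borel_measurable borel" if "\<psi> \<in> bump_algebra" for \<psi> :: "real ^ 'a \<Rightarrow> real"
    by (intro borel_measurable_continuous_onI bump_algebra_continuous that)
  have product: "(LINT x|lebesgue. f x * \<psi> x) = (LINT x|lborel. g x * \<psi> x)"
    if "borel_version f g" "\<psi> \<in> bump_algebra" for f g \<psi> :: "real ^ 'a \<Rightarrow> real"
    by (rule lebesgue_eq_borel(3)) (use that bump_meas[OF that(2)] in \<open>auto simp: borel_version_def\<close>)
  have "compact (closure {x. \<phi> x \<noteq> 0})"
    by (rule compact_support_bounded[where R = R]) (use R not_less in blast)
  then have "test_fun \<phi>"
    by (simp add: test_fun_def bump_algebra_smooth[OF \<phi>])
  then have "(LINT x|lebesgue. u x * partial_derivs is \<phi> x) = (- 1) ^ length is * (LINT x|lebesgue. v x * \<phi> x)"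
    using weak by (simp add: weak_deriv_def)
  then show ?thesis
    by (simp add: product[OF u bump_algebra_partial_derivs[OF \<phi>]] product[OF v \<phi>])
qed

text \<open>
  The fundamental lemma for the difference; weak derivatives are thereby unique.
\<close>

lemma equal_against_bumps_imp_equal:
  fixes f g :: "real ^ 'n \<Rightarrow> real"
  assumes [measurable]: "f \<in> borel_measurable borel" "g \<in> borel_measurable borel"
    and f: "\<And>R. set_integrable lborel (cball 0 R) f" and g: "\<And>R. set_integrable lborel (cball 0 R) g"
    and eq: "\<And>\<phi> R. \<phi> \<in> bump_algebra \<Longrightarrow> (\<And>x. R < norm x \<Longrightarrow> \<phi> x = 0) \<Longrightarrow>
      (LINT x|lborel. f x * \<phi> x) = (LINT x|lborel. g x * \<phi> x)"
  shows "AE x in lborel. f x = g x"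
proof -
  have "AE x in lborel. f x - g x = 0"
  proof (rule zero_against_box_bumps_imp_zero)
    fix a b :: "real ^ 'n" and m
    obtain R where R: "\<And>x. x \<in> box a b \<Longrightarrow> norm x \<le> R"
      using bounded_box[of a b] by (auto simp: bounded_iff)
    have bump: "box_bump m a b \<in> borel_measurable borel" "\<bar>box_bump m a b x\<bar> \<le> 1"
        "R < norm x \<Longrightarrow> box_bump m a b x = 0" for x
      using box_bump_bounds[of m a b x] R[of x] box_bump_eq_0[of x a b m]
      by (auto intro: borel_measurable_continuous_onI bump_algebra_continuous box_bump_in_bump_algebra simp: not_less[symmetric])
    show "(LINT x|lborel. (f x - g x) * box_bump m a b x) = 0"
      using locally_integrable_mult[OF assms(1) bump(1) f bump(2,3)]
        locally_integrable_mult[OF assms(2) bump(1) g bump(2,3)]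
        eq[OF box_bump_in_bump_algebra bump(3)]
      by (simp add: left_diff_distrib)
    have "set_integrable lborel (box a b) (\<lambda>x. f x)" "set_integrable lborel (box a b) (\<lambda>x. g x)"
      by (rule set_integrable_subset[OF f[of R]], use R in auto)
        (rule set_integrable_subset[OF g[of R]], use R in auto)
    then show "set_integrable lborel (box a b) (\<lambda>x. f x - g x)"
      by (rule set_integral_diff)
  qed
  then show ?thesis by eventually_elim simp
qed

lemma AE_translate_reflect:
  fixes P :: "'a::euclidean_space \<Rightarrow> bool"
  assumes P: "AE z in lborel. P z"
  shows "AE h in lborel. P (x + h)" "AE h in lborel. P (x - h)"
proof -
  have plus: "AE h in lborel. P (x + h)"
  proof (rule AE_distrD[of "(+) x" lborel borel])
    show "AE z in distr lborel borel ((+) x). P z"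
      unfolding lborel_distr_plus by (rule P)
  qed simp
  have "orthogonal_transformation (uminus :: 'a \<Rightarrow> 'a)"
    by (simp add: orthogonal_transformation_def linear_uminus)
  then have reflect: "distr lborel borel uminus = (lborel :: 'a measure)"
    by (rule lborel_distr_orthogonal)
  have "AE h in lborel. P (x + (- h))"
  proof (rule AE_distrD[of uminus lborel borel "\<lambda>h. P (x + h)"])
    show "AE h in distr lborel borel uminus. P (x + h)"
      unfolding reflect by (rule plus)
  qed simp
  then show "AE h in lborel. P (x - h)" by simp
  show "AE h in lborel. P (x + h)" by (rule plus)
qed

section \<open>The kernel of the non-local Hessian\<close>

text \<open>
  The kernel that remains of entry \<open>kl\<close> when the second difference is replaced by \<open>h_i h_j\<close>; it is
  homogeneous of degree \<open>0\<close> and vanishes at \<open>0\<close>, where \<open>sgn\<close> is \<open>0\<close>.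
\<close>

definition hessian_kernel :: "'n \<Rightarrow> 'n \<Rightarrow> 'n \<Rightarrow> 'n \<Rightarrow> real ^ 'n \<Rightarrow> real" where
  "hessian_kernel i j k l h =
     sgn h $ i * sgn h $ j * (sgn h $ k * sgn h $ l - (if k = l then 1 / (real CARD('n) + 2) else 0))"

lemma abs_sgn_component_le: "\<bar>sgn h $ i\<bar> \<le> 1" for h :: "real ^ 'n"
  using component_le_norm_cart[of "sgn h" i] by (simp add: norm_sgn split: if_splits)

lemma abs_hessian_kernel_le: "\<bar>hessian_kernel i j k l h\<bar> \<le> 1" for h :: "real ^ 'n"
proof -
  let ?s = "sgn h" and ?c = "1 / (real CARD('n) + 2)"
  have prod: "\<bar>?s $ a * ?s $ b\<bar> \<le> 1" for a b
    using abs_sgn_component_le[of h] by (simp add: abs_mult mult_le_one)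
  have c: "0 \<le> ?c" "?c \<le> 1" by auto
  have "0 \<le> ?s $ k * ?s $ k" by simp
  then have "\<bar>?s $ k * ?s $ l - (if k = l then ?c else 0)\<bar> \<le> 1"
  proof (cases "k = l")
    case True
    have "\<bar>x - ?c\<bar> \<le> 1" if "0 \<le> x" "\<bar>x\<bar> \<le> 1" for x :: real
      using that c by linarith
    then show ?thesis using True prod[of k l] by simp
  next
    case False
    then show ?thesis using prod[of k l] by simp
  qed
  then have "\<bar>?s $ i * ?s $ j\<bar> * \<bar>?s $ k * ?s $ l - (if k = l then ?c else 0)\<bar> \<le> 1"
    using prod[of i j] by (intro mult_le_one) auto
  then show ?thesis by (simp only: hessian_kernel_def abs_mult)
qed

lemma measurable_hessian_kernel: "hessian_kernel i j k l \<in> borel_measurable borel"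
proof -
  have "(\<lambda>h :: real ^ 'a. sgn h) \<in> borel_measurable borel"
    unfolding sgn_div_norm[abs_def] by measurable
  then have [measurable]: "(\<lambda>h :: real ^ 'a. sgn h $ a) \<in> borel_measurable borel" for a
    by (rule measurable_compose) (intro borel_measurable_continuous_onI continuous_intros)
  show ?thesis
    unfolding hessian_kernel_def[abs_def] by measurable
qed

lemma nonlocal_hessian_integrand_kernel:
  fixes u :: "real ^ 'n \<Rightarrow> real"
  assumes "u (x + h) - 2 * u x + u (x - h) = (\<Sum>i\<in>UNIV. \<Sum>j\<in>UNIV. h $ i * h $ j * A i j)"
  shows "nonlocal_hessian_integrand \<rho> u x h $ k $ l =
    (\<Sum>i\<in>UNIV. \<Sum>j\<in>UNIV. \<rho> h * (hessian_kernel i j k l h * A i j))"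
proof (cases "h = 0")
  case True
  then show ?thesis by (simp add: nonlocal_hessian_integrand_def hessian_kernel_def)
next
  case False
  then have n: "norm h \<noteq> 0" by simp
  have sgn: "sgn h $ a * sgn h $ b = h $ a * h $ b / (norm h)\<^sup>2" for a b
    by (simp add: sgn_div_norm power2_eq_square divide_inverse)
  have comp: "((outer_product h h - ((norm h)\<^sup>2 / (real CARD('n) + 2)) *\<^sub>R mat 1) /\<^sub>R (norm h)\<^sup>2) $ k $ l =
      sgn h $ k * sgn h $ l - (if k = l then 1 / (real CARD('n) + 2) else 0)"
  proof -
    have "((outer_product h h - ((norm h)\<^sup>2 / (real CARD('n) + 2)) *\<^sub>R mat 1) /\<^sub>R (norm h)\<^sup>2) $ k $ l =
        (h $ k * h $ l - (norm h)\<^sup>2 * (if k = l then 1 / (real CARD('n) + 2) else 0)) / (norm h)\<^sup>2"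
      by (simp add: outer_product_def mat_def divide_inverse mult.commute)
    then show ?thesis
      unfolding sgn using n by (simp add: diff_divide_distrib)
  qed
  have "nonlocal_hessian_integrand \<rho> u x h $ k $ l =
      (\<Sum>i\<in>UNIV. \<Sum>j\<in>UNIV. h $ i * h $ j * A i j) / (norm h)\<^sup>2 * \<rho> h *
      (sgn h $ k * sgn h $ l - (if k = l then 1 / (real CARD('n) + 2) else 0))"
    unfolding nonlocal_hessian_integrand_def assms vector_scaleR_component real_scaleR_def comp[symmetric] ..
  also have "\<dots> = (\<Sum>i\<in>UNIV. \<Sum>j\<in>UNIV. \<rho> h * (hessian_kernel i j k l h * A i j))"
    unfolding hessian_kernel_def sgn[of _ _] sum_divide_distrib sum_distrib_right
    by (intro sum.cong refl) simp
  finally show ?thesis .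
qed

context radial_density
begin

text \<open>
  In the mean of the kernel the term \<open>\<delta>_kl/(N+2)\<close> cancels exactly the part \<open>\<delta>_ij \<delta>_kl\<close> of the fourth
  moment, which would contribute the trace of \<open>A\<close>.
\<close>

lemma hessian_kernel_contraction:
  fixes A :: "'n \<Rightarrow> 'n \<Rightarrow> real"
  defines "N \<equiv> real CARD('n)"
  shows "N * (N + 2) / 2 * (\<Sum>i\<in>UNIV. \<Sum>j\<in>UNIV. (LINT h|lborel. \<rho> h * hessian_kernel i j k l h) * A i j) =
    (A k l + A l k) / 2"
proof -
  have N: "0 < N" "N * (N + 2) \<noteq> 0" by (simp_all add: N_def)
  have kernel: "(LINT h|lborel. \<rho> h * hessian_kernel i j k l h) = (\<delta> i k * \<delta> j l + \<delta> i l * \<delta> j k) / (N * (N + 2))" for i j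
  proof -
    have "(LINT h|lborel. \<rho> h * hessian_kernel i j k l h) =
        expect (\<lambda>s. s $ i * s $ j * (s $ k * s $ l) - \<delta> k l / (N + 2) * (s $ i * s $ j))"
      unfolding expect_def hessian_kernel_def N_def by (simp add: algebra_simps)
    also have "\<dots> = (\<delta> i j * \<delta> k l + \<delta> i k * \<delta> j l + \<delta> i l * \<delta> j k) / (N * (N + 2)) - \<delta> k l / (N + 2) * (\<delta> i j / N)"
      by (simp only: expect_diff expect_cmult continuous_intros expect_coordinates N_def)
    also have "\<dots> = (\<delta> i k * \<delta> j l + \<delta> i l * \<delta> j k) / (N * (N + 2))"
      by (simp add: add_divide_distrib mult.commute)
    finally show ?thesis .
  qed
  have "(\<Sum>i\<in>UNIV. \<Sum>j\<in>UNIV. (LINT h|lborel. \<rho> h * hessian_kernel i j k l h) * A i j) =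
      (\<Sum>i\<in>UNIV. \<Sum>j\<in>UNIV. \<delta> i k * (\<delta> j l * A i j) + \<delta> i l * (\<delta> j k * A i j)) / (N * (N + 2))"
    unfolding kernel sum_divide_distrib by (intro sum.cong refl) (simp add: algebra_simps)
  also have "(\<Sum>i\<in>UNIV. \<Sum>j\<in>UNIV. \<delta> i k * (\<delta> j l * A i j) + \<delta> i l * (\<delta> j k * A i j)) = A k l + A l k"
  proof -
    have pick: "(\<Sum>i\<in>UNIV. \<delta> i a * f i) = f a" for a and f :: "'n \<Rightarrow> real"
      by (simp add: if_distrib[of "\<lambda>x. x * _"] cong: if_cong)
    show ?thesis
      by (simp only: sum.distrib sum_distrib_left[symmetric] pick)
  qed
  finally show ?thesis using N by simp
qed

end

text \<open>
  Convergence includes membership of all \<open>F n\<close> in \<open>L^p\<close>; it follows from a finite distance to \<open>f\<close>.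
\<close>

lemma Lp_tendsto_from_error_bound:
  fixes F :: "nat \<Rightarrow> 'a::euclidean_space \<Rightarrow> 'b::euclidean_space"
  assumes p: "0 < p" and F: "\<And>n. F n \<in> borel_measurable lebesgue" and f: "Lp_fun p f"
    and bound: "\<And>n. (\<integral>\<^sup>+x. ennreal (norm (F n x - f x) powr p) \<partial>lebesgue) \<le> e n"
    and fin: "\<And>n. e n < \<infinity>" and lim: "e \<longlonglongrightarrow> 0"
  shows "Lp_tendsto p F f"
proof -
  have f_meas: "f \<in> borel_measurable lebesgue" and f_int: "integrable lebesgue (\<lambda>x. norm (f x) powr p)"
    using f by (auto simp: Lp_fun_def)
  note [measurable] = F f_meas
  have diff_int: "integrable lebesgue (\<lambda>x. norm (F n x - f x) powr p)" for n
    using order.strict_trans1[OF bound fin] by (intro integrableI_nonneg) auto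
  have "integrable lebesgue (\<lambda>x. norm (F n x) powr p)" for n
  proof (rule Bochner_Integration.integrable_bound)
    show "integrable lebesgue (\<lambda>x. 2 powr p * (norm (F n x - f x) powr p + norm (f x) powr p))"
      by (intro integrable_mult_right Bochner_Integration.integrable_add diff_int f_int)
    show "AE x in lebesgue. norm (norm (F n x) powr p) \<le> norm (2 powr p * (norm (F n x - f x) powr p + norm (f x) powr p))"
    proof (rule AE_I2)
      fix x
      have "norm (F n x) \<le> \<bar>norm (F n x - f x) + norm (f x)\<bar>"
        using norm_triangle_ineq[of "F n x - f x" "f x"] by simp
      then have "norm (F n x) powr p \<le> \<bar>norm (F n x - f x) + norm (f x)\<bar> powr p"
        using p by (intro powr_mono2) auto
      also have "\<dots> \<le> 2 powr p * (norm (F n x - f x) powr p + norm (f x) powr p)"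
        using powr_sum_bound[of p "norm (F n x - f x)" "norm (f x)"] p by simp
      finally show "norm (norm (F n x) powr p) \<le> norm (2 powr p * (norm (F n x - f x) powr p + norm (f x) powr p))"
        by simp
    qed
  qed measurable
  then have "Lp_fun p (F n)" for n by (simp add: Lp_fun_def F)
  moreover have "(\<lambda>n. Lp_norm p (\<lambda>x. F n x - f x)) \<longlonglongrightarrow> 0"
  proof -
    have "(\<lambda>n. ennreal (LINT x|lebesgue. norm (F n x - f x) powr p)) \<longlonglongrightarrow> ennreal 0"
    proof (rule tendsto_sandwich[OF _ _ tendsto_const])
      show "\<forall>\<^sub>F n in sequentially. ennreal (LINT x|lebesgue. norm (F n x - f x) powr p) \<le> e n"
        using bound by (simp add: nn_integral_eq_integral[OF diff_int])
      show "e \<longlonglongrightarrow> ennreal 0" using lim by simp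
    qed simp
    then have "(\<lambda>n. LINT x|lebesgue. norm (F n x - f x) powr p) \<longlonglongrightarrow> 0"
      by (subst (asm) tendsto_ennreal_iff) (auto intro!: always_eventually integral_nonneg_AE)
    then have "(\<lambda>n. (LINT x|lebesgue. norm (F n x - f x) powr p) powr (1 / p)) \<longlonglongrightarrow> 0 powr (1 / p)"
      using p by (intro tendsto_powr' tendsto_const) (auto intro!: always_eventually integral_nonneg_AE)
    then show ?thesis by (simp add: Lp_norm_def)
  qed
  ultimately show ?thesis using f by (simp add: Lp_tendsto_def)
qed

lemma radial_density_borel_version:
  fixes \<rho> :: "real ^ 'n \<Rightarrow> real"
  assumes radial: "radial \<rho>" and nonneg: "\<And>x. 0 \<le> \<rho> x"
    and int: "integrable lebesgue \<rho>" and int1: "(LINT x|lebesgue. \<rho> x) = 1"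
  obtains \<rho>' where "borel_version \<rho> \<rho>'" "radial_density \<rho>'"
proof -
  obtain r where r: "borel_version \<rho> r"
    using borel_version_exists[OF borel_measurable_integrable[OF int]] .
  define \<rho>' where "\<rho>' x = max 0 (r x)" for x
  have [measurable]: "r \<in> borel_measurable borel" and r_eq: "AE x in lborel. \<rho> x = r x"
    using r by (auto simp: borel_version_def)
  have eq: "AE x in lborel. \<rho> x = \<rho>' x"
    using r_eq
  proof eventually_elim
    case (elim x)
    then show ?case using nonneg[of x] by (simp add: \<rho>'_def)
  qed
  have meas [measurable]: "\<rho>' \<in> borel_measurable borel"
    unfolding \<rho>'_def[abs_def] by measurable
  have "radial_density \<rho>'"
  proof
    show "0 \<le> \<rho>' h" for h by (simp add: \<rho>'_def)
    show "integrable lborel \<rho>'" using lebesgue_eq_borel(2)[OF meas eq] int by simp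
    show "(LINT h|lborel. \<rho>' h) = 1" using lebesgue_eq_borel(3)[OF meas eq] int1 by simp
    fix T :: "real ^ 'n \<Rightarrow> real ^ 'n"
    assume T: "orthogonal_transformation T"
    have T_meas: "T \<in> borel_measurable lborel"
      unfolding measurable_lborel2
      by (intro borel_measurable_continuous_onI linear_continuous_on linear_conv_bounded_linear[THEN iffD1]
          orthogonal_transformation_linear[OF T])
    have "AE h in distr lborel borel T. \<rho> h = \<rho>' h"
      unfolding lborel_distr_orthogonal[OF T] by (rule eq)
    from AE_distrD[OF T_meas this] have "AE h in lborel. \<rho> (T h) = \<rho>' (T h)" .
    then show "AE h in lborel. \<rho>' (T h) = \<rho>' h"
      using eq
    proof eventually_elim
      case (elim h)
      have "\<rho> (T h) = \<rho> h"
        using radial orthogonal_transformation_norm[OF T, of h] unfolding radial_def by blast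
      with elim show ?case by simp
    qed
  qed
  moreover have "borel_version \<rho> \<rho>'" using meas eq by (simp add: borel_version_def)
  ultimately show ?thesis using that by blast
qed

text \<open>
  For each \<open>h\<close> the formula holds for almost every \<open>x\<close>; the non-local Hessian needs it for almost every
  \<open>x\<close> and then almost every \<open>h\<close>, which Fubini's theorem supplies.
\<close>

lemma second_difference_AE_AE:
  fixes u :: "real ^ 'n \<Rightarrow> real" and G :: "'n \<Rightarrow> 'n \<Rightarrow> real ^ 'n \<Rightarrow> real"
  assumes u [measurable]: "u \<in> borel_measurable borel" and G [measurable]: "\<And>i j. G i j \<in> borel_measurable borel"
    and u_loc: "\<And>R. set_integrable lborel (cball 0 R) u"
    and G_loc: "\<And>i j R. set_integrable lborel (cball 0 R) (G i j)"
    and weak: "\<And>i j \<phi> R. \<phi> \<in> bump_algebra \<Longrightarrow> (\<And>x. R < norm x \<Longrightarrow> \<phi> x = 0) \<Longrightarrow>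
      (LINT x|lborel. u x * partial_deriv i (partial_deriv j \<phi>) x) = (LINT x|lborel. G i j x * \<phi> x)"
  shows "AE x in lborel. AE h in lborel. u (x + h) - 2 * u x + u (x - h) =
    (\<Sum>i\<in>UNIV. \<Sum>j\<in>UNIV. h $ i * h $ j * hat_average (G i j) h x)"
proof -
  have [measurable]: "(\<lambda>h :: real ^ 'n. h $ i) \<in> borel_measurable borel" for i
    by (intro borel_measurable_continuous_onI continuous_intros)
  have comp: "(\<lambda>z. (snd z :: real ^ 'n) $ i) \<in> borel_measurable (lborel \<Otimes>\<^sub>M lborel)" for i
    by measurable
  have avg: "(\<lambda>z. hat_average (G i j) (snd z) (fst z)) \<in> borel_measurable (lborel \<Otimes>\<^sub>M lborel)" for i j
    unfolding hat_average_def by measurable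
  have lhs: "(\<lambda>z. u (fst z + snd z) - 2 * u (fst z) + u (fst z - snd z)) \<in> borel_measurable (lborel \<Otimes>\<^sub>M lborel)"
    by measurable
  have rhs: "(\<lambda>z. \<Sum>i\<in>UNIV. \<Sum>j\<in>UNIV. snd z $ i * snd z $ j * hat_average (G i j) (snd z) (fst z)) \<in> borel_measurable (lborel \<Otimes>\<^sub>M lborel)"
    by (intro borel_measurable_sum borel_measurable_times comp avg)
  have "{z \<in> space (lborel \<Otimes>\<^sub>M lborel). u (fst z + snd z) - 2 * u (fst z) + u (fst z - snd z) =
      (\<Sum>i\<in>UNIV. \<Sum>j\<in>UNIV. snd z $ i * snd z $ j * hat_average (G i j) (snd z) (fst z))} \<in> sets (lborel \<Otimes>\<^sub>M lborel)"
    by (rule borel_measurable_eq[OF lhs rhs])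
  note commute = lborel_pair.AE_commute[OF this]
  have "AE x in lborel. u (x + h) - 2 * u x + u (x - h) =
      (\<Sum>i\<in>UNIV. \<Sum>j\<in>UNIV. h $ i * h $ j * hat_average (G i j) h x)" for h
    unfolding hat_average_def by (rule weak_second_difference[OF u G u_loc G_loc]) (rule weak)
  then show ?thesis
    unfolding commute by (rule AE_I2)
qed

section \<open>Convergence of the non-local Hessian\<close>

theorem theorem1p5:
  fixes \<rho> :: "nat \<Rightarrow> real ^ 'n \<Rightarrow> real"
    and u :: "real ^ 'n \<Rightarrow> real"
    and G :: "real ^ 'n \<Rightarrow> real ^ 'n ^ 'n"
    and p :: real
  assumes rho_radial: "\<And>n. radial (\<rho> n)"
    and rho_nonneg: "\<And>n x. 0 \<le> \<rho> n x"
    and rho_integrable: "\<And>n. integrable lebesgue (\<rho> n)"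
    and rho_integral: "\<And>n. (LINT x|lebesgue. \<rho> n x) = 1"
    and rho_concentrates:
      "\<And>\<gamma>. 0 < \<gamma> \<Longrightarrow> (\<lambda>n. LINT x:{x. \<gamma> < norm x}|lebesgue. \<rho> n x) \<longlonglongrightarrow> 0"
    and p_ge_1: "1 \<le> p"
    and u_sobolev: "sobolev 2 p u"
    and weak_hessian: "has_weak_hessian u G"
  shows "(\<forall>n. AE x in lebesgue. integrable lebesgue (nonlocal_hessian_integrand (\<rho> n) u x))
    \<and> Lp_tendsto p (\<lambda>n. nonlocal_hessian (\<rho> n) u) G"
proof -
  have weak: "weak_deriv [i, j] u (\<lambda>x. G x $ i $ j)" for i j
    using weak_hessian by (simp add: has_weak_hessian_def)
  have u_Lp: "Lp_fun p u" using u_sobolev by (simp add: sobolev_def)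
  then obtain u' where u': "borel_version u u'"
    using borel_version_exists by (auto simp: Lp_fun_def)
  then have u'_meas: "u' \<in> borel_measurable borel" and u'_eq: "AE x in lborel. u x = u' x"
    by (auto simp: borel_version_def)
  have u_loc: "locally_integrable u" using weak by (simp add: weak_deriv_def)
  have G_loc: "locally_integrable (\<lambda>x. G x $ i $ j)" for i j
    using weak[of i j] by (simp add: weak_deriv_def)
  have "\<exists>g. borel_version (\<lambda>x. G x $ i $ j) g" for i j
    using borel_version_exists[OF locally_integrable_measurable[OF G_loc[of i j]]] by blast
  then obtain G' where G': "\<And>i j. borel_version (\<lambda>x. G x $ i $ j) (G' i j)" by metis
  then have G'_meas: "G' i j \<in> borel_measurable borel" and G'_eq: "AE x in lborel. G x $ i $ j = G' i j x" for i j
    by (auto simp: borel_version_def)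
  have u'_loc: "set_integrable lborel (cball 0 R) u'" for R
    by (rule locally_integrable_borel_version[OF u_loc u'])
  have G'_loc: "set_integrable lborel (cball 0 R) (G' i j)" for i j R
    by (rule locally_integrable_borel_version[OF G_loc G'])
  have weak': "(LINT x|lborel. u' x * partial_deriv i (partial_deriv j \<phi>) x) = (LINT x|lborel. G' i j x * \<phi> x)"
    if "\<phi> \<in> bump_algebra" "\<And>x. R < norm x \<Longrightarrow> \<phi> x = 0" for i j \<phi> R
    using weak_deriv_bump[OF weak[of i j] u' G' that] by simp
  \<comment> \<open>Second derivatives of bumps commute, hence so do weak ones.\<close>
  have G'_sym: "AE x in lborel. G' i j x = G' j i x" for i j
  proof (rule equal_against_bumps_imp_equal[OF G'_meas G'_meas G'_loc G'_loc])
    fix \<phi> :: "real ^ 'n \<Rightarrow> real" and R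
    assume \<phi>: "\<phi> \<in> bump_algebra" "\<And>x. R < norm x \<Longrightarrow> \<phi> x = 0"
    show "(LINT x|lborel. G' i j x * \<phi> x) = (LINT x|lborel. G' j i x * \<phi> x)"
      using weak'[OF \<phi>, where i = i and j = j] weak'[OF \<phi>, where i = j and j = i] bump_algebra_symmetric[OF \<phi>(1), of i j] by simp
  qed
  \<comment> \<open>The hypothesis on \<open>G\<close> gives only local integrability of its entries; integrability of the \<open>p\<close>-th
    power comes from the derivatives in the Sobolev space, by uniqueness.\<close>
  have G'_fin: "(\<integral>\<^sup>+x. ennreal (\<bar>G' i j x\<bar> powr p) \<partial>lborel) < \<infinity>" for i j
  proof -
    obtain v where v: "Lp_fun p v" "weak_deriv [i, j] u v"
      using u_sobolev unfolding sobolev_def by (metis length_Cons list.size(3) numeral_2_eq_2 order_refl)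
    then obtain v' where v': "borel_version v v'"
      using borel_version_exists by (auto simp: Lp_fun_def)
    then have v'_meas: "v' \<in> borel_measurable borel" by (simp add: borel_version_def)
    have v_loc: "locally_integrable v" using v(2) by (simp add: weak_deriv_def)
    have "AE x in lborel. G' i j x = v' x"
    proof (rule equal_against_bumps_imp_equal[OF G'_meas v'_meas G'_loc locally_integrable_borel_version[OF v_loc v']])
      fix \<phi> :: "real ^ 'n \<Rightarrow> real" and R
      assume \<phi>: "\<phi> \<in> bump_algebra" "\<And>x. R < norm x \<Longrightarrow> \<phi> x = 0"
      show "(LINT x|lborel. G' i j x * \<phi> x) = (LINT x|lborel. v' x * \<phi> x)"
        using weak'[OF \<phi>, where i = i and j = j] weak_deriv_bump[OF v(2) u' v' \<phi>] by simp
    qed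
    then have "(\<integral>\<^sup>+x. ennreal (\<bar>G' i j x\<bar> powr p) \<partial>lborel) = (\<integral>\<^sup>+x. ennreal (\<bar>v' x\<bar> powr p) \<partial>lborel)"
      by (intro nn_integral_cong_AE) auto
    also have "\<dots> < \<infinity>" by (rule Lp_fun_borel_version[OF v(1) v'])
    finally show ?thesis .
  qed
  have "\<exists>r. borel_version (\<rho> n) r \<and> radial_density r" for n
    using radial_density_borel_version[OF rho_radial rho_nonneg rho_integrable rho_integral, of n] by blast
  then obtain \<rho>' where \<rho>': "\<And>n. borel_version (\<rho> n) (\<rho>' n)" "\<And>n. radial_density (\<rho>' n)" by metis
  then have \<rho>'_eq: "AE x in lborel. \<rho> n x = \<rho>' n x" for n
    by (auto simp: borel_version_def)
  note \<rho>'_props = radial_density.nonneg[OF \<rho>'(2)] radial_density.integrable[OF \<rho>'(2)]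
    radial_density.integral_1[OF \<rho>'(2)]
  have \<rho>'_meas [measurable]: "\<rho>' n \<in> borel_measurable borel" for n
    using \<rho>'(1) by (simp add: borel_version_def)
  \<comment> \<open>The common bound for the errors of all kernels.\<close>
  define E where "E n i j =
    (\<integral>\<^sup>+h. ennreal (\<rho>' n h) * (\<integral>\<^sup>+t. ennreal (hat t) * shift_dist p (G' i j) (- (t *\<^sub>R h)) \<partial>lborel) \<partial>lborel)" for n i j
  have E_fin: "E n i j < \<infinity>" for n i j
    unfolding E_def using p_ge_1
    by (intro hat_average_kernel_error_finite \<rho>'_props G'_meas G'_fin) simp
  have E_lim: "(\<lambda>n. E n i j) \<longlonglongrightarrow> 0" for i j
    unfolding E_def
  proof (rule concentrating_kernel_error_tendsto_0[OF p_ge_1 \<rho>'_props _ G'_meas G'_fin])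
    fix \<gamma> :: real
    assume "0 < \<gamma>"
    have "(LINT x:{x. \<gamma> < norm x}|lebesgue. \<rho> n x) = (LINT x:{x. \<gamma> < norm x}|lborel. \<rho>' n x)" for n
      unfolding set_lebesgue_integral_def
    proof (rule lebesgue_eq_borel(3))
      have "{x :: real ^ 'n. \<gamma> < norm x} \<in> sets borel"
        by (intro borel_open open_Collect_less continuous_intros)
      then show "(\<lambda>x. indicator {x. \<gamma> < norm x} x *\<^sub>R \<rho>' n x) \<in> borel_measurable borel"
        by (intro borel_measurable_scaleR borel_measurable_indicator \<rho>'_meas)
      show "AE x in lborel. indicator {x. \<gamma> < norm x} x *\<^sub>R \<rho> n x = indicator {x. \<gamma> < norm x} x *\<^sub>R \<rho>' n x"
        using \<rho>'_eq[of n] by eventually_elim simp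
    qed
    then show "(\<lambda>n. LINT x:{x. \<gamma> < norm x}|lborel. \<rho>' n x) \<longlonglongrightarrow> 0"
      using rho_concentrates[OF \<open>0 < \<gamma>\<close>] by simp
  qed
  define T where "T n i j k l x = (LINT h|lborel. \<rho>' n h * (hessian_kernel i j k l h * hat_average (G' i j) h x))"
    for n i j k l x
  define c where "c n i j k l = (LINT h|lborel. \<rho>' n h * hessian_kernel i j k l h)" for n i j k l
  note error = hat_average_kernel_error[OF p_ge_1 \<rho>'_props measurable_hessian_kernel abs_hessian_kernel_le G'_meas G'_fin]
  have T_int: "AE x in lborel. integrable lborel (\<lambda>h. \<rho>' n h * (hessian_kernel i j k l h * hat_average (G' i j) h x))" for n i j k l
    by (rule error(1))
  have T_err: "(\<integral>\<^sup>+x. ennreal (\<bar>T n i j k l x - c n i j k l * G' i j x\<bar> powr p) \<partial>lborel) \<le> E n i j" for n i j k l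
    unfolding T_def c_def E_def by (rule error(2))
  define C where "C = real CARD('n) * (real CARD('n) + 2) / 2"
  have C0: "0 \<le> C" by (simp add: C_def)
  \<comment> \<open>The second difference formula eliminates \<open>u\<close>. The functions \<open>u\<close> and \<open>u'\<close> agree at \<open>x + h\<close> and \<open>x - h\<close> for
    almost every \<open>h\<close>, whatever \<open>x\<close> is; at \<open>x\<close> itself they agree for almost every \<open>x\<close>.\<close>
  have pointwise: "AE x in lborel. integrable lebesgue (nonlocal_hessian_integrand (\<rho> n) u x) \<and>
      (\<forall>k l. nonlocal_hessian (\<rho> n) u x $ k $ l = C * (\<Sum>i\<in>UNIV. \<Sum>j\<in>UNIV. T n i j k l x))" for n
  proof -
    have diff: "AE x in lborel. AE h in lborel. u' (x + h) - 2 * u' x + u' (x - h) =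
        (\<Sum>i\<in>UNIV. \<Sum>j\<in>UNIV. h $ i * h $ j * hat_average (G' i j) h x)"
      by (rule second_difference_AE_AE[OF u'_meas G'_meas u'_loc G'_loc]) (rule weak')
    have ints: "AE x in lborel. \<forall>i j k l. integrable lborel (\<lambda>h. \<rho>' n h * (hessian_kernel i j k l h * hat_average (G' i j) h x))"
      using T_int by (simp add: AE_all_countable)
    show ?thesis
      using diff ints u'_eq
    proof eventually_elim
      case (elim x)
      have int: "integrable lborel (\<lambda>h. \<Sum>i\<in>UNIV. \<Sum>j\<in>UNIV. \<rho>' n h * (hessian_kernel i j k l h * hat_average (G' i j) h x))" for k l
        using elim(2) by (intro Bochner_Integration.integrable_sum) blast
      then have meas: "(\<lambda>h. \<Sum>i\<in>UNIV. \<Sum>j\<in>UNIV. \<rho>' n h * (hessian_kernel i j k l h * hat_average (G' i j) h x)) \<in> borel_measurable borel" for k l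
        using borel_measurable_integrable by fastforce
      have eq: "AE h in lborel. nonlocal_hessian_integrand (\<rho> n) u x h $ k $ l =
          (\<Sum>i\<in>UNIV. \<Sum>j\<in>UNIV. \<rho>' n h * (hessian_kernel i j k l h * hat_average (G' i j) h x))" for k l
        using elim(1) \<rho>'_eq[of n] AE_translate_reflect[OF u'_eq, of x]
      proof eventually_elim
        case (elim h)
        then have "u (x + h) - 2 * u x + u (x - h) = (\<Sum>i\<in>UNIV. \<Sum>j\<in>UNIV. h $ i * h $ j * hat_average (G' i j) h x)"
          using \<open>u x = u' x\<close> by simp
        from nonlocal_hessian_integrand_kernel[OF this] show ?case using elim(2) by simp
      qed
      have "integrable lebesgue (\<lambda>h. nonlocal_hessian_integrand (\<rho> n) u x h $ k $ l)" for k l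
        using lebesgue_eq_borel(2)[OF meas eq] int by blast
      note matrix = integrable_matrix[OF this]
      have "nonlocal_hessian (\<rho> n) u x $ k $ l = C * (\<Sum>i\<in>UNIV. \<Sum>j\<in>UNIV. T n i j k l x)" for k l
      proof -
        have "(LINT h|lebesgue. nonlocal_hessian_integrand (\<rho> n) u x h) $ k $ l =
            (LINT h|lborel. (\<Sum>i\<in>UNIV. \<Sum>j\<in>UNIV. \<rho>' n h * (hessian_kernel i j k l h * hat_average (G' i j) h x)))"
          unfolding matrix(2) by (rule lebesgue_eq_borel(3)[OF meas eq])
        also have "\<dots> = (\<Sum>i\<in>UNIV. \<Sum>j\<in>UNIV. T n i j k l x)"
          unfolding T_def using elim(2) by (simp add: Bochner_Integration.integral_sum)
        finally show ?thesis by (simp add: nonlocal_hessian_def C_def)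
      qed
      with matrix(1) show ?case by blast
    qed
  qed
  have T_meas [measurable]: "T n i j k l \<in> borel_measurable borel" for n i j k l
  proof -
    note [measurable] = G'_meas measurable_hessian_kernel
    have "(\<lambda>z. hat_average (G' i j) (snd z) (fst z)) \<in> borel_measurable (borel \<Otimes>\<^sub>M borel)"
      unfolding hat_average_def by measurable
    then have [measurable]: "(\<lambda>(x, h). hat_average (G' i j) h x) \<in> borel_measurable (borel \<Otimes>\<^sub>M borel)"
      by (simp add: case_prod_beta')
    show ?thesis unfolding T_def[abs_def] by measurable
  qed
  have hess_meas: "nonlocal_hessian (\<rho> n) u \<in> borel_measurable lebesgue" for n
  proof (rule measurable_matrix)
    fix k l
    show "(\<lambda>x. nonlocal_hessian (\<rho> n) u x $ k $ l) \<in> borel_measurable lebesgue"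
    proof (rule lebesgue_eq_borel(1))
      show "(\<lambda>x. C * (\<Sum>i\<in>UNIV. \<Sum>j\<in>UNIV. T n i j k l x)) \<in> borel_measurable borel"
        by measurable
      show "AE x in lborel. nonlocal_hessian (\<rho> n) u x $ k $ l = C * (\<Sum>i\<in>UNIV. \<Sum>j\<in>UNIV. T n i j k l x)"
        using pointwise[of n] by eventually_elim blast
    qed
  qed
  have G_meas: "G \<in> borel_measurable lebesgue"
    by (intro measurable_matrix locally_integrable_measurable G_loc)
  let ?I = "UNIV :: ('n \<times> 'n \<times> 'n \<times> 'n) set"
  define err where "err n q x = (case q of (k, l, i, j) \<Rightarrow> C * (T n i j k l x - c n i j k l * G' i j x))" for n q x
  have err_meas [measurable]: "err n q \<in> borel_measurable borel" for n q
  proof -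
    note [measurable] = G'_meas
    show ?thesis unfolding err_def[abs_def] by (cases q) simp
  qed
  \<comment> \<open>The limits of the averages add up to \<open>(G_kl + G_lk) / 2\<close>, which is \<open>G_kl\<close> by symmetry.\<close>
  have err_bound: "AE x in lborel. norm (nonlocal_hessian (\<rho> n) u x - G x) \<le> (\<Sum>q\<in>?I. \<bar>err n q x\<bar>)" for n
  proof -
    have G_all: "AE x in lborel. \<forall>k l. G x $ k $ l = G' k l x \<and> G' k l x = G' l k x"
      using G'_eq G'_sym by (simp add: AE_all_countable)
    show ?thesis
      using pointwise[of n] G_all
    proof eventually_elim
      case (elim x)
      have "nonlocal_hessian (\<rho> n) u x $ k $ l - G x $ k $ l = (\<Sum>i\<in>UNIV. \<Sum>j\<in>UNIV. err n (k, l, i, j) x)" for k l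
      proof -
        have "G x $ k $ l = (G' k l x + G' l k x) / 2" using elim(2) by simp
        also have "\<dots> = C * (\<Sum>i\<in>UNIV. \<Sum>j\<in>UNIV. c n i j k l * G' i j x)"
          unfolding C_def c_def by (rule radial_density.hessian_kernel_contraction[OF \<rho>'(2), symmetric])
        finally show ?thesis
          using elim(1) by (simp add: err_def right_diff_distrib sum_subtractf sum_distrib_left)
      qed
      then have "norm (nonlocal_hessian (\<rho> n) u x - G x) \<le>
          (\<Sum>k\<in>UNIV. \<Sum>l\<in>UNIV. \<bar>\<Sum>i\<in>UNIV. \<Sum>j\<in>UNIV. err n (k, l, i, j) x\<bar>)"
        using matrix_norm_le_sum[of "nonlocal_hessian (\<rho> n) u x - G x"] by simp
      also have "\<dots> \<le> (\<Sum>k\<in>UNIV. \<Sum>l\<in>UNIV. \<Sum>i\<in>UNIV. \<Sum>j\<in>UNIV. \<bar>err n (k, l, i, j) x\<bar>)"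
        by (intro sum_mono order.trans[OF sum_abs] sum_abs)
      also have "\<dots> = (\<Sum>q\<in>?I. \<bar>err n q x\<bar>)"
        by (simp add: sum.cartesian_product UNIV_Times_UNIV[symmetric] case_prod_beta' del: UNIV_Times_UNIV)
      finally show ?case .
    qed
  qed
  define K where "K = ennreal (real (card ?I) powr p) * ennreal (C powr p)"
  define e where "e n = K * (\<Sum>q\<in>?I. case q of (k, l, i, j) \<Rightarrow> E n i j)" for n
  \<comment> \<open>The \<open>p\<close>-th power of a sum of \<open>N^4\<close> terms costs only a constant factor.\<close>
  have bound: "(\<integral>\<^sup>+x. ennreal (norm (nonlocal_hessian (\<rho> n) u x - G x) powr p) \<partial>lebesgue) \<le> e n" for n
  proof -
    have "(\<integral>\<^sup>+x. ennreal (norm (nonlocal_hessian (\<rho> n) u x - G x) powr p) \<partial>lebesgue) \<le>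
        (\<integral>\<^sup>+x. ennreal (real (card ?I) powr p) * (\<Sum>q\<in>?I. ennreal (\<bar>err n q x\<bar> powr p)) \<partial>lebesgue)"
    proof (rule nn_integral_mono_AE, rule AE_completion)
      show "AE x in lborel. ennreal (norm (nonlocal_hessian (\<rho> n) u x - G x) powr p) \<le>
          ennreal (real (card ?I) powr p) * (\<Sum>q\<in>?I. ennreal (\<bar>err n q x\<bar> powr p))"
        using err_bound[of n]
      proof eventually_elim
        case (elim x)
        have "norm (nonlocal_hessian (\<rho> n) u x - G x) powr p \<le> \<bar>\<Sum>q\<in>?I. \<bar>err n q x\<bar>\<bar> powr p"
          using elim p_ge_1 by (intro powr_mono2) auto
        also have "\<dots> \<le> real (card ?I) powr p * (\<Sum>q\<in>?I. \<bar>err n q x\<bar> powr p)"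
          using p_ge_1 by (intro abs_sum_powr_le) auto
        finally show ?case
          by (simp add: ennreal_leI ennreal_mult'[symmetric] sum_ennreal sum_nonneg)
      qed
    qed
    also have "\<dots> = (\<integral>\<^sup>+x. ennreal (real (card ?I) powr p) * (\<Sum>q\<in>?I. ennreal (\<bar>err n q x\<bar> powr p)) \<partial>lborel)"
      by (rule nn_integral_completion)
    also have "\<dots> = ennreal (real (card ?I) powr p) * (\<Sum>q\<in>?I. \<integral>\<^sup>+x. ennreal (\<bar>err n q x\<bar> powr p) \<partial>lborel)"
      by (subst nn_integral_cmult, measurable, subst nn_integral_sum, measurable)
    also have "\<dots> \<le> ennreal (real (card ?I) powr p) * (\<Sum>q\<in>?I. ennreal (C powr p) * (case q of (k, l, i, j) \<Rightarrow> E n i j))"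
    proof (intro mult_left_mono sum_mono)
      fix q :: "'n \<times> 'n \<times> 'n \<times> 'n"
      obtain k l i j where q: "q = (k, l, i, j)" by (cases q)
      note [measurable] = G'_meas
      have "(\<integral>\<^sup>+x. ennreal (\<bar>err n q x\<bar> powr p) \<partial>lborel) =
          ennreal (C powr p) * (\<integral>\<^sup>+x. ennreal (\<bar>T n i j k l x - c n i j k l * G' i j x\<bar> powr p) \<partial>lborel)"
        using C0 by (subst nn_integral_cmult[symmetric]) (simp_all add: q err_def abs_mult powr_mult ennreal_mult)
      also have "\<dots> \<le> ennreal (C powr p) * E n i j"
        by (intro mult_left_mono T_err) simp
      finally show "(\<integral>\<^sup>+x. ennreal (\<bar>err n q x\<bar> powr p) \<partial>lborel) \<le>
          ennreal (C powr p) * (case q of (k, l, i, j) \<Rightarrow> E n i j)"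
        by (simp add: q)
    qed simp
    also have "\<dots> = e n"
      by (simp add: e_def K_def sum_distrib_left mult.assoc)
    finally show ?thesis .
  qed
  have K_fin: "K < \<infinity>" by (simp add: K_def ennreal_mult_less_top)
  have e_fin: "e n < \<infinity>" for n
    using K_fin E_fin by (auto simp: e_def ennreal_mult_less_top split: prod.splits)
  have e_lim: "e \<longlonglongrightarrow> 0"
  proof -
    have "(\<lambda>n. K * (\<Sum>q\<in>?I. case q of (k, l, i, j) \<Rightarrow> E n i j)) \<longlonglongrightarrow> K * (\<Sum>q\<in>?I. 0)"
      using K_fin E_lim by (intro ennreal_tendsto_cmult tendsto_sum) (auto split: prod.splits)
    then show ?thesis by (simp add: e_def[abs_def])
  qed
  have G_Lp: "Lp_fun p G"
    unfolding Lp_fun_def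
  proof
    show "integrable lebesgue (\<lambda>x. norm (G x) powr p)"
    proof (rule Bochner_Integration.integrable_bound)
      let ?J = "UNIV :: ('n \<times> 'n) set"
      show "integrable lebesgue (\<lambda>x. real (card ?J) powr p * (\<Sum>q\<in>?J. \<bar>G' (fst q) (snd q) x\<bar> powr p))"
      proof (intro integrable_mult_right Bochner_Integration.integrable_sum)
        fix q
        have "integrable lborel (\<lambda>x. \<bar>G' (fst q) (snd q) x\<bar> powr p)"
          using G'_fin G'_meas by (intro integrableI_nonneg) auto
        then show "integrable lebesgue (\<lambda>x. \<bar>G' (fst q) (snd q) x\<bar> powr p)"
          using integrable_completion borel_measurable_integrable by blast
      qed
      show "(\<lambda>x. norm (G x) powr p) \<in> borel_measurable lebesgue"
        using G_meas by measurable
      have "AE x in lborel. \<forall>k l. G x $ k $ l = G' k l x"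
        using G'_eq by (simp add: AE_all_countable)
      then have "AE x in lborel. norm (norm (G x) powr p) \<le>
          norm (real (card ?J) powr p * (\<Sum>q\<in>?J. \<bar>G' (fst q) (snd q) x\<bar> powr p))"
      proof eventually_elim
        case (elim x)
        have "norm (G x) \<le> (\<Sum>q\<in>?J. \<bar>G' (fst q) (snd q) x\<bar>)"
          using matrix_norm_le_sum[of "G x"] elim
          by (simp add: sum.cartesian_product UNIV_Times_UNIV[symmetric] case_prod_beta' del: UNIV_Times_UNIV)
        then have "norm (G x) powr p \<le> \<bar>\<Sum>q\<in>?J. \<bar>G' (fst q) (snd q) x\<bar>\<bar> powr p"
          using p_ge_1 by (intro powr_mono2) auto
        also have "\<dots> \<le> real (card ?J) powr p * (\<Sum>q\<in>?J. \<bar>G' (fst q) (snd q) x\<bar> powr p)"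
          using p_ge_1 by (intro abs_sum_powr_le) auto
        finally show ?case by (simp add: sum_nonneg)
      qed
      then show "AE x in lebesgue. norm (norm (G x) powr p) \<le>
          norm (real (card ?J) powr p * (\<Sum>q\<in>?J. \<bar>G' (fst q) (snd q) x\<bar> powr p))"
        by (rule AE_completion)
    qed
  qed (rule G_meas)
  have "AE x in lebesgue. integrable lebesgue (nonlocal_hessian_integrand (\<rho> n) u x)" for n
    using AE_completion[OF pointwise[of n]] by eventually_elim simp
  moreover have "Lp_tendsto p (\<lambda>n. nonlocal_hessian (\<rho> n) u) G"
    using p_ge_1 by (intro Lp_tendsto_from_error_bound[where e = e] hess_meas G_Lp bound e_fin e_lim) simp
  ultimately show ?thesis by blast
qed

end
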